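(* Let $(W_1(t))_{t\ge0}$ and $(W_2(t))_{t\ge0}$ be independent one-dimensional Brownian motions with $W_1(0)=W_2(0)=1$. Set $T_0=0$, $Y_0=1$, and for $k\ge1$ define $$T_k=\inf\Big\{t>T_{k-1}:\min_{j=1,2}\big(W_j(t)-W_j(T_{k-1})+Y_{k-1}\big)=0\Big\},$$ $$Y_k=\max_{j=1,2}\big(W_j(T_k)-W_j(T_{k-1})+Y_{k-1}\big).$$ Then, almost surely, $$\limsup_{n\to\infty}\frac{Y_n}{\sqrt{2T_n\log\log T_n}}=1.$$
   Context: This is the embedded sequence of a two-particle Fleming-Viot type process: two Brownian particles on $(0,\infty)$ start from a common point; when one hits $0$ it is killed and the other branches into two particles, which evolve as independent Brownian motions, and the scheme repeats. $T_k$ is the time of the $k$-th branching and $Y_k$ is the position of the surviving particle at that time. It is known that $T_k\to\infty$ almost surely. *)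

theory Defs
  imports "HOL-Probability.Probability"
begin

context prob_space
begin

text \<open>One-dimensional Brownian motion started at \<open>x\<close>, with time index restricted to \<open>t \<ge> 0\<close>.
  The second parameter of \<^const>\<open>normal_density\<close> is the standard deviation, so the increment over
  \<open>[s, t]\<close> has variance \<open>t - s\<close>.\<close>

definition brownian_motion :: "real \<Rightarrow> (real \<Rightarrow> 'a \<Rightarrow> real) \<Rightarrow> bool" where
  "brownian_motion x W \<longleftrightarrow>
     (\<forall>t\<ge>0. random_variable borel (W t)) \<and>
     (AE \<omega> in M. W 0 \<omega> = x) \<and>
     (\<forall>(n::nat) (s::nat \<Rightarrow> real). 0 \<le> s 0 \<and> (\<forall>i<n. s i \<le> s (Suc i)) \<longrightarrow>
        indep_vars (\<lambda>_. borel) (\<lambda>i \<omega>. W (s (Suc i)) \<omega> - W (s i) \<omega>) {..<n}) \<and>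
     (\<forall>s t. 0 \<le> s \<and> s < t \<longrightarrow>
        distributed M lborel (\<lambda>\<omega>. W t \<omega> - W s \<omega>) (normal_density 0 (sqrt (t - s)))) \<and>
     (AE \<omega> in M. continuous_on {0..} (\<lambda>t. W t \<omega>))"

text \<open>Independence of whole processes, i.e. of the random elements they induce in the product
  space of real functions on \<open>[0, \<infinity>)\<close> with the cylinder sigma-algebra.\<close>

definition indep_processes :: "(real \<Rightarrow> 'a \<Rightarrow> real) \<Rightarrow> (real \<Rightarrow> 'a \<Rightarrow> real) \<Rightarrow> bool" where
  "indep_processes V W \<longleftrightarrow>
     indep_var (Pi\<^sub>M {0..} (\<lambda>_. borel)) (\<lambda>\<omega>. \<lambda>t\<in>{0..}. V t \<omega>)
               (Pi\<^sub>M {0..} (\<lambda>_. borel)) (\<lambda>\<omega>. \<lambda>t\<in>{0..}. W t \<omega>)"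

end

text \<open>Branching times and positions of the surviving particle, as functionals of a pair of paths.
  If the particles never hit \<open>0\<close> (an event of probability zero for Brownian paths) the infimum
  is that of the empty set of reals, an unspecified real number.\<close>

fun branch_time :: "(real \<Rightarrow> real) \<Rightarrow> (real \<Rightarrow> real) \<Rightarrow> nat \<Rightarrow> real"
  and branch_pos :: "(real \<Rightarrow> real) \<Rightarrow> (real \<Rightarrow> real) \<Rightarrow> nat \<Rightarrow> real" where
  "branch_time w1 w2 0 = 0"
| "branch_time w1 w2 (Suc k) =
     Inf {t. t > branch_time w1 w2 k \<and>
       min (w1 t - w1 (branch_time w1 w2 k) + branch_pos w1 w2 k)
           (w2 t - w2 (branch_time w1 w2 k) + branch_pos w1 w2 k) = 0}"
| "branch_pos w1 w2 0 = 1"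
| "branch_pos w1 w2 (Suc k) =
     max (w1 (branch_time w1 w2 (Suc k)) - w1 (branch_time w1 w2 k) + branch_pos w1 w2 k)
         (w2 (branch_time w1 w2 (Suc k)) - w2 (branch_time w1 w2 k) + branch_pos w1 w2 k)"

end

theory Submission
  imports Defs "HOL-Real_Asymp.Real_Asymp"
begin

text \<open>The argument has a deterministic half and a probabilistic half, and it avoids the strong Markov
property: Brownian motion is only ever observed on deterministic grids.

Between two branchings particle \<open>j\<close> sits at \<open>w j t + offset j n\<close>, where the offset is constant on the
\<open>n\<close>-th interval and never decreases in \<open>n\<close>, because a particle that dies reappears at the survivor,
that is, above the origin. Hence the position \<open>R j\<close> of particle \<open>j\<close> satisfies
\<open>R j t \<ge> R j s + (w j t - w j s)\<close> for \<open>s \<le> t\<close>, and the position of the survivor is a sum of increments of \<open>w\<close>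
along a \<^emph>\<open>spine\<close> that selects, on each interval, the particle which survives it.

\<^emph>\<open>Upper bound\<close> (\<open>pos_bound\<close>). Write \<open>a(x) = sqrt (2 x ln (ln x))\<close>, and look at the spine up to time \<open>x\<close>
from the last branching with position below \<open>\<epsilon> a(x)\<close> on. Each complete later interval starts above that level and so contains a drop of size
\<open>\<epsilon> a(x)\<close> of one Brownian path, so by uniform continuity on the scale of the law of the iterated
logarithm it lasts a fixed fraction of \<open>x\<close>, and there are boundedly many of them. Rounding the branching times
to a grid of \<open>m\<close> cells therefore costs little, and what is left is at most the sum over the cells of
\<open>max 0 (max (\<Delta>w True) (\<Delta>w False))\<close>. Choosing one of the particles or none in every cell gives \<open>3 ^ m\<close> sums, each a Gaussian
variable of variance at most \<open>x\<close>; as \<open>m\<close> is fixed, that factor does not change the exponent in the Chernoff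
bound (\<open>grid_sum_tail\<close>), and the first Borel--Cantelli lemma along geometric scales gives the constant \<open>1\<close>.

\<^emph>\<open>Lower bound\<close> (\<open>driven_branch\<close>). Infinitely often, by the second Borel--Cantelli lemma applied to disjoint
time blocks, the second path rises almost linearly to almost \<open>a(x)\<close>, while the first creeps up slightly
and then falls in a short final phase by more than its particle can be high. The creeping path protects the
first particle until the final phase, and there it has to die; at that moment the other particle is
almost at \<open>a(x)\<close>.

\<^emph>\<open>No accumulation of branchings\<close> (\<open>AE_no_common_record\<close>). If the branching times had a finite limit, or if both
particles died together, then both Brownian paths would have a strict running minimum there. Planar
Brownian motion reflected in the quadrant does not hit the corner: minus the logarithm of the distance to
the corner, suitably corrected, gives a nonnegative almost-supermartingale \<open>psi\<close> for the walk observed on a grid,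
and it is large near the corner.\<close>

section \<open>The branching system of a pair of paths\<close>

text \<open>The properties of a pair of paths that make all branching times well defined and unbounded. The
third one says that no positive time is a strict running minimum at a nonpositive level for both paths at
once; the fourth one forces the first particle to die eventually.\<close>

locale branching_pair =
  fixes w :: "bool \<Rightarrow> real \<Rightarrow> real"
  assumes cont: "\<And>j. continuous_on {0..} (w j)"
    and start: "\<And>j. w j 0 = 1"
    and no_common_record: "\<And>t. t > 0 \<Longrightarrow> \<exists>j. w j t > 0 \<or> (\<exists>s\<in>{0..<t}. w j s \<le> w j t)"
    and unbounded_below: "\<And>K. \<exists>t\<ge>0. w True t < K"
begin

definition T :: "nat \<Rightarrow> real" where "T = branch_time (w True) (w False)"
definition Y :: "nat \<Rightarrow> real" where "Y = branch_pos (w True) (w False)"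
text \<open>On the \<open>n\<close>-th interval particle \<open>j\<close> is at \<open>w j t + offset j n\<close>; the offset is the sum of the upward jumps which
that particle has made so far.\<close>

definition offset :: "bool \<Rightarrow> nat \<Rightarrow> real" where "offset j n = Y n - w j (T n)"

lemma T_0 [simp]: "T 0 = 0" and Y_0 [simp]: "Y 0 = 1"
  by (simp_all add: T_def Y_def)

lemma T_Suc: "T (Suc n) =
    Inf {t. t > T n \<and> min (w True t + offset True n) (w False t + offset False n) = 0}"
  unfolding T_def Y_def offset_def by (simp add: algebra_simps)

lemma Y_Suc: "Y (Suc n) =
    max (w True (T (Suc n)) + offset True n) (w False (T (Suc n)) + offset False n)"
  unfolding T_def Y_def offset_def by (simp add: algebra_simps)

lemma Y_eq: "Y n = w j (T n) + offset j n"
  by (simp add: offset_def)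

text \<open>Both particles continue from the larger of the two positions, so a jump can only go up.\<close>

lemma offset_Suc_ge: "offset j n \<le> offset j (Suc n)"
  using Y_Suc[of n] unfolding offset_def[of j "Suc n"] by (cases j) auto

lemma offset_mono: "n \<le> m \<Longrightarrow> offset j n \<le> offset j m"
  by (rule lift_Suc_mono_le[of "offset j"]) (auto intro: offset_Suc_ge)

lemma offset_0 [simp]: "offset j 0 = 0"
  by (simp add: offset_def start)

text \<open>The infimum in the definition of the next branching time is over a nonempty set, since the first
path falls below every level.\<close>

lemma hit_after:
  assumes "T n \<ge> 0" "Y n > 0"
  shows "\<exists>t>T n. min (w True t + offset True n) (w False t + offset False n) = 0"
proof -
  define g where "g t = min (w True t + offset True n) (w False t + offset False n)" for t
  have cg: "continuous_on {0..} g"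
    unfolding g_def by (intro continuous_intros cont)
  have "compact (w True ` {0..T n})"
    by (intro compact_continuous_image continuous_on_subset[OF cont]) auto
  then obtain B where B: "\<And>t. t \<in> {0..T n} \<Longrightarrow> \<bar>w True t\<bar> \<le> B"
    by (metis bounded_iff compact_imp_bounded image_eqI real_norm_def)
  obtain t where t: "t \<ge> 0" "w True t < min (- B) (- offset True n)"
    using unbounded_below by blast
  have "t > T n"
    using B[of t] t by (cases "t \<le> T n") auto
  moreover have "g t < 0" using t by (auto simp: g_def)
  moreover have "g (T n) > 0" using assms by (simp add: g_def flip: Y_eq)
  moreover have "continuous_on {T n..t} g"
    using assms by (intro continuous_on_subset[OF cg]) auto
  ultimately obtain s where "T n \<le> s" "s \<le> t" "g s = 0"
    using IVT2'[of g t 0 "T n"] by force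
  then show ?thesis
    using \<open>g (T n) > 0\<close> by (intro exI[of _ s]) (auto simp: g_def less_le)
qed

lemma first_hit:
  assumes "T n \<ge> 0" "Y n > 0"
  shows T_less_Suc_if: "T n < T (Suc n)"
    and min_hit_if: "min (w True (T (Suc n)) + offset True n) (w False (T (Suc n)) + offset False n) = 0"
    and alive_if: "\<And>t j. T n \<le> t \<Longrightarrow> t < T (Suc n) \<Longrightarrow> w j t + offset j n > 0"
proof -
  define g where "g t = min (w True t + offset True n) (w False t + offset False n)" for t
  define S where "S = {t. t > T n \<and> g t = 0}"
  have cg: "continuous_on {0..} g"
    unfolding g_def by (intro continuous_intros cont)
  have gT: "g (T n) > 0" using assms by (simp add: g_def flip: Y_eq)
  have S_eq: "S = {T n..} \<inter> g -` {0}"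
    using gT by (auto simp: S_def less_le)
  have cl: "closed S"
    unfolding S_eq using assms
    by (intro continuous_closed_preimage continuous_on_subset[OF cg]) auto
  have ne: "S \<noteq> {}" using hit_after[OF assms] by (auto simp: S_def g_def)
  have bd: "bdd_below S" by (auto simp: S_def intro!: bdd_belowI[of _ "T n"])
  have TS: "T (Suc n) = Inf S" by (simp add: T_Suc S_def g_def)
  have "Inf S \<in> S" by (rule closed_contains_Inf[OF ne bd cl])
  then show "T n < T (Suc n)"
    and "min (w True (T (Suc n)) + offset True n) (w False (T (Suc n)) + offset False n) = 0"
    by (auto simp: TS S_def g_def)
  fix t j assume t: "T n \<le> t" "t < T (Suc n)"
  have "g t > 0"
  proof (rule ccontr)
    assume "\<not> g t > 0"
    moreover have "continuous_on {T n..t} g"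
      using assms by (intro continuous_on_subset[OF cg]) auto
    ultimately obtain s where s: "T n \<le> s" "s \<le> t" "g s = 0"
      using IVT2'[of g t 0 "T n"] gT t by force
    then have "s \<in> S" by (simp add: S_eq)
    then have "Inf S \<le> s" by (rule cInf_lower[OF _ bd])
    with s t TS show False by simp
  qed
  then show "w j t + offset j n > 0" by (cases j) (auto simp: g_def)
qed

lemma find_interval:
  assumes "T 0 \<le> s" "s < T m"
  obtains n where "n < m" "T n \<le> s" "s < T (Suc n)"
  using assms
proof (induction m arbitrary: thesis)
  case 0 then show ?case by simp
next
  case (Suc m)
  show ?case
  proof (cases "s < T m")
    case True
    with Suc.IH[OF _ Suc.prems(2)] Suc.prems(1) show ?thesis by (metis less_SucI)
  next
    case False
    with Suc.prems show ?thesis by (meson lessI not_less)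
  qed
qed

lemma not_common_record:
  assumes t: "t > 0" and le0: "\<And>j. w j t \<le> 0"
    and rec: "\<And>j s. 0 \<le> s \<Longrightarrow> s < t \<Longrightarrow> w j t < w j s"
  shows False
  using no_common_record[OF t] le0 rec by (meson atLeastLessThan_iff linorder_not_less)

text \<open>The survivor has a positive position because two simultaneous deaths would make the branching time
a common record of the two paths: at that time \<open>w j\<close> equals minus its offset, whereas earlier it was above
minus a smaller offset.\<close>

lemma T_nonneg_and_Y_pos: "T n \<ge> 0 \<and> Y n > 0"
proof (induction n rule: less_induct)
  case (less n)
  show ?case
  proof (cases n)
    case 0 then show ?thesis by simp
  next
    case (Suc m)
    have IH: "T i \<ge> 0" "Y i > 0" if "i \<le> m" for i using less[of i] that Suc by auto
    have lt: "T i < T (Suc i)" if "i \<le> m" for i using first_hit(1)[OF IH] that by blast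
    have "T m < T n" using lt[of m] Suc by simp
    then have T0: "T n > 0" using IH[of m] by simp
    have "Y n \<ge> 0" using Y_Suc[of m] first_hit(2)[OF IH, of m] Suc by (simp add: max_def min_def split: if_splits)
    moreover have "Y n \<noteq> 0"
    proof
      assume Y0: "Y n = 0"
      have eq: "w j (T n) = - offset j m" for j
        using Y0 Y_Suc[of m] first_hit(2)[OF IH, of m] Suc by (cases j) (auto simp: max_def min_def split: if_splits)
      show False
      proof (rule not_common_record[OF T0])
        show "w j (T n) \<le> 0" for j using eq[of j] offset_mono[of 0 m j] by simp
        fix j s assume "0 \<le> s" "s < T n"
        then obtain i where i: "i < n" "T i \<le> s" "s < T (Suc i)"
          using find_interval[of s n] by auto
        then have "w j s + offset j i > 0" using first_hit(3)[OF IH] Suc by simp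
        with eq[of j] offset_mono[of i m j] i Suc show "w j (T n) < w j s" by simp
      qed
    qed
    ultimately show ?thesis using T0 by simp
  qed
qed

lemma T_nonneg [simp]: "T n \<ge> 0" and Y_pos [simp]: "Y n > 0"
  using T_nonneg_and_Y_pos by auto

lemmas T_less_Suc = first_hit(1)[OF T_nonneg Y_pos]
  and min_hit = first_hit(2)[OF T_nonneg Y_pos]
  and alive = first_hit(3)[OF T_nonneg Y_pos]

lemma T_strict_mono: "strict_mono T"
  by (simp add: strict_mono_Suc_iff T_less_Suc)

lemma killed_drop: "\<exists>j. w j (T (Suc n)) - w j (T n) = - Y n"
proof -
  from min_hit[of n] obtain j where "w j (T (Suc n)) + offset j n = 0"
    by (auto simp: min_def split: if_splits)
  then show ?thesis unfolding offset_def by (intro exI[of _ j]) simp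
qed

lemma survivor_step: "\<exists>j. Y (Suc n) = Y n + (w j (T (Suc n)) - w j (T n))"
proof -
  from Y_Suc[of n] obtain j where "Y (Suc n) = w j (T (Suc n)) + offset j n"
    by (auto simp: max_def split: if_splits)
  then show ?thesis unfolding offset_def by (intro exI[of _ j]) simp
qed

text \<open>Suppose \<open>T n\<close> increases to a finite \<open>L\<close>. One of the paths drops by \<open>Y n\<close> on the \<open>n\<close>-th interval, so \<open>Y n \<longlonglongrightarrow> 0\<close> by
continuity at \<open>L\<close>, and then \<open>offset j n\<close> increases to \<open>- w j L\<close>. Since a particle is at a positive position before \<open>L\<close>,
this makes \<open>L\<close> a common record.\<close>

theorem T_at_top: "filterlim T at_top sequentially"
proof (rule ccontr)
  assume "\<not> filterlim T at_top sequentially"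
  then obtain B where B0: "\<not> (\<exists>N. \<forall>n\<ge>N. B \<le> T n)"
    unfolding filterlim_at_top eventually_sequentially by auto
  have B: "T n \<le> B" for n
  proof -
    obtain m where "m \<ge> n" "T m < B" using B0 by (metis not_less)
    then show ?thesis using T_strict_mono by (metis less_imp_le order_trans strict_mono_less_eq)
  qed
  have "Bseq T" by (rule BseqI'[of _ B]) (simp add: B)
  then have "convergent T"
    using T_strict_mono by (intro Bseq_mono_convergent) (auto simp: strict_mono_less_eq)
  then obtain L where L: "T \<longlonglongrightarrow> L" by (auto simp: convergent_def)
  have TL: "T n < L" for n
  proof -
    have "T (Suc n) \<le> L"
      using T_strict_mono by (intro LIMSEQ_le_const[OF L]) (auto simp: strict_mono_less_eq)
    with T_less_Suc[of n] show ?thesis by simp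
  qed
  have L0: "L > 0" using TL[of 0] by simp
  have wlim: "(\<lambda>n. w j (T n)) \<longlonglongrightarrow> w j L" for j
    using continuous_on_tendsto_compose[OF cont L, of j] L0 by (auto intro: always_eventually)
  have "Y \<longlonglongrightarrow> 0"
  proof (rule tendsto_sandwich[OF _ _ tendsto_const])
    show "\<forall>\<^sub>F n in sequentially. 0 \<le> Y n" by (simp add: less_imp_le)
    show "\<forall>\<^sub>F n in sequentially. Y n \<le> \<bar>w True (T (Suc n)) - w True (T n)\<bar> + \<bar>w False (T (Suc n)) - w False (T n)\<bar>"
    proof (rule always_eventually, rule allI)
      fix n show "Y n \<le> \<bar>w True (T (Suc n)) - w True (T n)\<bar> + \<bar>w False (T (Suc n)) - w False (T n)\<bar>"
        using killed_drop[of n] Y_pos[of n] by (smt (verit) )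
    qed
    have "(\<lambda>n. \<bar>w j (T (Suc n)) - w j (T n)\<bar>) \<longlonglongrightarrow> \<bar>w j L - w j L\<bar>" for j
      by (intro tendsto_intros wlim LIMSEQ_Suc)
    from tendsto_add[OF this[of True] this[of False]]
    show "(\<lambda>n. \<bar>w True (T (Suc n)) - w True (T n)\<bar> + \<bar>w False (T (Suc n)) - w False (T n)\<bar>) \<longlonglongrightarrow> 0"
      by simp
  qed
  then have off: "offset j \<longlonglongrightarrow> - w j L" for j
    unfolding offset_def using tendsto_diff[OF _ wlim[of j]] by fastforce
  have offle: "offset j n \<le> - w j L" for j n
    by (rule LIMSEQ_le_const[OF off]) (auto intro: offset_mono)
  show False
  proof (rule not_common_record[OF L0])
    show "w j L \<le> 0" for j using offle[of j 0] by simp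
    fix j s assume s: "0 \<le> s" "s < L"
    then obtain m where "s < T m"
      using order_tendstoD(1)[OF L] by (meson eventually_sequentially order_refl)
    with s obtain n where "T n \<le> s" "s < T (Suc n)" using find_interval[of s m] by auto
    then show "w j L < w j s" using alive[of n s j] offle[of j n] by simp
  qed
qed

end

section \<open>The upper bound for a pair of paths\<close>

definition lil_norm :: "real \<Rightarrow> real" where
  "lil_norm x = sqrt (2 * x * ln (ln x))"

definition grid_inc :: "(bool \<Rightarrow> real \<Rightarrow> real) \<Rightarrow> real \<Rightarrow> bool \<Rightarrow> nat \<Rightarrow> real" where
  "grid_inc w h j i = w j (real (Suc i) * h) - w j (real i * h)"

text \<open>The sum dominates every sum of increments along a spine that chooses, in each of the \<open>m\<close> cells, either one of the
particles or none; choosing none accounts for spines over a part of the interval.\<close>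

definition grid_sum :: "(bool \<Rightarrow> real \<Rightarrow> real) \<Rightarrow> real \<Rightarrow> nat \<Rightarrow> real" where
  "grid_sum w h m = (\<Sum>i<m. max 0 (max (grid_inc w h True i) (grid_inc w h False i)))"

definition osc_le :: "(bool \<Rightarrow> real \<Rightarrow> real) \<Rightarrow> real \<Rightarrow> real \<Rightarrow> real \<Rightarrow> bool" where
  "osc_le w B \<delta> e \<longleftrightarrow> (\<forall>j. \<forall>s\<in>{0..B}. \<forall>t\<in>{0..B}. \<bar>s - t\<bar> \<le> \<delta> \<longrightarrow> \<bar>w j s - w j t\<bar> \<le> e)"

text \<open>The paths are uniformly continuous on the scale of the law of the iterated logarithm, seen at the
times \<open>q ^ k\<close>: the mesh is a fraction of \<open>q ^ k\<close> that depends on \<open>\<eta>\<close> only.\<close>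

definition modulus_ok :: "(bool \<Rightarrow> real \<Rightarrow> real) \<Rightarrow> real \<Rightarrow> bool" where
  "modulus_ok w q \<longleftrightarrow> (\<forall>\<eta>>0. \<exists>m::nat. m > 0 \<and> (\<forall>\<^sub>F k in sequentially.
     osc_le w (q^k) (q^k / m) (\<eta> * lil_norm (q^k))))"

definition grid_ok :: "(bool \<Rightarrow> real \<Rightarrow> real) \<Rightarrow> real \<Rightarrow> bool" where
  "grid_ok w q \<longleftrightarrow> (\<forall>m>0. \<forall>\<eta>>0. \<forall>\<^sub>F k in sequentially.
     grid_sum w (q^k / real m) m \<le> (1 + \<eta>) * lil_norm (q^k))"

text \<open>At the scale \<open>x = N ^ (2 k)\<close>, with \<open>N ^ 2 d\<close> cells in \<open>[0, x]\<close>, the cells from number \<open>d\<close> on make up the block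
\<open>[x / N ^ 2, x]\<close>, so the blocks of different \<open>k\<close> do not overlap, and the last \<open>N d\<close> cells are the final
phase \<open>[(1 - 1/N) x, x]\<close>. In total the second path rises by almost \<open>lil_norm x\<close>; the first one rises by
at most \<open>lil_norm x / (2 N)\<close> and falls by at least \<open>4 lil_norm x / N\<close> in the final phase.\<close>

definition drive_event :: "(bool \<Rightarrow> real \<Rightarrow> real) \<Rightarrow> nat \<Rightarrow> nat \<Rightarrow> nat \<Rightarrow> bool" where
  "drive_event w N d k \<longleftrightarrow>
     (let m = N^2 * d; a = lil_norm ((real N^2)^k) / m; h = (real N^2)^k / m in
       \<forall>i\<in>{d..<m}. grid_inc w h False i \<ge> (1 - 20 / real N) * a \<and>
         (if i < m - N * d then a / (4 * real N) \<le> grid_inc w h True i \<and> grid_inc w h True i \<le> a / (2 * real N)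
          else grid_inc w h True i \<le> - 4 * a))"

lemma lil_norm_at_top: "filterlim lil_norm at_top at_top"
  unfolding lil_norm_def by real_asymp

lemma ln_ge_1: "exp 1 \<le> x \<Longrightarrow> 1 \<le> ln (x::real)"
  using less_le_trans[OF exp_gt_zero, of 1 x] by (subst ln_ge_iff) auto

lemma eventually_lil_norm_gt: "\<forall>\<^sub>F x in at_top. C < lil_norm x"
  using lil_norm_at_top by (simp add: filterlim_at_top_dense)

lemma lil_norm_mono: "exp 1 \<le> x \<Longrightarrow> x \<le> y \<Longrightarrow> lil_norm x \<le> lil_norm y"
proof -
  assume x: "exp 1 \<le> x" "x \<le> y"
  have "x > 0" using x(1) exp_gt_zero[of 1] by linarith
  moreover have "ln x \<ge> 1" by (rule ln_ge_1[OF x(1)])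
  moreover have "ln x \<le> ln y" using x \<open>x > 0\<close> by simp
  moreover have "ln (ln x) \<le> ln (ln y)" by (rule ln_mono) (use calculation in linarith)+
  ultimately have "ln (ln x) \<le> ln (ln y)" "0 \<le> ln (ln x)" by auto
  then show ?thesis
    unfolding lil_norm_def using x \<open>x > 0\<close> by (intro real_sqrt_le_mono mult_mono) auto
qed

lemma lil_norm_nonneg: "exp 1 \<le> x \<Longrightarrow> 0 \<le> lil_norm x"
  using less_le_trans[OF exp_gt_zero, of 1 x] ln_ge_1[of x] by (auto simp: lil_norm_def intro!: mult_nonneg_nonneg ln_ge_zero)

lemma lil_norm_scale:
  assumes q: "q > 0" and c: "c > sqrt q"
  shows "\<forall>\<^sub>F x in at_top. lil_norm (q * x) \<le> c * lil_norm x"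
proof -
  have "((\<lambda>x. lil_norm (q * x) / lil_norm x) \<longlongrightarrow> sqrt q) at_top"
  proof -
    have "((\<lambda>x. sqrt (q * (ln (ln (q * x)) / ln (ln x)))) \<longlongrightarrow> sqrt (q * 1)) at_top"
      using q by (intro tendsto_intros) real_asymp
    moreover have "\<forall>\<^sub>F x in at_top. sqrt (q * (ln (ln (q * x)) / ln (ln x))) = lil_norm (q * x) / lil_norm x"
      using eventually_gt_at_top[of 0]
      by eventually_elim (simp add: lil_norm_def real_sqrt_divide[symmetric])
    ultimately show ?thesis by (simp add: tendsto_cong)
  qed
  then have "\<forall>\<^sub>F x in at_top. lil_norm (q * x) / lil_norm x < c"
    using c by (rule order_tendstoD)
  with eventually_lil_norm_gt[of 0] show ?thesis
    by eventually_elim (simp add: field_simps)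
qed

lemma power_at_top: "q > 1 \<Longrightarrow> filterlim (\<lambda>k. q ^ k :: real) at_top sequentially"
  by real_asymp

lemma eventually_power:
  assumes "q > (1::real)" "eventually P at_top"
  shows "\<forall>\<^sub>F k in sequentially. P (q ^ k)"
  using filterlim_iff power_at_top[OF assms(1)] assms(2) by blast

lemma eventually_le_power: "q > (1::real) \<Longrightarrow> \<forall>\<^sub>F k in sequentially. B \<le> q ^ k"
  by (rule eventually_power[OF _ eventually_ge_at_top])

lemma sum_grid_inc:
  assumes "i \<le> l"
  shows "(\<Sum>r\<in>{i..<l}. grid_inc w h j r) = w j (real l * h) - w j (real i * h)"
  unfolding grid_inc_def using sum_Suc_diff'[OF assms, of "\<lambda>r. w j (real r * h)"] by simp

lemma floor_cell:
  assumes "h > 0" "0 \<le> (t::real)"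
  shows "real (nat \<lfloor>t / h\<rfloor>) * h \<le> t" "t < real (nat \<lfloor>t / h\<rfloor>) * h + h"
proof -
  have e: "real (nat \<lfloor>t / h\<rfloor>) = of_int \<lfloor>t / h\<rfloor>" using assms by simp
  have f: "of_int \<lfloor>t / h\<rfloor> \<le> t / h" "t / h < of_int \<lfloor>t / h\<rfloor> + 1" by linarith+
  show "real (nat \<lfloor>t / h\<rfloor>) * h \<le> t"
    unfolding e using mult_right_mono[OF f(1), of h] assms by simp
  show "t < real (nat \<lfloor>t / h\<rfloor>) * h + h"
    unfolding e using f(2) assms by (simp add: field_simps)
qed

text \<open>Moving both ends of an interval to grid points costs one oscillation each. The bound is a
difference of values of one function of time, hence it telescopes along a spine.\<close>

lemma increment_le_grid:
  assumes h: "h > 0" and osc: "osc_le w B h e"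
    and M: "\<And>i. grid_inc w h j i \<le> M i"
    and st: "0 \<le> s" "s \<le> t" "t \<le> B"
  shows "w j t - w j s \<le> (\<Sum>i<nat \<lfloor>t / h\<rfloor>. M i) - (\<Sum>i<nat \<lfloor>s / h\<rfloor>. M i) + 2 * e"
proof -
  define g where "g t = nat \<lfloor>t / h\<rfloor>" for t
  have gle: "g s \<le> g t" unfolding g_def using st h by (intro nat_mono floor_mono divide_right_mono) auto
  note cs = floor_cell[OF h, of s, folded g_def] and ct = floor_cell[OF h, of t, folded g_def]
  have nn: "0 \<le> real (g s) * h" "0 \<le> real (g t) * h" using h by auto
  have "\<bar>w j t - w j (real (g t) * h)\<bar> \<le> e"
    using st ct h nn osc unfolding osc_le_def by auto
  moreover have "\<bar>w j s - w j (real (g s) * h)\<bar> \<le> e"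
    using st cs h nn osc unfolding osc_le_def by auto
  moreover have "w j (real (g t) * h) - w j (real (g s) * h) \<le> (\<Sum>i\<in>{g s..<g t}. M i)"
    unfolding sum_grid_inc[OF gle, symmetric] by (rule sum_mono) (rule M)
  moreover have "(\<Sum>i\<in>{g s..<g t}. M i) = (\<Sum>i<g t. M i) - (\<Sum>i<g s. M i)"
    using sum_diff_nat_ivl[of 0 "g s" "g t" M] gle by (simp add: lessThan_atLeast0)
  ultimately show ?thesis unfolding g_def[symmetric] by linarith
qed

context branching_pair
begin

text \<open>The spine is followed from the last branching \<open>p\<close> with \<open>Y p\<close> below a small multiple of \<open>lil_norm (q ^ k)\<close>. A coarse
mesh \<open>1 / m0\<close> bounds the number of later branchings, and only then is the fine mesh \<open>1 / m\<close> chosen, so that one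
rounding error \<open>e'\<close> per branching adds up to a small amount.\<close>

lemma pos_bound_scale:
  assumes q: "q > 1" and mod: "modulus_ok w q" and grid: "grid_ok w q" and \<eta>: "\<eta> > 0"
  shows "\<forall>\<^sub>F k in sequentially. \<forall>n t j. T n \<le> t \<and> t \<le> T (Suc n) \<and> t \<le> q ^ k \<longrightarrow>
           w j t + offset j n \<le> (1 + \<eta>) * lil_norm (q ^ k)"
proof -
  define e where "e = \<eta> / 4"
  have e: "e > 0" using \<eta> by (simp add: e_def)
  obtain m0 :: nat where m0: "m0 > 0" and ev0: "\<forall>\<^sub>F k in sequentially. osc_le w (q^k) (q^k / m0) (e / 2 * lil_norm (q^k))"
    using mod[unfolded modulus_ok_def, rule_format, of "e / 2"] e by auto
  define e' where "e' = e / (2 * (m0 + 2))"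
  have e': "e' > 0" using e by (simp add: e'_def)
  obtain m :: nat where m: "m > 0" and ev1: "\<forall>\<^sub>F k in sequentially. osc_le w (q^k) (q^k / m) (e' * lil_norm (q^k))"
    using mod[unfolded modulus_ok_def, rule_format, of e'] e' by auto
  have ev2: "\<forall>\<^sub>F k in sequentially. grid_sum w (q^k / real m) m \<le> (1 + e) * lil_norm (q^k)"
    using grid m e unfolding grid_ok_def by blast
  have ev3: "\<forall>\<^sub>F k in sequentially. 1 / e < lil_norm (q^k)"
    by (rule eventually_power[OF q eventually_lil_norm_gt])
  show ?thesis
    using ev0 ev1 ev2 ev3
  proof eventually_elim
    fix k
    define B where "B = q ^ k"
    define a where "a = lil_norm B"
    define h where "h = B / real m"
    assume H0: "osc_le w (q^k) (q^k / m0) (e / 2 * lil_norm (q^k))"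
      and H1: "osc_le w (q^k) (q^k / m) (e' * lil_norm (q^k))"
      and H2: "grid_sum w (q^k / real m) m \<le> (1 + e) * lil_norm (q^k)"
      and H3: "1 / e < lil_norm (q^k)"
    have B: "B > 0" using q by (simp add: B_def)
    have a: "a \<ge> 1 / e" using H3 by (simp add: a_def B_def)
    then have a0: "a > 0" using e by (meson divide_pos_pos less_le_trans zero_less_one)
    have h: "h > 0" using B m by (simp add: h_def)
    \<comment> \<open>The factor \<open>1 / 2\<close> in the choice of \<open>m0\<close> makes this inequality strict.\<close>
    have coarse: "\<bar>w j s - w j t\<bar> < e * a" if "0 \<le> s" "s \<le> t" "t \<le> B" "t - s \<le> B / m0" for j s t
    proof -
      have "\<bar>w j s - w j t\<bar> \<le> e / 2 * a"
        using H0 that unfolding osc_le_def a_def B_def by simp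
      also have "\<dots> < e * a" using e a0 by simp
      finally show ?thesis .
    qed
    have fine: "osc_le w B h (e' * a)" using H1 unfolding a_def B_def h_def .
    define M where "M i = max 0 (max (grid_inc w h True i) (grid_inc w h False i))" for i
    have M_ge: "grid_inc w h j i \<le> M i" for i j by (cases j) (auto simp: M_def)
    define G where "G t = (\<Sum>i<nat \<lfloor>t / h\<rfloor>. M i)" for t
    have G_nn: "G t \<ge> 0" for t unfolding G_def by (intro sum_nonneg) (simp add: M_def)
    have inc: "w j t - w j s \<le> G t - G s + 2 * (e' * a)" if "0 \<le> s" "s \<le> t" "t \<le> B" for s t j
      unfolding G_def by (rule increment_le_grid[OF h fine M_ge that])
    have G_le: "G t \<le> (1 + e) * a" if "0 \<le> t" "t \<le> B" for t
    proof -
      have "t / h \<le> real m" using that B m by (simp add: h_def field_simps)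
      then have "nat \<lfloor>t / h\<rfloor> \<le> m" by linarith
      then have "G t \<le> (\<Sum>i<m. M i)"
        unfolding G_def by (intro sum_mono2) (auto simp: M_def)
      also have "\<dots> \<le> (1 + e) * a"
        using H2 by (simp add: grid_sum_def M_def a_def B_def h_def)
      finally show ?thesis .
    qed
    show "\<forall>n t j. T n \<le> t \<and> t \<le> T (Suc n) \<and> t \<le> q ^ k \<longrightarrow>
           w j t + offset j n \<le> (1 + \<eta>) * lil_norm (q ^ k)"
    proof (intro allI impI)
      fix n t j assume "T n \<le> t \<and> t \<le> T (Suc n) \<and> t \<le> q ^ k"
      then have t: "T n \<le> t" "t \<le> T (Suc n)" "t \<le> B" by (auto simp: B_def)
      have TB: "T i \<le> B" if "i \<le> n" for i
        using t that T_strict_mono by (meson order_trans strict_mono_less_eq)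
      define P where "P = {i. i \<le> n \<and> Y i \<le> e * a}"
      have "0 \<in> P" using a e by (simp add: P_def field_simps)
      moreover have finP: "finite P" by (simp add: P_def)
      ultimately have "Max P \<in> P" by (intro Max_in) auto
      define p where "p = Max P"
      have p: "p \<le> n" "Y p \<le> e * a" using \<open>Max P \<in> P\<close> by (auto simp: P_def p_def)
      have large: "Y i > e * a" if "p < i" "i \<le> n" for i
      proof (rule ccontr)
        assume "\<not> Y i > e * a"
        then have "i \<in> P" using that by (simp add: P_def)
        then show False using Max_ge[OF finP, of i] that by (simp add: p_def)
      qed
      have long: "T (Suc i) - T i > B / m0" if "p < i" "i < n" for i
      proof (rule ccontr)
        assume c: "\<not> T (Suc i) - T i > B / m0"
        obtain j where j: "w j (T (Suc i)) - w j (T i) = - Y i" using killed_drop by blast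
        have "\<bar>w j (T i) - w j (T (Suc i))\<bar> < e * a"
          using c that T_less_Suc[of i] TB[of "Suc i"] by (intro coarse) auto
        with j large[of i] that Y_pos[of i] show False by simp
      qed
      have "real i * (B / m0) \<le> T (Suc p + i)" if "Suc p + i \<le> n" for i
        using that
      proof (induction i)
        case (Suc i)
        then have "real i * (B / m0) + B / m0 \<le> T (Suc p + i) + (T (Suc (Suc p + i)) - T (Suc p + i))"
          using long[of "Suc p + i"] by (intro add_mono) auto
        then show ?case by (simp add: algebra_simps add_divide_distrib)
      qed simp
      then have 1: "real (n - Suc p) * (B / m0) \<le> B" if "p < n"
        using TB[of n] that by (metis Suc_leI le_add_diff_inverse order_refl order_trans)
      then have "real (n - Suc p) \<le> real m0" if "p < n"
      proof -
        have "real (n - Suc p) * (B / m0) = (real (n - Suc p) / m0) * B" by simp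
        then have "(real (n - Suc p) / m0) * B \<le> 1 * B" using 1 that by simp
        then have "real (n - Suc p) / m0 \<le> 1" using B by (simp only: mult_le_cancel_right_pos)
        then show ?thesis using m0 by (simp add: pos_divide_le_eq)
      qed
      then have count: "n - p + 1 \<le> m0 + 2" by (cases "p < n") auto
      have chain: "Y (p + i) \<le> Y p + (G (T (p + i)) - G (T p)) + real i * (2 * (e' * a))"
        if "p + i \<le> n" for i
        using that
      proof (induction i)
        case (Suc i)
        obtain j where j: "Y (Suc (p + i)) = Y (p + i) + (w j (T (Suc (p + i))) - w j (T (p + i)))"
          using survivor_step by blast
        have "w j (T (Suc (p + i))) - w j (T (p + i)) \<le> G (T (Suc (p + i))) - G (T (p + i)) + 2 * (e' * a)"
          using Suc.prems T_less_Suc[of "p + i"] TB[of "Suc (p + i)"] by (intro inc) auto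
        with Suc.IH Suc.prems j show ?case by (simp add: algebra_simps)
      qed simp
      have "w j t + offset j n = Y n + (w j t - w j (T n))" by (simp add: offset_def)
      also have "\<dots> \<le> Y p + (G (T n) - G (T p)) + real (n - p) * (2 * (e' * a)) + (G t - G (T n) + 2 * (e' * a))"
        using chain[of "n - p"] p inc[of "T n" t j] t by (intro add_mono) auto
      also have "\<dots> = Y p - G (T p) + G t + real (n - p + 1) * (2 * (e' * a))"
        by (simp add: algebra_simps)
      also have "real (n - p + 1) * (2 * (e' * a)) \<le> real (m0 + 2) * (2 * (e' * a))"
        using count e' a0 by (intro mult_right_mono) (auto simp del: of_nat_add)
      also have "real (m0 + 2) * (2 * (e' * a)) = e * a" by (simp add: e'_def field_simps)
      also have "Y p - G (T p) + G t + e * a \<le> e * a + (1 + e) * a + e * a"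
        using p G_nn[of "T p"] G_le[of t] t order_trans[OF T_nonneg t(1)] by linarith
      also have "\<dots> = (1 + 3 * e) * a" by (simp add: algebra_simps)
      also have "\<dots> \<le> (1 + \<eta>) * a" using a0 \<eta> by (intro mult_right_mono) (auto simp: e_def)
      finally show "w j t + offset j n \<le> (1 + \<eta>) * lil_norm (q ^ k)" by (simp add: a_def B_def)
    qed
  qed
qed

text \<open>A time \<open>t\<close> between \<open>q ^ (k - 1)\<close> and \<open>q ^ k\<close> is compared with the scale \<open>q ^ k \<le> q t\<close>, at the price of a factor close to
\<open>sqrt q\<close>; it remains to let \<open>q\<close> be close to \<open>1\<close>. The ratio \<open>q\<close> is rational so that countably many
null sets suffice in the end.\<close>

lemma pos_bound:
  assumes mod: "\<And>q. q \<in> \<rat> \<Longrightarrow> q > 1 \<Longrightarrow> modulus_ok w q"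
    and grid: "\<And>q. q \<in> \<rat> \<Longrightarrow> q > 1 \<Longrightarrow> grid_ok w q" and \<eta>: "\<eta> > 0"
  shows "\<forall>\<^sub>F t in at_top. \<forall>n j. T n \<le> t \<and> t \<le> T (Suc n) \<longrightarrow>
           w j t + offset j n \<le> (1 + \<eta>) * lil_norm t"
proof -
  define e where "e = min 1 \<eta> / 6"
  have e: "e > 0" "e \<le> 1 / 6" "6 * e \<le> \<eta>" using \<eta> by (auto simp: e_def)
  have "(1::real) < (1 + e)^2" using e by (simp add: power2_eq_square algebra_simps add_pos_pos)
  then obtain q where qQ: "q \<in> \<rat>" and q: "1 < q" "q < (1 + e)^2" using Rats_dense_in_real by blast
  have sq: "sqrt q < 1 + e" using q e by (intro real_less_lsqrt) auto
  obtain K where K: "\<And>k n t j. k \<ge> K \<Longrightarrow> T n \<le> t \<Longrightarrow> t \<le> T (Suc n) \<Longrightarrow> t \<le> q ^ k \<Longrightarrow>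
           w j t + offset j n \<le> (1 + e) * lil_norm (q ^ k)"
    using pos_bound_scale[OF q(1) mod[OF qQ q(1)] grid[OF qQ q(1)] e(1)]
    unfolding eventually_sequentially by blast
  have "\<forall>\<^sub>F t in at_top. lil_norm (q * t) \<le> (1 + e) * lil_norm t"
    using q sq by (intro lil_norm_scale) auto
  moreover have "\<forall>\<^sub>F t in at_top. t \<ge> max (exp 1) (q ^ K + 1)" by (rule eventually_ge_at_top)
  ultimately show ?thesis
  proof eventually_elim
    case (elim t)
    then have t: "t \<ge> exp 1" "t > q ^ K" by auto
    obtain k0 where k0: "t < q ^ k0" using real_arch_pow[OF q(1)] by blast
    define k where "k = (LEAST k. t \<le> q ^ k)"
    have k: "t \<le> q ^ k" unfolding k_def by (rule LeastI[of _ k0]) (use k0 in auto)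
    have kK: "k > K"
    proof (rule ccontr)
      assume "\<not> k > K"
      then have "q ^ k \<le> q ^ K" using q by (intro power_increasing) auto
      with k t show False by simp
    qed
    then obtain l where l: "k = Suc l" by (cases k) auto
    have "\<not> t \<le> q ^ l" using not_less_Least[of l "\<lambda>k. t \<le> q ^ k"] l by (simp add: k_def[symmetric])
    then have qk: "q ^ k \<le> q * t" using l q by simp
    have "exp 1 \<le> q ^ k" using t k by linarith
    then have "lil_norm (q ^ k) \<le> lil_norm (q * t)" by (intro lil_norm_mono qk)
    also have "\<dots> \<le> (1 + e) * lil_norm t" using elim by simp
    finally have le: "lil_norm (q ^ k) \<le> (1 + e) * lil_norm t" .
    have nn: "lil_norm t \<ge> 0" by (rule lil_norm_nonneg[OF t(1)])
    show ?case
    proof (intro allI impI, elim conjE)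
      fix n j assume "T n \<le> t" "t \<le> T (Suc n)"
      then have "w j t + offset j n \<le> (1 + e) * lil_norm (q ^ k)"
        using K[of k n t j] kK k by simp
      also have "\<dots> \<le> (1 + e) * ((1 + e) * lil_norm t)"
        using le e by (intro mult_left_mono) auto
      also have "\<dots> = ((1 + e) * (1 + e)) * lil_norm t" by simp
      also have "\<dots> \<le> (1 + \<eta>) * lil_norm t"
      proof (intro mult_right_mono nn)
        have "e * e \<le> 1 * e" using e by (intro mult_right_mono) auto
        then have "1 + 2 * e + e * e \<le> 1 + \<eta>" using e by linarith
        then show "(1 + e) * (1 + e) \<le> 1 + \<eta>" by (simp add: algebra_simps)
      qed
      finally show "w j t + offset j n \<le> (1 + \<eta>) * lil_norm t" .
    qed
  qed
qed

end

section \<open>The lower bound for a pair of paths\<close>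

lemma lil_norm_contract:
  assumes "0 < c" "c \<le> 1" "exp 1 \<le> c * x"
  shows "lil_norm (c * x) \<le> sqrt c * lil_norm x"
proof -
  have "0 < c * x" by (rule less_le_trans[OF exp_gt_zero assms(3)])
  with assms have x: "x > 0" by (simp add: zero_less_mult_iff)
  have "c * x \<le> x" using mult_right_mono[OF assms(2), of x] x by simp
  then have "ln (c * x) \<le> ln x" using \<open>0 < c * x\<close> by (rule ln_mono)
  then have "ln (ln (c * x)) \<le> ln (ln x)"
    by (rule ln_mono) (use ln_ge_1[OF assms(3)] in linarith)
  then have "2 * (c * x) * ln (ln (c * x)) \<le> 2 * (c * x) * ln (ln x)"
    using \<open>0 < c * x\<close> by (intro mult_left_mono) auto
  then have "lil_norm (c * x) \<le> sqrt (c * (2 * x * ln (ln x)))"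
    unfolding lil_norm_def by (intro real_sqrt_le_mono) (simp add: algebra_simps)
  then show ?thesis unfolding lil_norm_def by (simp only: real_sqrt_mult)
qed

lemma drive_eventD:
  assumes "drive_event w N d k"
  defines "m \<equiv> N^2 * d" and "a \<equiv> lil_norm ((real N^2)^k)"
  defines "h \<equiv> (real N^2)^k / real m"
  shows "\<And>i. d \<le> i \<Longrightarrow> i < m \<Longrightarrow> (1 - 20 / N) * (a / m) \<le> grid_inc w h False i"
    and "\<And>i. d \<le> i \<Longrightarrow> i < m - N * d \<Longrightarrow> (a / m) / (4 * real N) \<le> grid_inc w h True i"
    and "\<And>i. d \<le> i \<Longrightarrow> i < m - N * d \<Longrightarrow> grid_inc w h True i \<le> (a / m) / (2 * real N)"
    and "\<And>i. d \<le> i \<Longrightarrow> m - N * d \<le> i \<Longrightarrow> i < m \<Longrightarrow> grid_inc w h True i \<le> - 4 * (a / m)"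
  using assms(1)[unfolded drive_event_def Let_def, folded m_def, folded a_def h_def]
  by (force simp: not_less[symmetric])+

lemma drive_index:
  assumes N: "N \<ge> 40" and d: "d > 0"
  shows "N * d + 2 * d \<le> N^2 * d" "real (N^2 * d - N * d) = (real N^2 - real N) * real d"
proof -
  have "N * d + 2 * d = (N + 2) * d" by (simp add: algebra_simps)
  also have "(N + 2) * d \<le> (2 * N) * d" using N by (intro mult_right_mono) auto
  also have "\<dots> \<le> (N * N) * d" using N by (intro mult_right_mono) auto
  finally show le: "N * d + 2 * d \<le> N^2 * d" by (simp add: power2_eq_square)
  then have "N * d \<le> N^2 * d" by linarith
  then show "real (N^2 * d - N * d) = (real N^2 - real N) * real d"
    by (simp add: of_nat_diff algebra_simps)
qed

text \<open>On the driving event the first path loses \<open>4 / N\<close> in the final phase and has gained at most \<open>1 / (2 N)\<close> before.\<close>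

lemma drive_fall:
  assumes ev: "drive_event w N d k" and N: "N \<ge> 40" and d: "d > 0" and r: "r \<in> {d..2 * d}"
    and a: "lil_norm ((real N^2)^k) \<ge> 0"
  shows "w True ((real N^2)^k) - w True (real r * ((real N^2)^k / real (N^2 * d)))
           \<le> - (7 / (2 * N)) * lil_norm ((real N^2)^k)"
proof -
  define m where "m = N^2 * d"
  define a where "a = lil_norm ((real N^2)^k)"
  define h where "h = (real N^2)^k / real m"
  note D = drive_eventD[OF ev, folded m_def, folded a_def h_def]
  note ix = drive_index[OF N d, folded m_def]
  have m: "m > 0" using N d by (simp add: m_def)
  have le: "r \<le> m - N * d" "d \<le> r" "m - N * d \<le> m" using r ix by auto
  have "w True (real m * h) - w True (real r * h) = (\<Sum>i\<in>{r..<m}. grid_inc w h True i)"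
    using le by (intro sum_grid_inc[symmetric]) auto
  also have "\<dots> = (\<Sum>i\<in>{r..<m - N * d}. grid_inc w h True i) + (\<Sum>i\<in>{m - N * d..<m}. grid_inc w h True i)"
    using le by (simp add: sum.atLeastLessThan_concat)
  also have "\<dots> \<le> (\<Sum>i\<in>{r..<m - N * d}. (a / m) / (2 * N)) + (\<Sum>i\<in>{m - N * d..<m}. - 4 * (a / m))"
    using D(3,4) le by (intro add_mono sum_mono) (auto simp del: divide_divide_eq_left)
  also have "\<dots> = real (m - N * d - r) * ((a / m) / (2 * N)) + real (N * d) * (- 4 * (a / m))"
    using ix by simp
  also have "\<dots> \<le> real m * ((a / m) / (2 * N)) + real (N * d) * (- 4 * (a / m))"
    using assms(5) by (intro add_right_mono mult_right_mono) (auto simp: a_def)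
  also have "\<dots> = - (7 / (2 * N)) * a"
    using N d by (simp add: m_def power2_eq_square field_simps)
  finally show ?thesis
    using m by (simp add: h_def m_def a_def)
qed

text \<open>At the beginning of the block the first path is at most about \<open>(3/2) lil_norm (x / N ^ 2) \<le> (3/2) lil_norm x / N\<close>,
by the bound on grid sums with a single cell, and the block takes away \<open>(7/2) lil_norm x / N\<close>.\<close>

lemma driven_path_unbounded_below:
  assumes start: "w True 0 = 1" and N: "N \<ge> 40" and d: "d > 0"
    and grid: "grid_ok w (real N^2)" and drive: "\<exists>\<^sub>F k in sequentially. drive_event w N d k"
  shows "\<exists>t\<ge>0. w True t < K"
proof -
  define q where "q = real N^2"
  have "40 * 40 \<le> real N * real N" using N by (intro mult_mono) auto
  then have q: "q > 1" by (simp add: q_def power2_eq_square)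
  have "\<forall>\<^sub>F k in sequentially. grid_sum w (q^k / real 1) 1 \<le> (1 + 1/2) * lil_norm (q^k)"
    using grid[folded q_def, unfolded grid_ok_def, rule_format, of 1 "1/2"] by simp
  then have ev1: "\<forall>\<^sub>F k in sequentially. w True (q^k) \<le> 1 + 3/2 * lil_norm (q^k)"
  proof eventually_elim
    case (elim k)
    have "grid_inc w (q^k) True 0 \<le> max 0 (max (grid_inc w (q^k) True 0) (grid_inc w (q^k) False 0))"
      by (simp add: le_max_iff_disj)
    also have "\<dots> \<le> 3/2 * lil_norm (q^k)" using elim by (simp add: grid_sum_def)
    finally show ?case by (simp add: grid_inc_def start)
  qed
  have ev2: "\<forall>\<^sub>F k in sequentially. exp 1 \<le> q ^ k" by (rule eventually_le_power[OF q])
  have ev3: "\<forall>\<^sub>F k in sequentially. lil_norm (q ^ k) > real N * (1 + \<bar>K\<bar>)"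
    by (rule eventually_power[OF q eventually_lil_norm_gt])
  have "\<forall>\<^sub>F k in sequentially. w True (q^k) \<le> 1 + 3/2 * lil_norm (q^k) \<and> exp 1 \<le> q ^ k \<and> lil_norm (q ^ Suc k) > real N * (1 + \<bar>K\<bar>)"
    using ev1 ev2 ev3[THEN eventually_sequentially_Suc[THEN iffD2]] by eventually_elim auto
  then have "\<forall>\<^sub>F k in sequentially. k > 0 \<and> (w True (q^(k-1)) \<le> 1 + 3/2 * lil_norm (q^(k-1)) \<and> exp 1 \<le> q ^ (k-1) \<and> lil_norm (q ^ k) > real N * (1 + \<bar>K\<bar>))"
    by (subst eventually_sequentially_Suc[symmetric]) simp
  then obtain k where ev: "drive_event w N d k" and k: "k > 0"
    and H: "w True (q^(k-1)) \<le> 1 + 3/2 * lil_norm (q^(k-1))" "exp 1 \<le> q ^ (k-1)" "lil_norm (q ^ k) > real N * (1 + \<bar>K\<bar>)"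
    by (blast dest: frequently_eventually_conj[OF drive] frequently_ex)
  have qk: "q ^ k = q * q ^ (k - 1)" using k by (cases k) auto
  have N0: "real N > 0" using N by simp
  have a: "lil_norm (q ^ k) \<ge> 0"
    using H(3) N0 by (intro order_trans[OF _ less_imp_le[OF H(3)]] mult_nonneg_nonneg) auto
  have "real d * (q ^ k / real (N^2 * d)) = q ^ (k - 1)"
    using N d q unfolding qk by (simp add: q_def)
  then have fall: "w True (q ^ k) - w True (q ^ (k - 1)) \<le> - (7 / (2 * N)) * lil_norm (q ^ k)"
    using drive_fall[OF ev N d, of d] a by (simp add: q_def)
  have "lil_norm (q ^ (k - 1)) = lil_norm (1 / q * q ^ k)" using q qk by simp
  also have "\<dots> \<le> sqrt (1 / q) * lil_norm (q ^ k)"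
    using q H(2) qk by (intro lil_norm_contract) auto
  also have "sqrt (1 / q) = 1 / N" using N by (simp add: q_def real_sqrt_divide)
  finally have "w True (q ^ k) \<le> 1 + 3/2 * (1 / N * lil_norm (q ^ k)) - (7 / (2 * N)) * lil_norm (q ^ k)"
    using H(1) fall by linarith
  also have "\<dots> = 1 - 2 * (lil_norm (q ^ k) / N)" using N0 by (simp add: field_simps)
  also have "lil_norm (q ^ k) / N > 1 + \<bar>K\<bar>" using H(3) N0 by (simp add: field_simps)
  then have "1 - 2 * (lil_norm (q ^ k) / N) < K" by linarith
  finally have "w True (q ^ k) < K" .
  then show ?thesis using q by (intro exI[of _ "q ^ k"]) auto
qed

context branching_pair
begin

lemma interval_of:
  assumes "0 \<le> s" obtains n where "T n \<le> s" "s < T (Suc n)"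
proof -
  have "\<forall>\<^sub>F n in sequentially. s < T n"
    using T_at_top by (simp add: filterlim_at_top_dense)
  then obtain m where "s < T m" by (meson eventually_sequentially order_refl)
  with assms that show ?thesis using find_interval[of s m] by auto
qed

lemma interval_le:
  assumes "T n \<le> s" "s < T (Suc m)" shows "n \<le> m"
proof -
  have "T n < T (Suc m)" using assms by linarith
  then show ?thesis using T_strict_mono by (simp add: strict_mono_less less_Suc_eq_le)
qed

text \<open>The times \<open>u0 < u1 < u2\<close> are the beginning of the block, the end of its first \<open>d\<close> cells and the beginning of the
final phase. At \<open>u1\<close> the first particle is at most at \<open>3 a / N\<close> by the upper bound, and from then on its path
loses \<open>(7/2) a / N\<close>, so it dies between \<open>u1\<close> and the end of the block. It cannot die between \<open>u1\<close> and \<open>u2\<close>: its path is above its level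
at \<open>u0\<close>, where the particle was alive. Whatever has happened to the second particle in between, it is at
least as high as the increment of its path since \<open>u0\<close>.\<close>

lemma driven_branch:
  assumes N: "N \<ge> 40"
    and mod: "\<And>q. q \<in> \<rat> \<Longrightarrow> q > 1 \<Longrightarrow> modulus_ok w q"
    and grid: "\<And>q. q \<in> \<rat> \<Longrightarrow> q > 1 \<Longrightarrow> grid_ok w q"
  shows "\<exists>d>0. \<forall>\<^sub>F k in sequentially. drive_event w N d k \<longrightarrow>
    (\<exists>n. (1 - 1/N) * (real N^2)^k < T n \<and> T n \<le> (real N^2)^k \<and>
       ((1 - 1/N - 1/real N^2) * (1 - 20/N) - 1/N) * lil_norm ((real N^2)^k) \<le> Y n)"
proof -
  define q where "q = real N^2"
  have "40 * 40 \<le> real N * real N" using N by (intro mult_mono) auto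
  then have q: "q > 1" "q \<in> \<rat>" by (auto simp: q_def power2_eq_square)
  \<comment> \<open>In the first \<open>d\<close> cells of the block the first path rises by \<open>a / (4 N ^ 3)\<close>; oscillations
    inside a cell must not undo this.\<close>
  define e where "e = 1 / (8 * real N ^ 3)"
  have N0: "real N > 0" using N by simp
  then have e: "e > 0" by (simp add: e_def)
  obtain d :: nat where d: "d > 0" and ev0: "\<forall>\<^sub>F k in sequentially. osc_le w (q^k) (q^k / d) (e * lil_norm (q^k))"
    using mod[OF q(2,1), unfolded modulus_ok_def, rule_format, of e] e by auto
  have "\<forall>\<^sub>F t in at_top. exp 1 \<le> t \<and> (\<forall>n j. T n \<le> t \<and> t \<le> T (Suc n) \<longrightarrow> w j t + offset j n \<le> (1 + 1) * lil_norm t)"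
    using pos_bound[OF mod grid zero_less_one]
    by (intro eventually_conj eventually_ge_at_top[of "exp 1"])
  moreover have "filterlim (\<lambda>x. 2 / q * x) at_top at_top"
    using q by (intro filterlim_tendsto_pos_mult_at_top[OF tendsto_const]) (auto simp: filterlim_ident)
  ultimately have "\<forall>\<^sub>F x in at_top. exp 1 \<le> 2 / q * x \<and> (\<forall>n j. T n \<le> 2 / q * x \<and> 2 / q * x \<le> T (Suc n) \<longrightarrow>
      w j (2 / q * x) + offset j n \<le> (1 + 1) * lil_norm (2 / q * x))"
    unfolding filterlim_iff by blast
  then have ev1: "\<forall>\<^sub>F k in sequentially. exp 1 \<le> 2 / q * q ^ k \<and> (\<forall>n j. T n \<le> 2 / q * q ^ k \<and> 2 / q * q ^ k \<le> T (Suc n) \<longrightarrow>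
      w j (2 / q * q ^ k) + offset j n \<le> (1 + 1) * lil_norm (2 / q * q ^ k))"
    by (rule eventually_power[OF q(1)])
  have ev2: "\<forall>\<^sub>F k in sequentially. lil_norm (q ^ k) > 0"
    by (rule eventually_power[OF q(1) eventually_lil_norm_gt])
  have "\<forall>\<^sub>F k in sequentially. drive_event w N d k \<longrightarrow>
    (\<exists>n. (1 - 1/N) * q^k < T n \<and> T n \<le> q^k \<and>
       ((1 - 1/N - 1/real N^2) * (1 - 20/N) - 1/N) * lil_norm (q^k) \<le> Y n)"
    using ev0 ev1 ev2
  proof (eventually_elim, intro impI)
    fix k
    define B where "B = q ^ k"
    define a where "a = lil_norm B"
    define m where "m = N^2 * d"
    define h where "h = B / real m"
    assume H0: "osc_le w (q^k) (q^k / d) (e * lil_norm (q^k))"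
      and H1: "exp 1 \<le> 2 / q * q ^ k \<and> (\<forall>n j. T n \<le> 2 / q * q ^ k \<and> 2 / q * q ^ k \<le> T (Suc n) \<longrightarrow>
        w j (2 / q * q ^ k) + offset j n \<le> (1 + 1) * lil_norm (2 / q * q ^ k))"
      and H2: "lil_norm (q ^ k) > 0" and ev: "drive_event w N d k"
    note D = drive_eventD[OF ev, folded m_def, folded q_def, folded B_def, folded a_def h_def]
    note ix = drive_index[OF N d, folded m_def]
    have m: "m > 0" using N d by (simp add: m_def)
    have B: "B > 0" using q by (simp add: B_def)
    have h: "h > 0" using m B by (simp add: h_def)
    have a: "a > 0" using H2 by (simp add: a_def B_def)
    have mh: "real m * h = B" using m by (simp add: h_def)
    define u0 u1 u2 where "u0 = real d * h" and "u1 = real (2 * d) * h" and "u2 = real (m - N * d) * h"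
    have u1_eq: "u1 = 2 / q * B" using N d by (simp add: u1_def h_def m_def q_def)
    have u2_eq: "u2 = (1 - 1 / N) * B"
      unfolding u2_def ix(2) h_def m_def using N d by (simp add: field_simps power2_eq_square)
    have u: "0 \<le> u0" "u0 < u1" "u1 \<le> u2" "u2 \<le> B"
    proof -
      show "0 \<le> u0" "u0 < u1" using h d by (auto simp: u0_def u1_def)
      have "2 * d \<le> m - N * d" using ix(1) by linarith
      then show "u1 \<le> u2" unfolding u1_def u2_def using h by (intro mult_right_mono) (auto simp del: of_nat_diff)
      show "u2 \<le> B" unfolding u2_def mh[symmetric] using h by (intro mult_right_mono) auto
    qed
    have osc: "\<bar>w j s - w j t\<bar> \<le> e * a" if "0 \<le> s" "s \<le> B" "0 \<le> t" "t \<le> B" "\<bar>s - t\<bar> \<le> h" for j s t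
    proof -
      have "h \<le> B / d" using N d B unfolding h_def m_def by (intro divide_left_mono) auto
      then show ?thesis using H0 that unfolding osc_le_def a_def B_def by simp
    qed
    have lower: "w j t \<ge> w j u0 + (\<Sum>i\<in>{d..<nat \<lfloor>t / h\<rfloor>}. grid_inc w h j i) - e * a"
      and cell: "r \<le> nat \<lfloor>t / h\<rfloor>" "nat \<lfloor>t / h\<rfloor> \<le> m" "t < B \<Longrightarrow> nat \<lfloor>t / h\<rfloor> < m"
      if "real r * h \<le> t" "t \<le> B" "d \<le> r" for j t r
    proof -
      have t0: "0 \<le> t" using that(1) h by (meson mult_nonneg_nonneg of_nat_0_le_iff order_trans less_imp_le)
      note c = floor_cell[OF h t0]
      have "real r \<le> t / h" using that h by (simp add: field_simps)
      then show r: "r \<le> nat \<lfloor>t / h\<rfloor>" by linarith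
      have "t / h \<le> real m" using that h mh by (simp add: field_simps)
      then show "nat \<lfloor>t / h\<rfloor> \<le> m" by linarith
      show "nat \<lfloor>t / h\<rfloor> < m" if "t < B"
      proof -
        have "t / h < real m" using that h mh by (simp add: field_simps)
        then show ?thesis using m by linarith
      qed
      have "\<bar>w j t - w j (real (nat \<lfloor>t / h\<rfloor>) * h)\<bar> \<le> e * a"
        using c h that t0 by (intro osc) (auto intro: mult_nonneg_nonneg)
      moreover have "(\<Sum>i\<in>{d..<nat \<lfloor>t / h\<rfloor>}. grid_inc w h j i) = w j (real (nat \<lfloor>t / h\<rfloor>) * h) - w j u0"
        unfolding u0_def using r that by (intro sum_grid_inc) auto
      ultimately show "w j t \<ge> w j u0 + (\<Sum>i\<in>{d..<nat \<lfloor>t / h\<rfloor>}. grid_inc w h j i) - e * a" by linarith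
    qed
    obtain n0 where n0: "T n0 \<le> u0" "u0 < T (Suc n0)" using interval_of[OF u(1)] .
    obtain n1 where n1: "T n1 \<le> u1" "u1 < T (Suc n1)" using interval_of[of u1] u by auto
    obtain n2 where n2: "T n2 \<le> B" "B < T (Suc n2)" using interval_of[of B] B by auto
    have alive0: "w j u0 + offset j n0 > 0" for j using alive[OF n0] .
    have "w True u1 + offset True n1 \<le> 2 * lil_norm (2 / q * B)"
      using H1 n1 unfolding u1_eq B_def by auto
    also have "lil_norm (2 / q * B) \<le> sqrt (2 / q) * a"
      unfolding a_def using q H1 \<open>40 * 40 \<le> real N * real N\<close> by (intro lil_norm_contract) (auto simp: q_def B_def power2_eq_square)
    also have "sqrt (2 / q) = sqrt 2 / N" using N by (simp add: q_def real_sqrt_divide)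
    also have "sqrt 2 / N \<le> (3 / 2) / N"
      using N0 by (intro divide_right_mono real_le_lsqrt) (auto simp: power2_eq_square)
    finally have at_u1: "w True u1 + offset True n1 \<le> 3 / N * a" using a by (auto simp: field_simps)
    have fall: "w True B - w True u1 \<le> - (7 / (2 * N)) * a"
      using drive_fall[OF ev N d, of "2 * d"] a unfolding q_def[symmetric] B_def[symmetric] a_def[symmetric] m_def[symmetric]
        u1_def h_def by auto
    have "w True B + offset True n1 \<le> - (1 / (2 * N)) * a"
      using at_u1 fall N0 by (simp add: field_simps)
    also have "\<dots> < 0" using N0 a by (simp add: field_simps)
    finally have "offset True n1 < offset True n2"
      using alive[OF n2, of True] by linarith
    moreover have "n1 \<le> n2" using interval_le[OF n1(1), of n2] n2 u by simp
    \<comment> \<open>The offset of the first particle changes exactly at its deaths.\<close>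
    ultimately obtain n where n: "n1 \<le> n" "n < n2" "offset True (Suc n) \<noteq> offset True n"
    proof -
      have "\<exists>n. n1 \<le> n \<and> n < n2 \<and> offset True (Suc n) \<noteq> offset True n"
      proof (rule ccontr)
        assume c: "\<not> ?thesis"
        have "offset True n2 = offset True n1"
          using \<open>n1 \<le> n2\<close> c by (induction n2 rule: dec_induct) auto
        with \<open>offset True n1 < offset True n2\<close> show False by simp
      qed
      with that show ?thesis by blast
    qed
    define \<tau> where "\<tau> = T (Suc n)"
    have "Y (Suc n) \<noteq> w True \<tau> + offset True n"
      using n(3) by (auto simp: \<tau>_def offset_def)
    then have killed: "w True \<tau> + offset True n = 0" and Yn: "Y (Suc n) = w False \<tau> + offset False n"
      using Y_Suc[of n] min_hit[of n] by (auto simp: \<tau>_def max_def min_def split: if_splits)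
    have \<tau>1: "u1 < \<tau>"
      using n1(2) n(1) T_strict_mono unfolding \<tau>_def by (meson Suc_le_mono less_le_trans strict_mono_less_eq)
    have \<tau>B: "\<tau> \<le> B"
      using n2(1) n(2) T_strict_mono unfolding \<tau>_def by (meson Suc_leI order_trans strict_mono_less_eq)
    have n0n: "n0 \<le> n" using interval_le[of n0 u0 n] n0 \<tau>1 u by (simp add: \<tau>_def)
    have off: "offset j n0 \<le> offset j n" for j by (rule offset_mono[OF n0n])
    have "u2 < \<tau>"
    proof (rule ccontr)
      assume "\<not> u2 < \<tau>"
      then have "\<tau> \<le> u2" by simp
      then have fl: "nat \<lfloor>\<tau> / h\<rfloor> \<le> m - N * d"
      proof -
        have "\<tau> / h \<le> real (m - N * d)" using \<open>\<tau> \<le> u2\<close> h by (simp add: u2_def field_simps)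
        then show ?thesis by linarith
      qed
      have c: "2 * d \<le> nat \<lfloor>\<tau> / h\<rfloor>" using \<tau>1 \<tau>B by (intro cell(1)) (auto simp: u1_def)
      have "real d * ((a / m) / (4 * N)) \<le> real (nat \<lfloor>\<tau> / h\<rfloor> - d) * ((a / m) / (4 * N))"
        using c a by (intro mult_right_mono) auto
      also have "\<dots> = (\<Sum>i\<in>{d..<nat \<lfloor>\<tau> / h\<rfloor>}. (a / m) / (4 * N))" by simp
      also have "\<dots> \<le> (\<Sum>i\<in>{d..<nat \<lfloor>\<tau> / h\<rfloor>}. grid_inc w h True i)"
        using fl D(2) by (intro sum_mono) auto
      finally have "real d * ((a / m) / (4 * N)) - e * a \<le> w True \<tau> - w True u0"
        using lower[of "2 * d" \<tau> True] \<tau>1 \<tau>B by (auto simp: u1_def)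
      moreover have "real d * ((a / m) / (4 * N)) = 2 * e * a"
        using N0 d by (simp add: m_def e_def power2_eq_square power3_eq_cube field_simps)
      moreover have "0 < e * a" using e a by simp
      ultimately have "w True u0 < w True \<tau>" by linarith
      with alive0[of True] off[of True] killed show False by linarith
    qed
    then have c: "m - N * d \<le> nat \<lfloor>\<tau> / h\<rfloor>" and c': "nat \<lfloor>\<tau> / h\<rfloor> \<le> m"
    proof -
      have r: "real (m - N * d) * h \<le> \<tau>" using \<open>u2 < \<tau>\<close> by (simp add: u2_def del: of_nat_diff)
      have dr: "d \<le> m - N * d" using ix(1) by linarith
      show "m - N * d \<le> nat \<lfloor>\<tau> / h\<rfloor>" "nat \<lfloor>\<tau> / h\<rfloor> \<le> m"
        using cell(1,2)[OF r \<tau>B dr] by auto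
    qed
    have lam: "1 - 20 / real N \<ge> 0" using N by (simp add: field_simps)
    have "real (m - N * d - d) * ((1 - 20 / N) * (a / m)) \<le> real (nat \<lfloor>\<tau> / h\<rfloor> - d) * ((1 - 20 / N) * (a / m))"
      using c a lam by (intro mult_right_mono) auto
    also have "\<dots> = (\<Sum>i\<in>{d..<nat \<lfloor>\<tau> / h\<rfloor>}. (1 - 20 / N) * (a / m))" by simp
    also have "\<dots> \<le> (\<Sum>i\<in>{d..<nat \<lfloor>\<tau> / h\<rfloor>}. grid_inc w h False i)"
      using c' D(1) by (intro sum_mono) auto
    finally have "real (m - N * d - d) * ((1 - 20 / N) * (a / m)) - e * a \<le> w False \<tau> - w False u0"
      using lower[of "2 * d" \<tau> False] \<tau>1 \<tau>B by (auto simp: u1_def)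
    also have "\<dots> \<le> Y (Suc n)" using Yn alive0[of False] off[of False] by linarith
    finally have *: "real (m - N * d - d) * ((1 - 20 / N) * (a / m)) - e * a \<le> Y (Suc n)" .
    have "real (m - N * d - d) = (real N^2 - real N - 1) * real d"
      using ix by (simp add: of_nat_diff algebra_simps)
    then have "real (m - N * d - d) / m = 1 - 1/N - 1/real N^2"
    proof -
      assume k: "real (m - N * d - d) = (real N^2 - real N - 1) * real d"
      have "real m = real N^2 * real d" by (simp add: m_def)
      then show ?thesis unfolding k using N0 d by (simp add: field_simps power2_eq_square)
    qed
    then have "real (m - N * d - d) * ((1 - 20 / N) * (a / m)) = (1 - 1/N - 1/real N^2) * (1 - 20/N) * a"
    proof -
      assume k: "real (m - N * d - d) / m = 1 - 1/N - 1/real N^2"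
      have "real (m - N * d - d) * ((1 - 20 / N) * (a / m)) = real (m - N * d - d) / m * (1 - 20 / N) * a"
        by simp
      then show ?thesis by (simp only: k)
    qed
    moreover have "e \<le> 1 / N"
    proof -
      have "real N * 1 \<le> real N * (real N)^2" using N by (intro mult_left_mono one_le_power) auto
      also have "\<dots> \<le> 8 * real N ^ 3" by (simp add: power2_eq_square power3_eq_cube)
      finally show ?thesis unfolding e_def using N0 by (intro divide_left_mono) auto
    qed
    then have "e * a \<le> 1 / N * a" using a by (intro mult_right_mono) auto
    ultimately have "((1 - 1/N - 1/real N^2) * (1 - 20/N) - 1/N) * a \<le> Y (Suc n)"
      using * left_diff_distrib[of "(1 - 1/N - 1/real N^2) * (1 - 20/N)" "1 / real N" a] by linarith
    then show "\<exists>n. (1 - 1/N) * q^k < T n \<and> T n \<le> q^k \<and>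
       ((1 - 1/N - 1/real N^2) * (1 - 20/N) - 1/N) * lil_norm (q^k) \<le> Y n"
      using \<open>u2 < \<tau>\<close> \<tau>B unfolding u2_eq \<tau>_def a_def B_def by (intro exI[of _ "Suc n"] conjI)
  qed
  with d show ?thesis unfolding q_def by (intro exI[of _ d] conjI)
qed

theorem limsup_branch_pos:
  assumes mod: "\<And>q. q \<in> \<rat> \<Longrightarrow> q > 1 \<Longrightarrow> modulus_ok w q"
    and grid: "\<And>q. q \<in> \<rat> \<Longrightarrow> q > 1 \<Longrightarrow> grid_ok w q"
    and drive: "\<And>N d. N \<ge> 40 \<Longrightarrow> d > 0 \<Longrightarrow> \<exists>\<^sub>F k in sequentially. drive_event w N d k"
  shows "limsup (\<lambda>n. ereal (Y n / lil_norm (T n))) = 1"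
proof (rule antisym)
  show "limsup (\<lambda>n. ereal (Y n / lil_norm (T n))) \<le> 1"
  proof (rule ereal_le_epsilon2)
    fix \<eta> :: real assume \<eta>: "0 < \<eta>"
    from eventually_lil_norm_gt[of 0] pos_bound[OF mod grid \<eta>]
    have "\<forall>\<^sub>F t in at_top. lil_norm t > 0 \<and> (\<forall>n j. T n \<le> t \<and> t \<le> T (Suc n) \<longrightarrow> w j t + offset j n \<le> (1 + \<eta>) * lil_norm t)"
      by (intro eventually_conj)
    with T_at_top have "\<forall>\<^sub>F n in sequentially. lil_norm (T n) > 0 \<and> (\<forall>n' j. T n' \<le> T n \<and> T n \<le> T (Suc n') \<longrightarrow> w j (T n) + offset j n' \<le> (1 + \<eta>) * lil_norm (T n))"
      unfolding filterlim_iff by blast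
    then have "\<forall>\<^sub>F n in sequentially. ereal (Y n / lil_norm (T n)) \<le> ereal (1 + \<eta>)"
    proof eventually_elim
      case (elim n)
      then have "Y n \<le> (1 + \<eta>) * lil_norm (T n)"
        using T_less_Suc[of n] by (metis Y_eq less_imp_le order_refl)
      with elim show ?case by (simp add: field_simps)
    qed
    then show "limsup (\<lambda>n. ereal (Y n / lil_norm (T n))) \<le> 1 + ereal \<eta>"
      by (simp add: Limsup_bounded one_ereal_def)
  qed
  show "1 \<le> limsup (\<lambda>n. ereal (Y n / lil_norm (T n)))"
  proof -
    define C where "C N = (1 - 1/real N - 1/real N^2) * (1 - 20/real N) - 1/real N" for N
    have "C \<longlonglongrightarrow> 1" unfolding C_def by real_asymp
    then have lim: "(\<lambda>N. ereal (C N)) \<longlonglongrightarrow> 1" by (simp add: one_ereal_def)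
    have posC: "\<forall>\<^sub>F N in sequentially. C N > 0"
      using \<open>C \<longlonglongrightarrow> 1\<close> by (rule order_tendstoD) simp
    have "\<forall>\<^sub>F N in sequentially. ereal (C N) \<le> limsup (\<lambda>n. ereal (Y n / lil_norm (T n)))"
      using posC eventually_ge_at_top[of 40]
    proof eventually_elim
      case (elim N)
      define q where "q = real N^2"
      have "40 * 40 \<le> real N * real N" using elim by (intro mult_mono) auto
      then have q: "q > 1" by (auto simp: q_def power2_eq_square)
      obtain d where d: "d > 0" and ev: "\<forall>\<^sub>F k in sequentially. drive_event w N d k \<longrightarrow>
        (\<exists>n. (1 - 1/N) * q^k < T n \<and> T n \<le> q^k \<and> C N * lil_norm (q^k) \<le> Y n)"
        using driven_branch[OF elim(2) mod grid] unfolding C_def q_def by auto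
      have "\<exists>\<^sub>F n in sequentially. ereal (C N) \<le> ereal (Y n / lil_norm (T n))"
        unfolding frequently_sequentially
      proof
        fix n0
        have p: "1 - 1 / real N > 0" using elim by (simp add: field_simps)
        obtain A where A: "\<And>x. x \<ge> A \<Longrightarrow> lil_norm x > 0"
          using eventually_lil_norm_gt[of 0] by (auto simp: eventually_at_top_linorder)
        define b where "b = max (max (T n0) (exp 1)) A"
        from eventually_le_power[OF q, of "b / (1 - 1 / N)"] ev have "\<forall>\<^sub>F k in sequentially. q ^ k \<ge> b / (1 - 1 / N) \<and> (drive_event w N d k \<longrightarrow>
          (\<exists>n. (1 - 1/N) * q^k < T n \<and> T n \<le> q^k \<and> C N * lil_norm (q^k) \<le> Y n))"
          by (intro eventually_conj)
        from frequently_eventually_conj[OF drive[OF elim(2) d] this]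
        obtain k n where k: "q ^ k \<ge> b / (1 - 1 / N)" and n: "(1 - 1/N) * q^k < T n" "T n \<le> q^k"
          "C N * lil_norm (q^k) \<le> Y n"
          by (auto dest!: frequently_ex)
        have "b \<le> (1 - 1/N) * q^k" using k p by (simp add: field_simps)
        then have Tn: "T n \<ge> b" using n by simp
        then have "T n0 \<le> T n" by (simp add: b_def)
        then have "n0 \<le> n" using T_strict_mono by (simp add: strict_mono_less_eq)
        have lp: "lil_norm (T n) > 0" using Tn by (intro A) (simp add: b_def)
        have "lil_norm (T n) \<le> lil_norm (q ^ k)" using Tn n by (intro lil_norm_mono) (auto simp: b_def)
        then have "C N * lil_norm (T n) \<le> Y n" using n(3) elim(1) by (meson less_imp_le mult_left_mono order_trans)
        then have "ereal (C N) \<le> ereal (Y n / lil_norm (T n))" using lp by (simp add: field_simps)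
        with \<open>n0 \<le> n\<close> show "\<exists>n\<ge>n0. ereal (C N) \<le> ereal (Y n / lil_norm (T n))" by blast
      qed
      then show ?case
        unfolding limsup_INF_SUP frequently_sequentially
      proof (intro INF_greatest)
        fix n0 :: nat assume "\<forall>M. \<exists>n\<ge>M. ereal (C N) \<le> ereal (Y n / lil_norm (T n))"
        then obtain n where "n \<ge> n0" "ereal (C N) \<le> ereal (Y n / lil_norm (T n))" by blast
        then show "ereal (C N) \<le> (SUP m\<in>{n0..}. ereal (Y m / lil_norm (T m)))"
          by (intro SUP_upper2[of n]) auto
      qed
    qed
    then show ?thesis using lim by (intro tendsto_upperbound[OF lim]) auto
  qed
qed

end

section \<open>Increments of two independent Brownian motions\<close>

context prob_space
begin

text \<open>Independence within two sequences and between them amounts to independence of all variables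
together. Finite intersections of events split into a box for each of the two sequences.\<close>

lemma indep_vars_two_sequences:
  fixes X :: "bool \<times> nat \<Rightarrow> 'a \<Rightarrow> real"
  assumes each: "\<And>b n. indep_vars (\<lambda>_. borel) (\<lambda>i. X (b, i)) {..<n}"
    and both: "\<And>n. indep_var (Pi\<^sub>M {..<n} (\<lambda>_. borel)) (\<lambda>\<omega>. \<lambda>i\<in>{..<n}. X (True, i) \<omega>)
                          (Pi\<^sub>M {..<n} (\<lambda>_. borel)) (\<lambda>\<omega>. \<lambda>i\<in>{..<n}. X (False, i) \<omega>)"
  shows "indep_vars (\<lambda>_. borel) X UNIV"
  unfolding indep_vars_def2
proof (intro conjI ballI indep_setsI)
  have rv: "X j \<in> borel_measurable M" for j
  proof -
    have "\<forall>i\<in>{..<Suc (snd j)}. X (fst j, i) \<in> borel_measurable M"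
      using each[of "fst j" "Suc (snd j)"] unfolding indep_vars_def by blast
    then show ?thesis by (metis lessI lessThan_iff prod.collapse)
  qed
  then show "random_variable borel (X j)" for j .
  show "{X j -` A \<inter> space M |A. A \<in> sets borel} \<subseteq> events" for j
    using measurable_sets[OF rv[of j]] by auto
  fix A and J :: "(bool \<times> nat) set"
  assume J: "J \<noteq> {}" "finite J" and AJ: "\<forall>j\<in>J. A j \<in> {X j -` A \<inter> space M |A. A \<in> sets borel}"
  then have "\<forall>j\<in>J. \<exists>S. A j = X j -` S \<inter> space M \<and> S \<in> sets borel" by blast
  then obtain B where B: "\<And>j. j \<in> J \<Longrightarrow> A j = X j -` B j \<inter> space M" "\<And>j. j \<in> J \<Longrightarrow> B j \<in> sets borel"
    by metis
  define n where "n = Suc (Max (snd ` J))"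
  have n: "i < n" if "(b, i) \<in> J" for b i
    unfolding n_def less_Suc_eq_le using J that by (intro Max_ge) force+
  have n0: "{..<n} \<noteq> {}" by (auto simp: n_def)
  define C where "C j = (if j \<in> J then B j else UNIV)" for j
  have C: "C j \<in> sets borel" for j using B by (simp add: C_def)
  define E where "E j = X j -` C j \<inter> space M" for j
  define V where "V b \<omega> = (\<lambda>i\<in>{..<n}. X (b, i) \<omega>)" for b \<omega>
  define Box where "Box b = Pi\<^sub>E {..<n} (\<lambda>i. C (b, i))" for b
  have Box: "Box b \<in> sets (Pi\<^sub>M {..<n} (\<lambda>_. borel))" for b
    unfolding Box_def using C by (intro sets_PiM_I_finite) auto
  have V_Box: "V b -` Box b \<inter> space M = (\<Inter>i\<in>{..<n}. E (b, i))" for b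
    using n0 by (auto simp: V_def Box_def E_def PiE_def Pi_def)
  have pV: "prob (V b -` Box b \<inter> space M) = (\<Prod>i<n. prob (E (b, i)))" for b
    unfolding V_Box E_def using n0 C by (intro indep_varsD[OF each[of b n]]) auto
  have "(\<Inter>j\<in>J. A j) = (\<lambda>\<omega>. (V True \<omega>, V False \<omega>)) -` (Box True \<times> Box False) \<inter> space M"
  proof -
    have "(\<Inter>j\<in>J. A j) = (\<Inter>i\<in>{..<n}. E (True, i)) \<inter> (\<Inter>i\<in>{..<n}. E (False, i))"
    proof (intro equalityI subsetI)
      fix x assume x: "x \<in> (\<Inter>j\<in>J. A j)"
      then have "x \<in> space M" using J B by blast
      moreover have "x \<in> X j -` C j" for j
      proof (cases "j \<in> J")
        case True
        then have "x \<in> A j" using x by blast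
        then show ?thesis using B(1)[OF True] True by (simp add: C_def)
      qed (simp add: C_def)
      ultimately show "x \<in> (\<Inter>i\<in>{..<n}. E (True, i)) \<inter> (\<Inter>i\<in>{..<n}. E (False, i))"
        by (auto simp: E_def)
    next
      fix x assume x: "x \<in> (\<Inter>i\<in>{..<n}. E (True, i)) \<inter> (\<Inter>i\<in>{..<n}. E (False, i))"
      have "x \<in> A j" if "j \<in> J" for j
      proof -
        obtain b i where j: "j = (b, i)" by (cases j)
        then have "x \<in> E j" using x n that by (cases b) auto
        then show ?thesis using that B by (simp add: E_def C_def)
      qed
      then show "x \<in> (\<Inter>j\<in>J. A j)" by blast
    qed
    also have "\<dots> = (\<lambda>\<omega>. (V True \<omega>, V False \<omega>)) -` (Box True \<times> Box False) \<inter> space M"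
      unfolding V_Box[symmetric] by auto
    finally show ?thesis .
  qed
  then have "prob (\<Inter>j\<in>J. A j) = prob (V True -` Box True \<inter> space M) * prob (V False -` Box False \<inter> space M)"
    using indep_varD[OF both[of n, folded V_def] Box Box] by simp
  also have "\<dots> = (\<Prod>b\<in>UNIV. \<Prod>i<n. prob (E (b, i)))"
    by (simp add: pV UNIV_bool)
  also have "\<dots> = (\<Prod>j\<in>UNIV \<times> {..<n}. prob (E j))"
    by (subst prod.cartesian_product) (simp add: case_prod_unfold)
  also have "\<dots> = (\<Prod>j\<in>J. prob (E j))"
    using n by (intro prod.mono_neutral_right) (auto simp: E_def C_def prob_space)
  also have "\<dots> = (\<Prod>j\<in>J. prob (A j))"
    by (intro prod.cong refl) (simp add: E_def C_def B)
  finally show "prob (\<Inter>j\<in>J. A j) = (\<Prod>j\<in>J. prob (A j))" .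
qed

lemma indep_increments_two_brownian:
  assumes bm: "\<And>j. brownian_motion x (W j)" and indep: "indep_processes (W True) (W False)"
    and s: "0 \<le> s 0" "\<And>i. s i \<le> s (Suc i)"
  shows "indep_vars (\<lambda>_. borel) (\<lambda>j \<omega>. W (fst j) (s (Suc (snd j))) \<omega> - W (fst j) (s (snd j)) \<omega>) UNIV"
proof (rule indep_vars_two_sequences, unfold fst_conv snd_conv)
  fix b n
  show "indep_vars (\<lambda>_. borel) (\<lambda>i \<omega>. W b (s (Suc i)) \<omega> - W b (s i) \<omega>) {..<n}"
    using bm[of b] s unfolding brownian_motion_def by blast
next
  fix n
  define D where "D x = (\<lambda>i\<in>{..<n}. x (s (Suc i)) - x (s i))" for x :: "real \<Rightarrow> real"
  have s0: "0 \<le> s i" for i by (induction i) (auto intro: s order_trans)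
  have D: "D \<in> measurable (Pi\<^sub>M {0..} (\<lambda>_. borel)) (Pi\<^sub>M {..<n} (\<lambda>_. borel))"
    unfolding D_def using s0
    by (intro measurable_restrict borel_measurable_diff measurable_component_singleton) auto
  have eq: "(\<lambda>\<omega>. \<lambda>i\<in>{..<n}. W b (s (Suc i)) \<omega> - W b (s i) \<omega>) = D \<circ> (\<lambda>\<omega>. \<lambda>t\<in>{0..}. W b t \<omega>)" for b
    using s0 by (auto simp: D_def fun_eq_iff)
  show "indep_var (Pi\<^sub>M {..<n} (\<lambda>_. borel)) (\<lambda>\<omega>. \<lambda>i\<in>{..<n}. W True (s (Suc i)) \<omega> - W True (s i) \<omega>)
          (Pi\<^sub>M {..<n} (\<lambda>_. borel)) (\<lambda>\<omega>. \<lambda>i\<in>{..<n}. W False (s (Suc i)) \<omega> - W False (s i) \<omega>)"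
    unfolding eq using indep unfolding indep_processes_def by (rule indep_var_compose) (rule D)+
qed

lemma normal_exp_moment:
  assumes X: "distributed M lborel X (normal_density 0 \<sigma>)" and \<sigma>: "\<sigma> > 0"
  shows "(\<integral>\<^sup>+\<omega>. ennreal (exp (l * X \<omega>)) \<partial>M) = ennreal (exp (l\<^sup>2 * \<sigma>\<^sup>2 / 2))"
proof -
  have eq: "normal_density 0 \<sigma> x * exp (l * x) = exp (l\<^sup>2 * \<sigma>\<^sup>2 / 2) * normal_density (l * \<sigma>\<^sup>2) \<sigma> x" for x
  proof -
    have "- (x - 0)\<^sup>2 / (2 * \<sigma>\<^sup>2) + l * x = l\<^sup>2 * \<sigma>\<^sup>2 / 2 + - (x - l * \<sigma>\<^sup>2)\<^sup>2 / (2 * \<sigma>\<^sup>2)"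
      using \<sigma> by (simp add: field_simps power2_eq_square)
    then have "exp (- (x - 0)\<^sup>2 / (2 * \<sigma>\<^sup>2)) * exp (l * x) = exp (l\<^sup>2 * \<sigma>\<^sup>2 / 2) * exp (- (x - l * \<sigma>\<^sup>2)\<^sup>2 / (2 * \<sigma>\<^sup>2))"
      by (simp only: exp_add[symmetric])
    then show ?thesis unfolding normal_density_def by simp
  qed
  have "(\<integral>\<^sup>+\<omega>. ennreal (exp (l * X \<omega>)) \<partial>M) = (\<integral>\<^sup>+x. ennreal (normal_density 0 \<sigma> x) * ennreal (exp (l * x)) \<partial>lborel)"
    by (rule distributed_nn_integral[OF X, symmetric]) auto
  also have "\<dots> = (\<integral>\<^sup>+x. ennreal (exp (l\<^sup>2 * \<sigma>\<^sup>2 / 2)) * ennreal (normal_density (l * \<sigma>\<^sup>2) \<sigma> x) \<partial>lborel)"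
    by (simp add: ennreal_mult[symmetric] eq)
  also have "\<dots> = ennreal (exp (l\<^sup>2 * \<sigma>\<^sup>2 / 2))"
  proof -
    interpret N: prob_space "density lborel (normal_density (l * \<sigma>\<^sup>2) \<sigma>)"
      using \<sigma> by (rule prob_space_normal_density)
    have "(\<integral>\<^sup>+x. ennreal (normal_density (l * \<sigma>\<^sup>2) \<sigma> x) \<partial>lborel) = 1"
      using N.emeasure_space_1 by (simp add: emeasure_density)
    then show ?thesis by (subst nn_integral_cmult) auto
  qed
  finally show ?thesis .
qed

lemma normal_tail:
  assumes X: "distributed M lborel X (normal_density 0 \<sigma>)" and \<sigma>: "\<sigma> > 0" and x: "x \<ge> 0"
  shows "prob {\<omega>\<in>space M. x \<le> \<bar>X \<omega>\<bar>} \<le> 2 * exp (- (x\<^sup>2 / (2 * \<sigma>\<^sup>2)))"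
proof -
  have rv[measurable]: "X \<in> borel_measurable M" using distributed_measurable[OF X] by simp
  define l where "l = x / \<sigma>\<^sup>2"
  have l: "l \<ge> 0" using x by (simp add: l_def)
  have one: "emeasure M {\<omega>\<in>space M. x \<le> c * X \<omega>} \<le> ennreal (exp (- (x\<^sup>2 / (2 * \<sigma>\<^sup>2))))" if c: "c\<^sup>2 = 1" for c
  proof -
    have "emeasure M {\<omega>\<in>space M. x \<le> c * X \<omega>} = (\<integral>\<^sup>+\<omega>. indicator {\<omega>\<in>space M. x \<le> c * X \<omega>} \<omega> \<partial>M)"
      by (rule nn_integral_indicator[symmetric]) measurable
    also have "\<dots> \<le> (\<integral>\<^sup>+\<omega>. ennreal (exp (- l * x)) * ennreal (exp ((l * c) * X \<omega>)) \<partial>M)"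
    proof (rule nn_integral_mono)
      fix \<omega>
      have "l * x \<le> l * c * X \<omega>" if "x \<le> c * X \<omega>"
        using mult_left_mono[OF that l] by (simp add: mult.assoc)
      then show "indicator {\<omega>\<in>space M. x \<le> c * X \<omega>} \<omega> \<le> ennreal (exp (- l * x)) * ennreal (exp ((l * c) * X \<omega>))"
        by (auto simp: indicator_def ennreal_mult[symmetric] mult_exp_exp)
    qed
    also have "\<dots> = ennreal (exp (- l * x)) * ennreal (exp ((l * c)\<^sup>2 * \<sigma>\<^sup>2 / 2))"
      by (simp add: nn_integral_cmult normal_exp_moment[OF X \<sigma>])
    also have "\<dots> = ennreal (exp (- (x\<^sup>2 / (2 * \<sigma>\<^sup>2))))"
      using \<sigma> c by (simp add: ennreal_mult[symmetric] mult_exp_exp l_def power_mult_distrib field_simps power2_eq_square)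
    finally show ?thesis .
  qed
  have "emeasure M {\<omega>\<in>space M. x \<le> \<bar>X \<omega>\<bar>} \<le> emeasure M ({\<omega>\<in>space M. x \<le> 1 * X \<omega>} \<union> {\<omega>\<in>space M. x \<le> -1 * X \<omega>})"
    by (intro emeasure_mono) auto
  also have "\<dots> \<le> emeasure M {\<omega>\<in>space M. x \<le> 1 * X \<omega>} + emeasure M {\<omega>\<in>space M. x \<le> -1 * X \<omega>}"
    by (intro emeasure_subadditive) measurable
  also have "\<dots> \<le> ennreal (exp (- (x\<^sup>2 / (2 * \<sigma>\<^sup>2)))) + ennreal (exp (- (x\<^sup>2 / (2 * \<sigma>\<^sup>2))))"
    by (intro add_mono one) auto
  also have "\<dots> = ennreal (2 * exp (- (x\<^sup>2 / (2 * \<sigma>\<^sup>2))))"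
    by (simp add: ennreal_plus[symmetric] del: ennreal_plus)
  finally show ?thesis by (simp add: emeasure_eq_measure)
qed

text \<open>The density is smallest at the far end of an interval of length \<open>\<sigma>\<close>. The sign \<open>c = \<plusminus> 1\<close> covers rises and falls.\<close>

lemma normal_interval_lower:
  assumes X: "distributed M lborel X (normal_density 0 \<sigma>)" and \<sigma>: "\<sigma> > 0" and x: "x \<ge> 0"
    and c: "c\<^sup>2 = 1"
  shows "exp (- ((x + \<sigma>)\<^sup>2 / (2 * \<sigma>\<^sup>2))) / sqrt (2 * pi) \<le> prob {\<omega>\<in>space M. x \<le> c * X \<omega> \<and> c * X \<omega> \<le> x + \<sigma>}"
proof -
  have rv[measurable]: "X \<in> borel_measurable M" using distributed_measurable[OF X] by simp
  have cc: "c = 1 \<or> c = -1" using c by (simp add: power2_eq_1_iff)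
  define S where "S = {y::real. x \<le> c * y \<and> c * y \<le> x + \<sigma>}"
  have S: "S = (if c = 1 then {x..x+\<sigma>} else {-(x+\<sigma>)..-x})" using cc by (auto simp: S_def)
  have [measurable]: "S \<in> sets borel" by (simp add: S)
  have "ennreal (exp (- ((x + \<sigma>)\<^sup>2 / (2 * \<sigma>\<^sup>2))) / sqrt (2 * pi))
     = ennreal (exp (- ((x + \<sigma>)\<^sup>2 / (2 * \<sigma>\<^sup>2))) / (sqrt (2 * pi) * \<sigma>)) * emeasure lborel S"
    using \<sigma> by (auto simp: S ennreal_mult[symmetric])
  also have "\<dots> = (\<integral>\<^sup>+y. ennreal (exp (- ((x + \<sigma>)\<^sup>2 / (2 * \<sigma>\<^sup>2))) / (sqrt (2 * pi) * \<sigma>)) * indicator S y \<partial>lborel)"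
    by (rule nn_integral_cmult_indicator[symmetric]) simp
  also have "\<dots> \<le> (\<integral>\<^sup>+y. ennreal (normal_density 0 \<sigma> y) * indicator S y \<partial>lborel)"
  proof (rule nn_integral_mono)
    fix y
    have "exp (- ((x + \<sigma>)\<^sup>2 / (2 * \<sigma>\<^sup>2))) / (sqrt (2 * pi) * \<sigma>) \<le> normal_density 0 \<sigma> y" if "y \<in> S"
    proof -
      have "(c * y)\<^sup>2 \<le> (x + \<sigma>)\<^sup>2" using that x by (intro power_mono) (auto simp: S_def)
      then have "y\<^sup>2 \<le> (x + \<sigma>)\<^sup>2" using c by (simp add: power_mult_distrib)
      then have "y\<^sup>2 / (2 * \<sigma>\<^sup>2) \<le> (x + \<sigma>)\<^sup>2 / (2 * \<sigma>\<^sup>2)" by (intro divide_right_mono) auto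
      then have "exp (- ((x + \<sigma>)\<^sup>2 / (2 * \<sigma>\<^sup>2))) \<le> exp (- (y\<^sup>2 / (2 * \<sigma>\<^sup>2)))" by simp
      moreover have "sqrt (2 * pi * \<sigma>\<^sup>2) = sqrt (2 * pi) * \<sigma>" using \<sigma> by (simp add: real_sqrt_mult)
      ultimately show ?thesis unfolding normal_density_def using \<sigma> by (simp add: divide_right_mono)
    qed
    then show "ennreal (exp (- ((x + \<sigma>)\<^sup>2 / (2 * \<sigma>\<^sup>2))) / (sqrt (2 * pi) * \<sigma>)) * indicator S y
        \<le> ennreal (normal_density 0 \<sigma> y) * indicator S y"
      by (auto simp: indicator_def intro: ennreal_leI)
  qed
  also have "\<dots> = emeasure M (X -` S \<inter> space M)"
    by (rule distributed_emeasure[OF X, symmetric]) simp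
  also have "X -` S \<inter> space M = {\<omega>\<in>space M. x \<le> c * X \<omega> \<and> c * X \<omega> \<le> x + \<sigma>}" by (auto simp: S_def)
  finally show ?thesis by (simp add: emeasure_eq_measure)
qed

end

section \<open>Grid sums and modulus of continuity of Brownian paths\<close>

text \<open>Chaining: a point is the limit of its dyadic roundings, and passing from level \<open>l\<close> to level \<open>l + 1\<close> moves the
rounding by at most one cell of level \<open>l + 1\<close>. The tail of the geometric series from level \<open>l0 + 1\<close> on is
\<open>9 (9/10) ^ l0\<close>, which is paid for both points, and one more cell of level \<open>l0\<close> lies between their roundings.\<close>

lemma dyadic_modulus:
  fixes f :: "real \<Rightarrow> real"
  assumes B: "B > 0" and a: "a \<ge> 0" and cont: "continuous_on {0..} f"
    and small: "\<And>l i. l \<ge> l0 \<Longrightarrow> i < 2 ^ l \<Longrightarrow>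
        \<bar>f (real (Suc i) * (B / 2 ^ l)) - f (real i * (B / 2 ^ l))\<bar> \<le> (9/10) ^ l * a"
    and st: "0 \<le> s" "s \<le> B" "0 \<le> t" "t \<le> B" "\<bar>s - t\<bar> \<le> B / 2 ^ l0"
  shows "\<bar>f s - f t\<bar> \<le> 19 * (9/10) ^ l0 * a"
proof -
  define g where "g l t = nat \<lfloor>t / (B / 2 ^ l)\<rfloor>" for l t
  define p where "p l t = real (g l t) * (B / 2 ^ l)" for l t
  have h: "B / 2 ^ l > 0" for l :: nat using B by simp
  note fc = floor_cell[OF h, folded g_def, folded p_def]
  have g_le: "g l t \<le> 2 ^ l" if "0 \<le> t" "t \<le> B" for l t
  proof -
    have "real (g l t) * (B / 2 ^ l) \<le> 2 ^ l * (B / 2 ^ l)" using fc(1)[OF that(1), of l] that B by (simp add: p_def)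
    then have "real (g l t) \<le> 2 ^ l" using h[of l] by (simp only: mult_le_cancel_right_pos)
    then show ?thesis by (simp flip: of_nat_le_iff)
  qed
  have g_adj: "g l t \<in> {g l s, Suc (g l s)}" if "0 \<le> s" "s \<le> t" "t - s \<le> B / 2 ^ l" for l s t
  proof -
    have "s / (B / 2 ^ l) \<le> t / (B / 2 ^ l)" using that h[of l] by (intro divide_right_mono) auto
    moreover have "t / (B / 2 ^ l) \<le> s / (B / 2 ^ l) + 1" using that B by (simp add: field_simps)
    moreover have "0 \<le> s / (B / 2 ^ l)" using that B by simp
    ultimately show ?thesis unfolding g_def by simp linarith
  qed
  have g_Suc: "g (Suc l) t \<in> {2 * g l t, Suc (2 * g l t)}" if "0 \<le> t" for l t
  proof -
    have e: "t / (B / 2 ^ Suc l) = 2 * (t / (B / 2 ^ l))" by simp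
    have "0 \<le> t / (B / 2 ^ l)" using that B by simp
    then show ?thesis unfolding g_def e by simp linarith
  qed
  have level: "\<bar>f (p (Suc l) t) - f (p l t)\<bar> \<le> (9/10) ^ Suc l * a" if "l \<ge> l0" "0 \<le> t" "t \<le> B" for l t
  proof -
    have e: "p l t = real (2 * g l t) * (B / 2 ^ Suc l)" by (simp add: p_def)
    from g_Suc[OF that(2), of l] consider "g (Suc l) t = 2 * g l t" | "g (Suc l) t = Suc (2 * g l t)" by auto
    then show ?thesis
    proof cases
      case 1
      then have "p (Suc l) t = p l t" unfolding e by (simp add: p_def)
      then show ?thesis using a by simp
    next
      case 2
      have "2 * g l t < 2 ^ Suc l" using g_le[OF that(2,3), of "Suc l"] 2 by simp
      from small[OF _ this] that(1) show ?thesis unfolding e by (simp add: p_def 2)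
    qed
  qed
  have chain: "\<bar>f (p (l0 + n) t) - f (p l0 t)\<bar> \<le> 9 * ((9/10) ^ l0 - (9/10) ^ (l0 + n)) * a"
    if t: "0 \<le> t" "t \<le> B" for n t
  proof (induction n)
    case (Suc n)
    have "\<bar>f (p (l0 + Suc n) t) - f (p l0 t)\<bar> \<le> 9 * ((9/10) ^ l0 - (9/10) ^ (l0 + n)) * a + (9/10) ^ Suc (l0 + n) * a"
      using Suc.IH level[of "l0 + n", OF _ t] unfolding add_Suc_right by linarith
    also have "\<dots> = 9 * ((9/10) ^ l0 - (9/10) ^ (l0 + Suc n)) * a" by (simp add: algebra_simps)
    finally show ?case .
  qed simp
  have close: "\<bar>f t - f (p l0 t)\<bar> \<le> 9 * (9/10) ^ l0 * a" if t: "0 \<le> t" "t \<le> B" for t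
  proof -
    have "(\<lambda>n. p (l0 + n) t) \<longlonglongrightarrow> t"
    proof (rule tendsto_sandwich[OF always_eventually always_eventually])
      show "\<forall>n. t - B / 2 ^ (l0 + n) \<le> p (l0 + n) t"
      proof
        fix n show "t - B / 2 ^ (l0 + n) \<le> p (l0 + n) t" using fc(2)[OF t(1), of "l0 + n"] by linarith
      qed
      show "\<forall>n. p (l0 + n) t \<le> t" using fc(1)[OF t(1)] by blast
      show "(\<lambda>n. t - B / 2 ^ (l0 + n)) \<longlonglongrightarrow> t" by real_asymp
    qed auto
    moreover have "p l t \<in> {0..}" for l using B by (simp add: p_def)
    ultimately have "(\<lambda>n. f (p (l0 + n) t)) \<longlonglongrightarrow> f t"
      using t by (intro continuous_on_tendsto_compose[OF cont]) auto
    then have "(\<lambda>n. \<bar>f (p (l0 + n) t) - f (p l0 t)\<bar>) \<longlonglongrightarrow> \<bar>f t - f (p l0 t)\<bar>" by (intro tendsto_intros)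
    moreover have "\<bar>f (p (l0 + n) t) - f (p l0 t)\<bar> \<le> 9 * (9/10) ^ l0 * a" for n
    proof -
      have "9 * ((9/10) ^ l0 - (9/10) ^ (l0 + n)) * a \<le> 9 * (9/10) ^ l0 * a"
        using a by (intro mult_right_mono) auto
      with chain[OF t, of n] show ?thesis by linarith
    qed
    ultimately show ?thesis by (intro LIMSEQ_le_const2) auto
  qed
  have adj: "\<bar>f (p l0 t) - f (p l0 s)\<bar> \<le> (9/10) ^ l0 * a" if st: "0 \<le> s" "s \<le> t" "t \<le> B" "t - s \<le> B / 2 ^ l0" for s t
  proof -
    from g_adj[OF st(1,2,4)] consider "g l0 t = g l0 s" | "g l0 t = Suc (g l0 s)" by auto
    then show ?thesis
    proof cases
      case 1 then show ?thesis using a by (simp add: p_def)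
    next
      case 2
      then have "g l0 s < 2 ^ l0" using g_le[of t l0] st by simp
      from small[OF _ this] 2 show ?thesis by (simp add: p_def)
    qed
  qed
  show ?thesis
    using close[OF st(1,2)] close[OF st(3,4)] adj[of s t] adj[of t s] st by (cases "s \<le> t") (auto simp: abs_minus_commute)
qed

lemma linear_le_geometric: "real l + 6 \<le> (162/100) ^ (l + 4)"
proof (induction l)
  case (Suc l)
  have "real (Suc l) + 6 \<le> (162/100) * (real l + 6)" by simp
  also have "\<dots> \<le> (162/100) * (162/100) ^ (l + 4)" using Suc by (intro mult_left_mono) auto
  finally show ?case unfolding add_Suc power_Suc .
qed (simp add: eval_nat_numeral)

lemma ln_ln_power: "q > 1 \<Longrightarrow> ln (ln (q ^ k)) = ln (real k * ln q)"
  by (simp add: ln_realpow)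

lemma exp_ln_ln_power:
  assumes "q > 1" "k > 0"
  shows "exp (- (c * ln (ln (q ^ k)))) = (real k * ln q) powr - c"
  using assms by (simp add: ln_ln_power powr_def)

lemma summable_log_powr:
  assumes "q > 1" "c > 1"
  shows "summable (\<lambda>k. (real k * ln q) powr - c)"
proof -
  have "summable (\<lambda>k. real k powr - c * ln q powr - c)"
    using assms by (intro summable_mult2) (simp add: summable_real_powr_iff)
  then show ?thesis using assms by (simp add: powr_mult)
qed

lemma lil_norm_sq: "exp 1 \<le> x \<Longrightarrow> (lil_norm x)\<^sup>2 = 2 * x * ln (ln x)"
  unfolding lil_norm_def using less_le_trans[OF exp_gt_zero, of 1 x] ln_ge_1[of x]
  by (intro real_sqrt_pow2 mult_nonneg_nonneg ln_ge_zero) auto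

text \<open>Two independent Brownian motions as one family indexed by the particle, matching \<^locale>\<open>branching_pair\<close>.\<close>

locale brownian_pair = prob_space M for M :: "'a measure" +
  fixes W :: "bool \<Rightarrow> real \<Rightarrow> 'a \<Rightarrow> real"
  assumes bm: "\<And>j. brownian_motion 1 (W j)"
    and indep_W: "indep_processes (W True) (W False)"
begin

abbreviation path :: "'a \<Rightarrow> bool \<Rightarrow> real \<Rightarrow> real" where
  "path \<omega> j t \<equiv> W j t \<omega>"

lemma W_measurable: "0 \<le> t \<Longrightarrow> W j t \<in> borel_measurable M"
  using bm[of j] unfolding brownian_motion_def by blast

lemma increment_normal:
  "0 \<le> s \<Longrightarrow> s < t \<Longrightarrow> distributed M lborel (\<lambda>\<omega>. W j t \<omega> - W j s \<omega>) (normal_density 0 (sqrt (t - s)))"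
  using bm[of j] unfolding brownian_motion_def by blast

lemma AE_start: "AE \<omega> in M. \<forall>j. W j 0 \<omega> = 1"
  using bm unfolding brownian_motion_def by (simp add: all_bool_eq AE_conj_iff)

lemma AE_continuous: "AE \<omega> in M. \<forall>j. continuous_on {0..} (path \<omega> j)"
  using bm unfolding brownian_motion_def by (simp add: all_bool_eq AE_conj_iff)

lemma grid_inc_measurable [measurable]: "h > 0 \<Longrightarrow> (\<lambda>\<omega>. grid_inc (path \<omega>) h j i) \<in> borel_measurable M"
  unfolding grid_inc_def by (intro borel_measurable_diff W_measurable) auto

lemma grid_inc_normal:
  "h > 0 \<Longrightarrow> distributed M lborel (\<lambda>\<omega>. grid_inc (path \<omega>) h j i) (normal_density 0 (sqrt h))"
  unfolding grid_inc_def using increment_normal[of "real i * h" "real (Suc i) * h" j]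
  by (simp add: algebra_simps)

lemma grid_inc_indep:
  "h > 0 \<Longrightarrow> indep_vars (\<lambda>_. borel) (\<lambda>j \<omega>. grid_inc (path \<omega>) h (fst j) (snd j)) UNIV"
  unfolding grid_inc_def by (rule indep_increments_two_brownian[OF bm indep_W, of "\<lambda>i. real i * h"]) (auto intro!: mult_right_mono)

lemma AE_eventually_not:
  assumes meas: "\<And>k. A k \<in> events" and le: "\<forall>\<^sub>F k in sequentially. prob (A k) \<le> f k" and f: "summable f"
  shows "AE \<omega> in M. \<forall>\<^sub>F k in sequentially. \<omega> \<notin> A k"
proof -
  have "summable (\<lambda>k. prob (A k))"
    using le by (intro summable_comparison_test_ev[OF _ f]) simp
  then have "AE \<omega> in M. \<forall>\<^sub>F k in sequentially. \<omega> \<in> space M - A k"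
    by (intro borel_cantelli_AE1 meas) (auto simp: emeasure_eq_measure)
  then show ?thesis by (rule AE_mp) (auto intro!: AE_I2 elim: eventually_mono)
qed

text \<open>Chernoff's bound with the parameter \<open>l = x / (m h)\<close> that is optimal for a single Gaussian variable of variance \<open>m h\<close>.
In each cell \<open>exp (l Z)\<close> is at most the sum of its values for the three candidates that make up the maximum, which
gives the factor \<open>3\<close>.\<close>

lemma grid_sum_tail:
  assumes h: "h > 0" and x: "x \<ge> 0" and m: "m > 0"
  shows "prob {\<omega>\<in>space M. x \<le> grid_sum (path \<omega>) h m}
           \<le> 3 ^ m * exp (- (x\<^sup>2 / (2 * (real m * h))))"
proof -
  define l where "l = x / (real m * h)"
  have l: "l \<ge> 0" using x h by (simp add: l_def)
  define Z where "Z i \<omega> = max 0 (max (grid_inc (path \<omega>) h True i) (grid_inc (path \<omega>) h False i))" for i \<omega>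
  have Zm[measurable]: "Z i \<in> borel_measurable M" for i unfolding Z_def using h by measurable
  define S where "S = {\<omega>\<in>space M. x \<le> (\<Sum>i<m. Z i \<omega>)}"
  have [measurable]: "S \<in> sets M" unfolding S_def by measurable
  have "indep_vars (\<lambda>i. Pi\<^sub>M (UNIV \<times> {i}) (\<lambda>_. borel)) (\<lambda>i \<omega>. \<lambda>j\<in>UNIV \<times> {i}. grid_inc (path \<omega>) h (fst j) (snd j)) {..<m}"
    by (rule indep_vars_restrict[OF grid_inc_indep[OF h]]) (auto simp: disjoint_family_on_def)
  then have "indep_vars (\<lambda>_. borel) (\<lambda>i. (\<lambda>y. ennreal (exp (l * max 0 (max (y (True, i)) (y (False, i)))))) \<circ>
      (\<lambda>\<omega>. \<lambda>j\<in>UNIV \<times> {i}. grid_inc (path \<omega>) h (fst j) (snd j))) {..<m}"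
    by (rule indep_vars_compose) measurable
  then have ind: "indep_vars (\<lambda>_. borel) (\<lambda>i \<omega>. ennreal (exp (l * Z i \<omega>))) {..<m}"
    by (simp add: comp_def Z_def)
  have one: "(\<integral>\<^sup>+\<omega>. ennreal (exp (l * Z i \<omega>)) \<partial>M) \<le> ennreal (3 * exp (l\<^sup>2 * h / 2))" for i
  proof -
    have "(\<integral>\<^sup>+\<omega>. ennreal (exp (l * Z i \<omega>)) \<partial>M) \<le>
      (\<integral>\<^sup>+\<omega>. 1 + (ennreal (exp (l * grid_inc (path \<omega>) h True i)) + ennreal (exp (l * grid_inc (path \<omega>) h False i))) \<partial>M)"
    proof (rule nn_integral_mono)
      fix \<omega>
      have "Z i \<omega> \<in> {0, grid_inc (path \<omega>) h True i, grid_inc (path \<omega>) h False i}"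
        by (auto simp: Z_def max_def)
      then have "exp (l * Z i \<omega>) \<le> 1 + (exp (l * grid_inc (path \<omega>) h True i) + exp (l * grid_inc (path \<omega>) h False i))"
        by auto
      then show "ennreal (exp (l * Z i \<omega>)) \<le> 1 + (ennreal (exp (l * grid_inc (path \<omega>) h True i)) + ennreal (exp (l * grid_inc (path \<omega>) h False i)))"
        by (drule_tac ennreal_leI) simp
    qed
    also have "\<dots> = 1 + (ennreal (exp (l\<^sup>2 * h / 2)) + ennreal (exp (l\<^sup>2 * h / 2)))"
      using h normal_exp_moment[OF grid_inc_normal[OF h], of l]
      by (subst nn_integral_add; (subst nn_integral_add)?; simp add: emeasure_space_1)
    also have "\<dots> \<le> ennreal (3 * exp (l\<^sup>2 * h / 2))"
    proof -
      have "1 + (exp (l\<^sup>2 * h / 2) + exp (l\<^sup>2 * h / 2)) \<le> 3 * exp (l\<^sup>2 * h / 2)" using h by simp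
      moreover have "ennreal (1 + (a + b)) = 1 + (ennreal a + ennreal b)" if "0 \<le> a" "0 \<le> b" for a b
        using that by simp
      ultimately show ?thesis by (metis ennreal_leI exp_ge_zero)
    qed
    finally show ?thesis .
  qed
  have "emeasure M S = (\<integral>\<^sup>+\<omega>. indicator S \<omega> \<partial>M)"
    by (rule nn_integral_indicator[symmetric]) measurable
  also have "\<dots> \<le> (\<integral>\<^sup>+\<omega>. ennreal (exp (- l * x)) * (\<Prod>i<m. ennreal (exp (l * Z i \<omega>))) \<partial>M)"
  proof (rule nn_integral_mono)
    fix \<omega>
    have e: "ennreal (exp (- l * x)) * (\<Prod>i<m. ennreal (exp (l * Z i \<omega>))) = ennreal (exp (- l * x + l * (\<Sum>i<m. Z i \<omega>)))"
    proof -
      have "(\<Prod>i<m. exp (l * Z i \<omega>)) = exp (l * (\<Sum>i<m. Z i \<omega>))" by (simp add: exp_sum sum_distrib_left)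
      then show ?thesis by (simp add: prod_ennreal ennreal_mult[symmetric] mult_exp_exp del: sum_distrib_left)
    qed
    have "l * x \<le> l * (\<Sum>i<m. Z i \<omega>)" if "\<omega> \<in> S" using that l by (intro mult_left_mono) (auto simp: S_def)
    then show "indicator S \<omega> \<le> ennreal (exp (- l * x)) * (\<Prod>i<m. ennreal (exp (l * Z i \<omega>)))"
      unfolding e by (auto simp: indicator_def)
  qed
  also have "\<dots> = ennreal (exp (- l * x)) * (\<Prod>i<m. \<integral>\<^sup>+\<omega>. ennreal (exp (l * Z i \<omega>)) \<partial>M)"
    using indep_vars_nn_integral[OF _ ind] by (subst nn_integral_cmult) auto
  also have "\<dots> \<le> ennreal (exp (- l * x)) * (\<Prod>i<m. ennreal (3 * exp (l\<^sup>2 * h / 2)))"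
    by (intro mult_left_mono prod_mono_ennreal one) auto
  also have "\<dots> = ennreal (exp (- l * x) * (3 * exp (l\<^sup>2 * h / 2)) ^ m)"
  proof -
    have "ennreal r * (\<Prod>i<m. ennreal E) = ennreal (r * E ^ m)" if "0 \<le> r" "0 \<le> E" for r E
      using that by (simp add: ennreal_power ennreal_mult)
    then show ?thesis by simp
  qed
  also have "exp (- l * x) * (3 * exp (l\<^sup>2 * h / 2)) ^ m = 3 ^ m * exp (- l * x + real m * (l\<^sup>2 * h / 2))"
    by (simp only: power_mult_distrib exp_of_nat_mult exp_add mult_ac)
  also have "- l * x + real m * (l\<^sup>2 * h / 2) = - (x\<^sup>2 / (2 * (real m * h)))"
    using h m by (simp add: l_def field_simps power2_eq_square)
  finally show ?thesis by (simp add: emeasure_eq_measure S_def Z_def grid_sum_def)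
qed

lemma AE_grid_ok: "AE \<omega> in M. \<forall>q\<in>\<rat>. q > 1 \<longrightarrow> grid_ok (path \<omega>) q"
proof -
  have one: "AE \<omega> in M. \<forall>\<^sub>F k in sequentially.
      grid_sum (path \<omega>) (q^k / real (Suc m)) (Suc m) \<le> (1 + 1 / Suc r) * lil_norm (q^k)" if q: "q > 1" for q :: real and m r :: nat
  proof -
    define A where "A k = {\<omega>\<in>space M. (1 + 1 / Suc r) * lil_norm (q^k) \<le> grid_sum (path \<omega>) (q^k / real (Suc m)) (Suc m)}" for k
    have h: "q ^ k / real (Suc m) > 0" for k using q by simp
    note [measurable] = grid_inc_measurable[OF h]
    have Am: "A k \<in> events" for k unfolding A_def grid_sum_def by measurable
    have "\<forall>\<^sub>F k in sequentially. exp 1 \<le> q ^ k" by (rule eventually_le_power[OF q])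
    then have le: "\<forall>\<^sub>F k in sequentially. prob (A k) \<le> 3 ^ Suc m * (real k * ln q) powr - (1 + 1 / Suc r)\<^sup>2"
      using eventually_gt_at_top[of 0]
    proof eventually_elim
      case (elim k)
      have "prob (A k) \<le> 3 ^ Suc m * exp (- (((1 + 1 / Suc r) * lil_norm (q^k))\<^sup>2 / (2 * (real (Suc m) * (q ^ k / real (Suc m))))))"
        unfolding A_def using h lil_norm_nonneg[OF elim(1)] by (intro grid_sum_tail) auto
      also have "((1 + 1 / Suc r) * lil_norm (q^k))\<^sup>2 / (2 * (real (Suc m) * (q ^ k / real (Suc m)))) = (1 + 1 / Suc r)\<^sup>2 * ln (ln (q ^ k))"
        using q by (simp add: power_mult_distrib lil_norm_sq[OF elim(1)])
      finally show ?case using exp_ln_ln_power[OF q elim(2)] by simp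
    qed
    have "1 < (1 + 1 / real (Suc r))\<^sup>2" by (intro one_less_power) auto
    from AE_eventually_not[OF Am le summable_mult[OF summable_log_powr[OF q this]]]
    have "AE \<omega> in M. \<forall>\<^sub>F k in sequentially. \<omega> \<notin> A k" .
    then show ?thesis
    proof (rule AE_mp, intro AE_I2 impI)
      fix \<omega> assume "\<omega> \<in> space M" "\<forall>\<^sub>F k in sequentially. \<omega> \<notin> A k"
      from this(2) show "\<forall>\<^sub>F k in sequentially.
      grid_sum (path \<omega>) (q^k / real (Suc m)) (Suc m) \<le> (1 + 1 / Suc r) * lil_norm (q^k)"
        by eventually_elim (use \<open>\<omega> \<in> space M\<close> in \<open>auto simp: A_def\<close>)
    qed
  qed
  have "AE \<omega> in M. \<forall>q\<in>\<rat> \<inter> {1<..}. \<forall>m r. \<forall>\<^sub>F k in sequentially.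
      grid_sum (path \<omega>) (q^k / real (Suc m)) (Suc m) \<le> (1 + 1 / Suc r) * lil_norm (q^k)"
    using countable_rat by (subst AE_ball_countable) (auto simp: AE_all_countable simp del: of_nat_Suc intro!: one)
  then show ?thesis
  proof (rule AE_mp, intro AE_I2 impI ballI)
    fix \<omega> q assume q: "q \<in> \<rat>" "q > (1::real)" and H: "\<forall>q\<in>\<rat> \<inter> {1<..}. \<forall>m r. \<forall>\<^sub>F k in sequentially.
      grid_sum (path \<omega>) (q^k / real (Suc m)) (Suc m) \<le> (1 + 1 / Suc r) * lil_norm (q^k)"
    show "grid_ok (path \<omega>) q"
      unfolding grid_ok_def
    proof (intro allI impI)
      fix m :: nat and \<eta> :: real assume m: "m > 0" and \<eta>: "\<eta> > 0"
      obtain r where r: "1 / real (Suc r) < \<eta>" using reals_Archimedean[OF \<eta>] by (auto simp: inverse_eq_divide)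
      obtain m' where m': "m = Suc m'" using m by (cases m) auto
      have "\<forall>\<^sub>F k in sequentially. exp 1 \<le> q ^ k" by (rule eventually_le_power[OF q(2)])
      moreover have "\<forall>\<^sub>F k in sequentially.
        grid_sum (path \<omega>) (q^k / real m) m \<le> (1 + 1 / Suc r) * lil_norm (q^k)"
        unfolding m' using H q by blast
      ultimately show "\<forall>\<^sub>F k in sequentially.
        grid_sum (path \<omega>) (q^k / real m) m \<le> (1 + \<eta>) * lil_norm (q^k)"
      proof eventually_elim
        case (elim k)
        have "(1 + 1 / Suc r) * lil_norm (q^k) \<le> (1 + \<eta>) * lil_norm (q^k)"
          using r lil_norm_nonneg[OF elim(1)] by (intro mult_right_mono) auto
        with elim(2) show ?case by linarith
      qed
    qed
  qed
qed

text \<open>The increments over the dyadic cells of level \<open>l\<close> are compared with \<open>(9/10) ^ l lil_norm (q ^ k)\<close>. As \<open>2 (9/10)\<^sup>2 > 1\<close>, the Gaussian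
exponent grows geometrically in \<open>l\<close> and beats the number \<open>2 ^ l\<close> of cells; with all levels from \<open>4\<close> on the
failure probability is of the order \<open>exp (- 2 ln (ln (q ^ k)))\<close>, which is summable in \<open>k\<close>.\<close>

lemma AE_modulus_ok: "AE \<omega> in M. \<forall>q\<in>\<rat>. q > 1 \<longrightarrow> modulus_ok (path \<omega>) q"
proof -
  have one: "AE \<omega> in M. \<forall>\<^sub>F k in sequentially. \<forall>j. \<forall>l\<ge>4. \<forall>i<2^l.
      \<bar>grid_inc (path \<omega>) (q ^ k / 2 ^ l) j i\<bar> \<le> (9/10) ^ l * lil_norm (q ^ k)" if q: "q > 1" for q :: real
  proof -
    define E where "E k j l i = {\<omega>\<in>space M. (9/10) ^ (l + 4) * lil_norm (q ^ k) \<le> \<bar>grid_inc (path \<omega>) (q ^ k / 2 ^ (l + 4)) j i\<bar>}" for k j l i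
    have h: "q ^ k / 2 ^ l > 0" for k l :: nat using q by simp
    note [measurable] = grid_inc_measurable[OF h]
    have Em[measurable]: "E k j l i \<in> events" for k j l i unfolding E_def by measurable
    define A where "A k = (\<Union>l. \<Union>j\<in>UNIV. \<Union>i\<in>{..<2^(l+4)}. E k j l i)" for k
    have Am: "A k \<in> events" for k unfolding A_def by (intro sets.countable_UN'' sets.countable_UN sets.finite_UN) auto
    \<comment> \<open>From here on \<open>exp (- L) \<le> 1 / 4\<close>, so that one factor \<open>exp (- L)\<close> per level beats the doubling of the number of cells.\<close>
    have "\<forall>\<^sub>F k in sequentially. exp 4 \<le> q ^ k" by (rule eventually_le_power[OF q])
    then have le: "\<forall>\<^sub>F k in sequentially. prob (A k) \<le> 128 * (real k * ln q) powr - 2"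
      using eventually_gt_at_top[of 0]
    proof eventually_elim
      case (elim k)
      define L where "L = ln (ln (q ^ k))"
      have e1: "exp 1 \<le> q ^ k" using elim(1) by (rule order_trans[rotated]) simp
      have "4 \<le> ln (q ^ k)" using elim(1) q by (subst ln_ge_iff) auto
      then have expL: "exp L \<ge> 4" unfolding L_def by simp
      then have L: "L \<ge> 0" by (metis exp_ge_zero ln_exp ln_ge_zero order_trans one_le_numeral)
      have EE: "prob (E k j l i) \<le> 2 * (exp (- L)) ^ (l + 6)" for j l i
      proof -
        have "prob (E k j l i) \<le> 2 * exp (- (((9/10) ^ (l + 4) * lil_norm (q ^ k))\<^sup>2 / (2 * (sqrt (q ^ k / 2 ^ (l + 4)))\<^sup>2)))"
          unfolding E_def using lil_norm_nonneg[OF e1] h by (intro normal_tail grid_inc_normal) auto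
        also have "(sqrt (q ^ k / 2 ^ (l + 4)))\<^sup>2 = q ^ k / 2 ^ (l + 4)" using h[of k "l + 4"] by (intro real_sqrt_pow2) simp
        also have "((9/10) ^ (l + 4) * lil_norm (q ^ k))\<^sup>2 / (2 * (q ^ k / 2 ^ (l + 4))) = ((9/10) ^ (l + 4))\<^sup>2 * 2 ^ (l + 4) * L"
          using q by (simp add: power_mult_distrib lil_norm_sq[OF e1] L_def)
        also have "((9/10::real) ^ (l + 4))\<^sup>2 * 2 ^ (l + 4) = (162/100) ^ (l + 4)"
          unfolding power_mult[symmetric] mult.commute[of "l + 4" 2] unfolding power_mult power_mult_distrib[symmetric]
          by (simp add: power2_eq_square)
        also have "2 * exp (- ((162/100) ^ (l + 4) * L)) \<le> 2 * exp (- ((real l + 6) * L))"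
          using mult_right_mono[OF linear_le_geometric[of l] L] by simp
        also have "exp (- ((real l + 6) * L)) = (exp (- L)) ^ (l + 6)"
          by (simp add: exp_of_nat_mult[symmetric])
        finally show ?thesis .
      qed
      define D where "D l = (\<Union>j\<in>UNIV. \<Union>i\<in>{..<2^(l+4)}. E k j l i)" for l
      have Dm: "range D \<subseteq> events" unfolding D_def by auto
      have Dle: "prob (D l) \<le> 64 * exp (- L) ^ 2 * (1/2) ^ l" for l
      proof -
        have "prob (D l) \<le> (\<Sum>j\<in>UNIV. prob (\<Union>i\<in>{..<2^(l+4)}. E k j l i))"
          unfolding D_def by (intro finite_measure_subadditive_finite) auto
        also have "\<dots> \<le> (\<Sum>j\<in>(UNIV::bool set). \<Sum>i\<in>{..<2^(l+4)}. prob (E k j l i))"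
          by (intro sum_mono finite_measure_subadditive_finite) auto
        also have "\<dots> \<le> (\<Sum>j\<in>(UNIV::bool set). \<Sum>i\<in>{..<(2::nat)^(l+4)}. 2 * (exp (- L)) ^ (l + 6))"
          by (intro sum_mono EE)
        also have "\<dots> = 64 * exp (- L) ^ 2 * ((2 * exp (- L)) ^ l * exp (- L) ^ 4)"
          by (simp add: UNIV_bool power_add power_mult_distrib)
        also have "\<dots> \<le> 64 * exp (- L) ^ 2 * ((1/2) ^ l * 1)"
        proof -
          have "2 * exp (- L) \<le> 1 / 2" using expL by (simp add: exp_minus field_simps)
          moreover have "exp (- L) ^ 4 \<le> 1" using L by (intro power_le_one) auto
          ultimately show ?thesis by (intro mult_left_mono mult_mono power_mono) auto
        qed
        finally show ?thesis by simp
      qed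
      have geo: "summable (\<lambda>l. 64 * exp (- L) ^ 2 * (1/2::real) ^ l)" by (intro summable_mult summable_geometric) simp
      have sD: "summable (\<lambda>l. prob (D l))"
        by (rule summable_comparison_test[OF _ geo]) (use Dle in auto)
      have "prob (A k) \<le> (\<Sum>l. prob (D l))"
        unfolding A_def D_def[symmetric] by (rule finite_measure_subadditive_countably[OF Dm sD])
      also have "\<dots> \<le> (\<Sum>l. 64 * exp (- L) ^ 2 * (1/2) ^ l)"
        by (rule suminf_le[OF Dle sD geo])
      also have "\<dots> = 128 * exp (- L) ^ 2"
        by (subst suminf_mult) (auto simp: suminf_geometric)
      also have "exp (- L) ^ 2 = exp (- (2 * L))" by (simp add: power2_eq_square mult_exp_exp)
      finally show ?case using exp_ln_ln_power[OF q elim(2), of 2] by (simp add: L_def)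
    qed
    have "(2::real) > 1" by simp
    from AE_eventually_not[OF Am le summable_mult[OF summable_log_powr[OF q this]]]
    have "AE \<omega> in M. \<forall>\<^sub>F k in sequentially. \<omega> \<notin> A k" .
    then show ?thesis
    proof (rule AE_mp, intro AE_I2 impI)
      fix \<omega> assume sp: "\<omega> \<in> space M" and "\<forall>\<^sub>F k in sequentially. \<omega> \<notin> A k"
      from this(2) show "\<forall>\<^sub>F k in sequentially. \<forall>j. \<forall>l\<ge>4. \<forall>i<2^l.
          \<bar>grid_inc (path \<omega>) (q ^ k / 2 ^ l) j i\<bar> \<le> (9/10) ^ l * lil_norm (q ^ k)"
      proof (eventually_elim, intro allI impI)
        fix k j l and i :: nat assume nA: "\<omega> \<notin> A k" and l: "4 \<le> l" and i: "i < 2 ^ l"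
        obtain l' where l': "l = l' + 4" using l by (metis add.commute le_Suc_ex)
        have "\<omega> \<notin> E k j l' i" using nA i unfolding A_def l' by blast
        then show "\<bar>grid_inc (path \<omega>) (q ^ k / 2 ^ l) j i\<bar> \<le> (9/10) ^ l * lil_norm (q ^ k)"
          using sp by (simp add: E_def l')
      qed
    qed
  qed
  have "AE \<omega> in M. \<forall>q\<in>\<rat> \<inter> {1<..}. \<forall>\<^sub>F k in sequentially. \<forall>j. \<forall>l\<ge>4. \<forall>i<2^l.
      \<bar>grid_inc (path \<omega>) (q ^ k / 2 ^ l) j i\<bar> \<le> (9/10) ^ l * lil_norm (q ^ k)"
    using countable_rat by (subst AE_ball_countable) (auto intro!: one)
  with AE_continuous show ?thesis
  proof (eventually_elim, intro ballI impI)
    fix \<omega> and q :: real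
    assume cont: "\<forall>j. continuous_on {0..} (path \<omega> j)" and q: "q \<in> \<rat>" "q > 1"
      and H: "\<forall>q\<in>\<rat> \<inter> {1<..}. \<forall>\<^sub>F k in sequentially. \<forall>j. \<forall>l\<ge>4. \<forall>i<2^l.
      \<bar>grid_inc (path \<omega>) (q ^ k / 2 ^ l) j i\<bar> \<le> (9/10) ^ l * lil_norm (q ^ k)"
    show "modulus_ok (path \<omega>) q"
      unfolding modulus_ok_def
    proof (intro allI impI)
      fix \<eta> :: real assume \<eta>: "\<eta> > 0"
      have "(\<lambda>l. 19 * (9/10::real) ^ l) \<longlonglongrightarrow> 0" by real_asymp
      then have "\<forall>\<^sub>F l in sequentially. 19 * (9/10::real) ^ l < \<eta>" using \<eta> by (rule order_tendstoD)
      with eventually_ge_at_top[of 4] obtain l0 where l0: "l0 \<ge> 4" "19 * (9/10::real) ^ l0 < \<eta>"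
        by (metis (mono_tags, lifting) eventually_conj eventually_happens trivial_limit_sequentially)
      have "\<forall>\<^sub>F k in sequentially. exp 1 \<le> q ^ k" by (rule eventually_le_power[OF q(2)])
      moreover have "\<forall>\<^sub>F k in sequentially. \<forall>j. \<forall>l\<ge>4. \<forall>i<2^l.
        \<bar>grid_inc (path \<omega>) (q ^ k / 2 ^ l) j i\<bar> \<le> (9/10) ^ l * lil_norm (q ^ k)" using H q by blast
      ultimately have "\<forall>\<^sub>F k in sequentially. osc_le (path \<omega>) (q^k) (q^k / real (2 ^ l0)) (\<eta> * lil_norm (q^k))"
      proof (eventually_elim, unfold osc_le_def, intro allI ballI impI)
        fix k j s t
        assume e: "exp 1 \<le> q ^ k" and G: "\<forall>j. \<forall>l\<ge>4. \<forall>i<2^l. \<bar>grid_inc (path \<omega>) (q ^ k / 2 ^ l) j i\<bar> \<le> (9/10) ^ l * lil_norm (q ^ k)"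
          and st: "s \<in> {0..q^k}" "t \<in> {0..q^k}" "\<bar>s - t\<bar> \<le> q^k / real (2 ^ l0)"
        have "\<bar>W j s \<omega> - W j t \<omega>\<bar> \<le> 19 * (9/10) ^ l0 * lil_norm (q ^ k)"
          using G l0 st cont q lil_norm_nonneg[OF e]
          by (intro dyadic_modulus[of "q ^ k"]) (auto simp: grid_inc_def)
        also have "\<dots> \<le> \<eta> * lil_norm (q^k)"
          using l0 lil_norm_nonneg[OF e] by (intro mult_right_mono) auto
        finally show "\<bar>W j s \<omega> - W j t \<omega>\<bar> \<le> \<eta> * lil_norm (q^k)" .
      qed
      then show "\<exists>m::nat. m > 0 \<and> (\<forall>\<^sub>F k in sequentially.
          osc_le (path \<omega>) (q^k) (q^k / m) (\<eta> * lil_norm (q^k)))"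
        by (intro exI[of _ "2 ^ l0"] conjI) auto
    qed
  qed
qed

end

section \<open>The driving events occur infinitely often\<close>

text \<open>The second Borel--Cantelli lemma for conjunctions over disjoint finite blocks of one independent
family. The complements over \<open>n \<le> k < n + l\<close> have probability \<open>\<Prod> (1 - p k) \<le> exp (- \<Sum> p k)\<close>, so a positive probability of
failing from \<open>n\<close> on would bound the partial sums of \<open>p\<close>.\<close>

lemma (in prob_space) AE_frequently_all_in_block:
  fixes X :: "'i \<Rightarrow> 'a \<Rightarrow> real"
  assumes ind: "indep_vars (\<lambda>_. borel) X UNIV"
    and K: "disjoint_family K" "\<And>k. finite (K k)" "\<And>k. K k \<noteq> {}"
    and S: "\<And>i. S i \<in> sets borel"
    and div: "\<not> summable (\<lambda>k. \<Prod>i\<in>K k. prob (X i -` S i \<inter> space M))"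
  shows "AE \<omega> in M. \<exists>\<^sub>F k in sequentially. \<forall>i\<in>K k. X i \<omega> \<in> S i"
proof -
  define p where "p k = (\<Prod>i\<in>K k. prob (X i -` S i \<inter> space M))" for k
  define V where "V k \<omega> = (\<lambda>i\<in>K k. X i \<omega>)" for k \<omega>
  define Box where "Box k = Pi\<^sub>E (K k) S" for k
  have Box: "Box k \<in> sets (Pi\<^sub>M (K k) (\<lambda>_. borel))" for k
    unfolding Box_def using S K by (intro sets_PiM_I_finite) auto
  have Vind: "indep_vars (\<lambda>k. Pi\<^sub>M (K k) (\<lambda>_. borel)) V UNIV"
    using indep_vars_restrict[OF ind, of UNIV K] K unfolding V_def by auto
  then have Vm: "V k \<in> measurable M (Pi\<^sub>M (K k) (\<lambda>_. borel))" for k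
    by (auto simp: indep_vars_def)
  define A where "A k = V k -` Box k \<inter> space M" for k
  define N where "N k = V k -` (space (Pi\<^sub>M (K k) (\<lambda>_. borel)) - Box k) \<inter> space M" for k
  have A_eq: "A k = (\<Inter>i\<in>K k. X i -` S i \<inter> space M)" for k
    using K(3)[of k] by (auto simp: A_def V_def Box_def PiE_def Pi_def)
  have Am: "A k \<in> events" and Nm: "N k \<in> events" for k
    unfolding A_def N_def by (auto intro!: measurable_sets[OF Vm] Box)
  have pA: "prob (A k) = p k" for k
    unfolding A_eq p_def using K S by (intro indep_varsD[OF ind]) auto
  have "N k = space M - A k" for k
    using measurable_space[OF Vm] by (auto simp: N_def A_def)
  then have pN: "prob (N k) = 1 - p k" for k
    using Am by (simp add: prob_compl pA)
  have p0: "p k \<ge> 0" for k unfolding p_def by (intro prod_nonneg) auto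
  have null: "(\<Inter>k\<in>{n..}. N k) \<in> null_sets M" for n
  proof -
    define e where "e = prob (\<Inter>k\<in>{n..}. N k)"
    have ev: "(\<Inter>k\<in>{n..}. N k) \<in> events" by (rule sets.countable_INT') (auto intro: Nm)
    have "e = 0"
    proof (rule ccontr)
      assume "e \<noteq> 0"
      then have e: "e > 0" unfolding e_def by (simp add: zero_less_measure_iff)
      have bound: "(\<Sum>k\<in>{n..<n + Suc l}. p k) \<le> - ln e" for l
      proof -
        have "e \<le> prob (\<Inter>k\<in>{n..<n + Suc l}. N k)"
          unfolding e_def by (intro finite_measure_mono sets.finite_INT) (auto intro: Nm)
        also have "\<dots> = (\<Prod>k\<in>{n..<n + Suc l}. 1 - p k)"
          unfolding pN[symmetric] unfolding N_def
          by (intro indep_varsD[OF Vind]) (auto intro!: sets.compl_sets Box)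
        also have "\<dots> \<le> (\<Prod>k\<in>{n..<n + Suc l}. exp (- p k))"
        proof (intro prod_mono conjI)
          fix k show "0 \<le> 1 - p k" using pN[of k] by (metis measure_nonneg)
          show "1 - p k \<le> exp (- p k)" using exp_ge_add_one_self[of "- p k"] by simp
        qed
        also have "\<dots> = exp (- (\<Sum>k\<in>{n..<n + Suc l}. p k))"
          by (simp only: exp_sum[OF finite_atLeastLessThan, symmetric] sum_negf)
        finally have "ln e \<le> ln (exp (- (\<Sum>k\<in>{n..<n + Suc l}. p k)))"
          using e by (intro ln_mono) auto
        then show ?thesis unfolding ln_exp by linarith
      qed
      have "summable (\<lambda>k. p (k + n))"
      proof (rule summableI_nonneg_bounded[of _ "- ln e"])
        fix l
        have "(\<Sum>k<l. p (k + n)) \<le> (\<Sum>k<Suc l. p (k + n))" using p0 by simp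
        also have "\<dots> = (\<Sum>k\<in>{n..<n + Suc l}. p k)"
          using sum.shift_bounds_nat_ivl[of p 0 n "Suc l"] by (simp only: lessThan_atLeast0 add.commute add_0)
        finally show "(\<Sum>k<l. p (k + n)) \<le> - ln e" using bound[of l] by linarith
      qed (rule p0)
      then have "summable p" by (simp only: summable_iff_shift)
      with div show False by (simp add: p_def[abs_def])
    qed
    then show ?thesis using ev by (simp add: e_def null_sets_def emeasure_eq_measure)
  qed
  have "AE \<omega> in M. \<forall>n. \<omega> \<notin> (\<Inter>k\<in>{n..}. N k)"
    unfolding AE_all_countable using AE_not_in[OF null] by blast
  then show ?thesis
  proof (rule AE_mp, intro AE_I2 impI)
    fix \<omega> assume sp: "\<omega> \<in> space M" and "\<forall>n. \<omega> \<notin> (\<Inter>k\<in>{n..}. N k)"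
    then have "\<forall>n. \<exists>k\<ge>n. \<omega> \<in> A k"
      using \<open>\<And>k. N k = space M - A k\<close> by auto
    then show "\<exists>\<^sub>F k in sequentially. \<forall>i\<in>K k. X i \<omega> \<in> S i"
      unfolding frequently_sequentially A_eq by blast
  qed
qed

text \<open>With \<open>x = 1 / N\<close> the bracket is the energy of the driving shape: the square of the total rise \<open>1 - 20 / N\<close> of the second
path, plus a bound on the cost of letting the first path creep, plus the cost \<open>(4 / N)\<^sup>2 / (1 / N)\<close> of a fall by \<open>4 / N\<close>
during a time \<open>1 / N\<close>. The rise falls short of \<open>1\<close> by \<open>20 / N\<close> just in order to pay for the fall; the factor
\<open>1 + 1 / N\<close> is the loss in the Gaussian lower bound for one cell. The product is \<open>1 - 23 x\<close> plus terms of higher order,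
which \<open>x \<le> 1 / 40\<close> keeps below \<open>23 x\<close>.\<close>

lemma drive_energy:
  fixes x :: real
  assumes "0 \<le> x" "x \<le> 1 / 40"
  shows "(1 + x) * ((1 - 20 * x)\<^sup>2 + x\<^sup>2 / 16 + 16 * x) \<le> 1"
proof -
  have x2: "x * x \<le> x / 40" using mult_left_mono[OF assms(2,1)] by simp
  have "x * x * x \<le> x / 40 / 40"
    using mult_right_mono[OF x2 assms(1)] x2 by simp
  moreover have "(1 + x) * ((1 - 20 * x)\<^sup>2 + x\<^sup>2 / 16 + 16 * x) = 1 - 23 * x + 6017/16 * (x * x) + 6401/16 * (x * x * x)"
    by (simp add: power2_eq_square algebra_simps)
  ultimately show ?thesis using x2 assms(1) by linarith
qed

lemma ln_ln_at_top: "filterlim (\<lambda>x::real. ln (ln x)) at_top at_top"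
  by real_asymp

context brownian_pair
begin

text \<open>The lower bound for an interval of one standard deviation contains \<open>(x + \<sigma>)\<^sup>2\<close>, which is at most
\<open>(1 + 1/N) x\<^sup>2 + (1 + N) \<sigma>\<^sup>2\<close>; the second term gives a constant factor.\<close>

lemma grid_cell_lower:
  assumes q: "q > 1" and e1: "exp 1 \<le> q ^ k" and N: "N > 0" and m: "m > 0" and \<mu>: "\<mu> \<ge> 0" and c: "c\<^sup>2 = 1"
    and sub: "\<And>y. \<mu> * (lil_norm (q ^ k) / real m) \<le> c * y \<Longrightarrow>
        c * y \<le> \<mu> * (lil_norm (q ^ k) / real m) + sqrt (q ^ k / real m) \<Longrightarrow> y \<in> S"
    and S: "S \<in> sets borel"
  shows "exp (- ((1 + 1 / real N) * \<mu>\<^sup>2 * ln (ln (q ^ k)) / real m)) * (exp (- ((1 + real N) / 2)) / sqrt (2 * pi))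
     \<le> prob ((\<lambda>\<omega>. grid_inc (path \<omega>) (q ^ k / real m) j i) -` S \<inter> space M)"
proof -
  define h where "h = q ^ k / real m"
  have h: "h > 0" using q m by (simp add: h_def)
  define \<sigma> where "\<sigma> = sqrt h"
  have \<sigma>: "\<sigma> > 0" "\<sigma>\<^sup>2 = h" using h by (auto simp: \<sigma>_def)
  define x where "x = \<mu> * (lil_norm (q ^ k) / real m)"
  have x: "x \<ge> 0" using \<mu> lil_norm_nonneg[OF e1] by (simp add: x_def)
  have "2 * x * \<sigma> \<le> x\<^sup>2 / N + N * \<sigma>\<^sup>2"
  proof -
    have "0 \<le> (x - N * \<sigma>)\<^sup>2 / N" using N by simp
    then show ?thesis using N by (simp add: power2_eq_square field_simps)
  qed
  then have "(x + \<sigma>)\<^sup>2 \<le> (1 + 1 / N) * x\<^sup>2 + (1 + N) * \<sigma>\<^sup>2"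
    by (simp add: power2_eq_square algebra_simps)
  then have "(x + \<sigma>)\<^sup>2 / (2 * \<sigma>\<^sup>2) \<le> ((1 + 1 / N) * x\<^sup>2 + (1 + N) * \<sigma>\<^sup>2) / (2 * \<sigma>\<^sup>2)"
    by (intro divide_right_mono) auto
  also have "\<dots> = (1 + 1 / N) * (x\<^sup>2 / (2 * h)) + (1 + N) / 2"
    using \<sigma> h by (simp add: add_divide_distrib)
  also have "x\<^sup>2 / (2 * h) = \<mu>\<^sup>2 * ln (ln (q ^ k)) / m"
    using q m by (simp add: x_def h_def power_mult_distrib power_divide lil_norm_sq[OF e1]) (simp add: power2_eq_square)
  finally have "- ((1 + 1 / N) * (\<mu>\<^sup>2 * ln (ln (q ^ k)) / m)) + - ((1 + N) / 2) \<le> - ((x + \<sigma>)\<^sup>2 / (2 * \<sigma>\<^sup>2))" by linarith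
  then have "exp (- ((1 + 1 / N) * (\<mu>\<^sup>2 * ln (ln (q ^ k)) / m))) * exp (- ((1 + N) / 2)) \<le> exp (- ((x + \<sigma>)\<^sup>2 / (2 * \<sigma>\<^sup>2)))"
    by (simp only: mult_exp_exp exp_le_cancel_iff)
  then have "exp (- ((1 + 1 / N) * (\<mu>\<^sup>2 * ln (ln (q ^ k)) / m))) * exp (- ((1 + N) / 2)) / sqrt (2 * pi)
      \<le> exp (- ((x + \<sigma>)\<^sup>2 / (2 * \<sigma>\<^sup>2))) / sqrt (2 * pi)"
    by (rule divide_right_mono) simp
  also have "\<dots> \<le> prob {\<omega>\<in>space M. x \<le> c * grid_inc (path \<omega>) h j i \<and> c * grid_inc (path \<omega>) h j i \<le> x + \<sigma>}"
    unfolding \<sigma>_def using h x c by (intro normal_interval_lower grid_inc_normal) auto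
  also have "\<dots> \<le> prob ((\<lambda>\<omega>. grid_inc (path \<omega>) h j i) -` S \<inter> space M)"
    using S h sub by (intro finite_measure_mono measurable_sets[OF grid_inc_measurable]) (auto simp: x_def \<sigma>_def h_def)
  finally show ?thesis by (simp add: h_def mult.assoc)
qed

text \<open>The blocks for successive \<open>k\<close> follow one another in time without gap or overlap, so all their cells form a
single increasing sequence of times \<open>s\<close>: the cell with number \<open>n = k b + r\<close>, \<open>r < b\<close>, is cell \<open>d + r\<close> of block \<open>k\<close>. The probability
of the event in block \<open>k\<close> is at least a constant times \<open>exp (- ln (ln (q ^ k))) = 1 / (k ln q)\<close>, by \<open>drive_energy\<close>.\<close>

lemma AE_drive_event:
  assumes N: "N \<ge> 40" and d: "d > 0"
  shows "AE \<omega> in M. \<exists>\<^sub>F k in sequentially. drive_event (path \<omega>) N d k"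
proof -
  define q where "q = real N^2"
  have NN: "40 * 40 \<le> real N * real N" using N by (intro mult_mono) auto
  then have q: "q > 1" by (simp add: q_def power2_eq_square)
  have N0: "real N > 0" using N by simp
  define m where "m = N^2 * d"
  have m: "m > 0" using N d by (simp add: m_def)
  have mq: "real m = q * d" by (simp add: m_def q_def)
  have dm: "d < m"
  proof -
    have "1 < N^2" using q unfolding q_def by (metis of_nat_1 of_nat_less_iff of_nat_power)
    then show ?thesis using d by (simp add: m_def)
  qed
  define b where "b = m - d"
  have b: "b > 0" "d + b = m" using dm by (auto simp: b_def)
  define s where "s n = q ^ (n div b) * (real (d + n mod b) / m)" for n
  have s_Suc: "s (Suc n) = q ^ (n div b) * (real (Suc (d + n mod b)) / m)" for n
  proof (cases "Suc (n mod b) = b")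
    case True
    then have "Suc n mod b = 0" "Suc n div b = Suc (n div b)" using b by (auto simp: mod_Suc div_Suc)
    moreover have "real (Suc (d + n mod b)) = m" using True b by linarith
    ultimately show ?thesis using m mq d q by (simp add: s_def)
  next
    case False
    then have "Suc n mod b = Suc (n mod b)" "Suc n div b = n div b" using b by (auto simp: mod_Suc div_Suc)
    then show ?thesis by (simp add: s_def)
  qed
  define X where "X j \<omega> = W (fst j) (s (Suc (snd j))) \<omega> - W (fst j) (s (snd j)) \<omega>" for j \<omega>
  have X_eq: "X (j, n) = (\<lambda>\<omega>. grid_inc (path \<omega>) (q ^ (n div b) / m) j (d + n mod b))" for j n
    unfolding X_def grid_inc_def s_Suc fst_conv snd_conv by (simp add: s_def mult.commute)
  have ind: "indep_vars (\<lambda>_. borel) X UNIV"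
    unfolding X_def
  proof (rule indep_increments_two_brownian[OF bm indep_W])
    show "0 \<le> s 0" using q by (simp add: s_def)
    show "s i \<le> s (Suc i)" for i unfolding s_Suc unfolding s_def using q m by (intro mult_left_mono divide_right_mono) auto
  qed
  define \<alpha> where "\<alpha> k = lil_norm (q ^ k) / m" for k
  define S where "S j = (case j of (j, n) \<Rightarrow>
     if j then (if d + n mod b < m - N * d then {\<alpha> (n div b) / (4 * N)..\<alpha> (n div b) / (2 * N)} else {..- 4 * \<alpha> (n div b)})
     else {(1 - 20 / N) * \<alpha> (n div b)..})" for j
  have S_sets: "S j \<in> sets borel" for j by (cases j) (auto simp: S_def)
  define K where "K k = (UNIV :: bool set) \<times> {k * b..<k * b + b}" for k
  have div_mod: "n div b = k" "n mod b = n - k * b" if "n \<in> {k * b..<k * b + b}" for n k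
  proof -
    show 1: "n div b = k" using that by (intro div_nat_eqI) (auto simp: mult.commute)
    show "n mod b = n - k * b" unfolding minus_div_mult_eq_mod[symmetric] 1 ..
  qed
  have Kdisj: "disjoint_family K"
    unfolding disjoint_family_on_def K_def by (auto dest!: div_mod(1))
  have "AE \<omega> in M. \<exists>\<^sub>F k in sequentially. \<forall>j\<in>K k. X j \<omega> \<in> S j"
  proof (rule AE_frequently_all_in_block[OF ind Kdisj _ _ S_sets])
    show "finite (K k)" "K k \<noteq> {}" for k using b by (auto simp: K_def)
    show "\<not> summable (\<lambda>k. \<Prod>j\<in>K k. prob (X j -` S j \<inter> space M))" (is "\<not> summable ?p")
    proof
      assume sm: "summable ?p"
      define c where "c = exp (- ((1 + real N) / 2)) / sqrt (2 * pi)"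
      have c: "c > 0" by (simp add: c_def)
      have ev1: "\<forall>\<^sub>F k in sequentially. exp 1 \<le> q ^ k" by (rule eventually_le_power[OF q])
      have "\<forall>\<^sub>F x::real in at_top. ln (ln x) \<ge> 8 * real N^2 * m" using ln_ln_at_top by (simp add: filterlim_at_top)
      then have ev2: "\<forall>\<^sub>F k in sequentially. ln (ln (q ^ k)) \<ge> 8 * real N^2 * m" by (rule eventually_power[OF q])
      have "\<forall>\<^sub>F k in sequentially. norm (1 / real k) \<le> ?p k * (ln q / c ^ (2 * b))"
        using ev1 ev2 eventually_gt_at_top[of 0]
      proof eventually_elim
        case (elim k)
        define L where "L = ln (ln (q ^ k))"
        define \<nu> where "\<nu> n = (if d + (n - k * b) < m - N * d then (1 / (4 * real N))\<^sup>2 else 4\<^sup>2)" for n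
        have a0: "\<alpha> k \<ge> 0" using lil_norm_nonneg[OF elim(1)] by (simp add: \<alpha>_def)
        have L0: "L \<ge> 0" using elim(2) unfolding L_def by (rule order_trans[rotated]) simp
        \<comment> \<open>An interval of one standard deviation fits into the window prescribed for creeping.\<close>
        have \<sigma>: "sqrt (q ^ k / m) \<le> \<alpha> k / (4 * N)"
        proof (rule real_le_lsqrt)
          show "0 \<le> \<alpha> k / (4 * N)" using a0 by simp
          have "8 * real N^2 * m * (q ^ k / (8 * real N^2 * m^2)) \<le> L * (q ^ k / (8 * real N^2 * m^2))"
            using elim(2) q by (intro mult_right_mono) (auto simp: L_def)
          also have "8 * real N^2 * m * (q ^ k / (8 * real N^2 * m^2)) = q ^ k / m"
            using N0 m by (simp add: power2_eq_square)
          also have "L * (q ^ k / (8 * real N^2 * m^2)) = (\<alpha> k / (4 * N))\<^sup>2"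
            by (simp add: \<alpha>_def L_def power_divide power_mult_distrib lil_norm_sq[OF elim(1)] ac_simps)
          finally show "q ^ k / m \<le> (\<alpha> k / (4 * N))\<^sup>2" .
        qed
        have F: "exp (- ((1 + 1 / real N) * (1 - 20 / N)\<^sup>2 * L / m)) * c \<le> prob (X (False, n) -` S (False, n) \<inter> space M)"
          if n: "n \<in> {k * b..<k * b + b}" for n
          unfolding X_eq div_mod[OF n] L_def c_def
          using q elim(1) N m
          by (intro grid_cell_lower[where c = 1]) (auto simp: S_sets S_def div_mod[OF n] \<alpha>_def field_simps)
        have R: "exp (- ((1 + 1 / real N) * \<nu> n * L / m)) * c \<le> prob (X (True, n) -` S (True, n) \<inter> space M)"
          if n: "n \<in> {k * b..<k * b + b}" for n
        proof (cases "d + (n - k * b) < m - N * d")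
          case True
          then have S: "S (True, n) = {\<alpha> k / (4 * N)..\<alpha> k / (2 * N)}" by (simp add: S_def div_mod[OF n])
          have \<nu>: "\<nu> n = (1 / (4 * real N))\<^sup>2" using True by (simp add: \<nu>_def)
          have "\<alpha> k / (4 * N) + sqrt (q ^ k / m) \<le> \<alpha> k / (2 * N)" using \<sigma> by simp
          then show ?thesis
            unfolding X_eq div_mod[OF n] L_def c_def S \<nu>
            using q elim(1) N m
            by (intro grid_cell_lower[where c = 1]) (auto simp: \<alpha>_def mult.commute)
        next
          case False
          then have S: "S (True, n) = {..- 4 * \<alpha> k}" by (simp add: S_def div_mod[OF n])
          have \<nu>: "\<nu> n = 4\<^sup>2" using False by (simp add: \<nu>_def)
          show ?thesis
            unfolding X_eq div_mod[OF n] L_def c_def S \<nu>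
            using q elim(1) N m
            by (intro grid_cell_lower[where c = "-1"]) (auto simp: \<alpha>_def)
        qed
        have sum_\<nu>: "(\<Sum>n\<in>{k * b..<k * b + b}. (1 - 20 / N)\<^sup>2 + \<nu> n) \<le> m * ((1 - 20 / N)\<^sup>2 + (1 / (4 * real N))\<^sup>2 + 16 / N)"
        proof -
          have "(\<Sum>n\<in>{k * b..<k * b + b}. (1 - 20 / N)\<^sup>2 + \<nu> n) = (\<Sum>i\<in>{d..<m}. (1 - 20 / N)\<^sup>2 + (if i < m - N * d then (1 / (4 * real N))\<^sup>2 else 4\<^sup>2))"
            unfolding \<nu>_def using b
            by (intro sum.reindex_bij_witness[of _ "\<lambda>i. i - d + k * b" "\<lambda>n. d + (n - k * b)"]) auto
          also have "\<dots> \<le> (\<Sum>i\<in>{d..<m}. ((1 - 20 / N)\<^sup>2 + (1 / (4 * real N))\<^sup>2) + (if i \<in> {m - N * d..<m} then 16 else 0))"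
            by (intro sum_mono) auto
          also have "\<dots> = real (m - d) * ((1 - 20 / N)\<^sup>2 + (1 / (4 * real N))\<^sup>2) + (\<Sum>i\<in>{d..<m}. if i \<in> {m - N * d..<m} then 16 else 0)"
            by (simp add: sum.distrib)
          also have "(\<Sum>i\<in>{d..<m}. if i \<in> {m - N * d..<m} then 16 else 0) = (\<Sum>i\<in>{d..<m} \<inter> {m - N * d..<m}. 16 :: real)"
            by (rule sum.inter_restrict[symmetric]) simp
          also have "\<dots> \<le> (\<Sum>i\<in>{m - N * d..<m}. 16)" by (intro sum_mono2) auto
          also have "\<dots> = 16 * real (N * d)"
          proof -
            have "m - (m - N * d) = N * d" using drive_index(1)[OF N d] by (simp add: m_def)
            then show ?thesis by (simp del: of_nat_diff of_nat_mult)
          qed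
          also have "16 * real (N * d) = m * (16 / N)" using N0 by (simp add: m_def power2_eq_square)
          also have "real (m - d) * ((1 - 20 / N)\<^sup>2 + (1 / (4 * real N))\<^sup>2) \<le> m * ((1 - 20 / N)\<^sup>2 + (1 / (4 * real N))\<^sup>2)"
            by (intro mult_right_mono) auto
          finally show ?thesis by (simp add: algebra_simps)
        qed
        have "exp (- L) * c ^ (2 * b) \<le> exp (- ((1 + 1 / real N) * L / m * (\<Sum>n\<in>{k * b..<k * b + b}. (1 - 20 / N)\<^sup>2 + \<nu> n))) * c ^ (2 * b)"
        proof -
          have "(1 + 1 / real N) * L / m * (\<Sum>n\<in>{k * b..<k * b + b}. (1 - 20 / N)\<^sup>2 + \<nu> n)
             \<le> (1 + 1 / real N) * L / m * (m * ((1 - 20 / N)\<^sup>2 + (1 / (4 * real N))\<^sup>2 + 16 / N))"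
            using L0 by (intro mult_left_mono sum_\<nu>) auto
          also have "\<dots> = L * ((1 + 1 / real N) * ((1 - 20 * (1 / N))\<^sup>2 + (1 / real N)\<^sup>2 / 16 + 16 * (1 / N)))"
            using m by (simp add: power_divide power_mult_distrib)
          also have "\<dots> \<le> L * 1"
            using N L0 by (intro mult_left_mono drive_energy) (auto simp: field_simps)
          finally show ?thesis using c by (intro mult_right_mono) auto
        qed
        also have "\<dots> = (\<Prod>n\<in>{k * b..<k * b + b}. exp (- ((1 + 1 / real N) * L / m * ((1 - 20 / N)\<^sup>2 + \<nu> n))) * c\<^sup>2)"
          by (simp add: prod.distrib exp_sum[symmetric] sum_negf sum_distrib_left power_mult)
        also have "\<dots> \<le> (\<Prod>n\<in>{k * b..<k * b + b}. prob (X (False, n) -` S (False, n) \<inter> space M) * prob (X (True, n) -` S (True, n) \<inter> space M))"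
        proof (intro prod_mono conjI)
          fix n assume n: "n \<in> {k * b..<k * b + b}"
          have "exp (- ((1 + 1 / real N) * L / m * ((1 - 20 / N)\<^sup>2 + \<nu> n))) * c\<^sup>2
            = (exp (- ((1 + 1 / real N) * (1 - 20 / N)\<^sup>2 * L / m)) * c) * (exp (- ((1 + 1 / real N) * \<nu> n * L / m)) * c)"
          proof -
            have "- ((1 + 1 / real N) * L / m * ((1 - 20 / N)\<^sup>2 + \<nu> n))
               = - ((1 + 1 / real N) * (1 - 20 / N)\<^sup>2 * L / m) + - ((1 + 1 / real N) * \<nu> n * L / m)"
              using m by (simp add: field_simps)
            then show ?thesis by (simp only: exp_add) (simp add: power2_eq_square)
          qed
          also have "\<dots> \<le> prob (X (False, n) -` S (False, n) \<inter> space M) * prob (X (True, n) -` S (True, n) \<inter> space M)"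
            using c by (intro mult_mono F[OF n] R[OF n]) auto
          finally show "exp (- ((1 + 1 / real N) * L / m * ((1 - 20 / N)\<^sup>2 + \<nu> n))) * c\<^sup>2
            \<le> prob (X (False, n) -` S (False, n) \<inter> space M) * prob (X (True, n) -` S (True, n) \<inter> space M)" .
        qed simp
        also have "\<dots> = ?p k"
        proof -
          have "?p k = (\<Prod>j\<in>(UNIV::bool set). \<Prod>n\<in>{k * b..<k * b + b}. prob (X (j, n) -` S (j, n) \<inter> space M))"
            unfolding K_def by (subst prod.cartesian_product) (simp add: case_prod_unfold)
          then show ?thesis by (simp add: UNIV_bool prod.distrib)
        qed
        finally have main: "exp (- L) * c ^ (2 * b) \<le> ?p k" .
        have "exp (- L) = 1 / (k * ln q)"
          using exp_ln_ln_power[OF q elim(3), of 1] q elim(3) by (simp add: L_def powr_minus inverse_eq_divide)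
        moreover have "ln q > 0" using q by simp
        ultimately have "norm (1 / real k) = (exp (- L) * c ^ (2 * b)) * (ln q / c ^ (2 * b))"
          using c elim(3) by simp
        also have "\<dots> \<le> ?p k * (ln q / c ^ (2 * b))"
          using c \<open>ln q > 0\<close> by (intro mult_right_mono main) auto
        finally show ?case .
      qed
      then have "summable (\<lambda>k. 1 / real k)"
        by (rule summable_comparison_test_ev[OF _ summable_mult2[OF sm]])
      then show False using not_summable_harmonic[where 'a = real] by (simp add: inverse_eq_divide)
    qed
  qed
  then show ?thesis
  proof (rule AE_mp, intro AE_I2 impI)
    fix \<omega> assume "\<exists>\<^sub>F k in sequentially. \<forall>j\<in>K k. X j \<omega> \<in> S j"
    then show "\<exists>\<^sub>F k in sequentially. drive_event (path \<omega>) N d k"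
    proof (rule frequently_elim1)
      fix k assume H: "\<forall>j\<in>K k. X j \<omega> \<in> S j"
      have cell: "grid_inc (path \<omega>) (q ^ k / m) j i \<in> S (j, k * b + (i - d))" "(k * b + (i - d)) div b = k"
          "d + (k * b + (i - d)) mod b = i" if i: "i \<in> {d..<m}" for j i
      proof -
        have n: "k * b + (i - d) \<in> {k * b..<k * b + b}" using i b by auto
        show 1: "(k * b + (i - d)) div b = k" using div_mod(1)[OF n] .
        show 2: "d + (k * b + (i - d)) mod b = i"
        proof -
          have "i - d < b" using i b by auto
          then show ?thesis unfolding mod_mult_self3 using i by simp
        qed
        have "X (j, k * b + (i - d)) \<omega> \<in> S (j, k * b + (i - d))" using H n unfolding K_def by blast
        then show "grid_inc (path \<omega>) (q ^ k / m) j i \<in> S (j, k * b + (i - d))"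
          unfolding X_eq 1 2 .
      qed
      show "drive_event (path \<omega>) N d k"
        unfolding drive_event_def Let_def m_def[symmetric] q_def[symmetric]
      proof (intro ballI conjI)
        fix i assume i: "i \<in> {d..<m}"
        show "(1 - 20 / N) * (lil_norm (q ^ k) / m) \<le> grid_inc (path \<omega>) (q ^ k / m) False i"
          using cell(1)[OF i, of False] unfolding S_def prod.case cell(2)[OF i] by (simp add: \<alpha>_def)
        show "if i < m - N * d
          then lil_norm (q ^ k) / m / (4 * real N) \<le> grid_inc (path \<omega>) (q ^ k / m) True i \<and>
               grid_inc (path \<omega>) (q ^ k / m) True i \<le> lil_norm (q ^ k) / m / (2 * real N)
          else grid_inc (path \<omega>) (q ^ k / m) True i \<le> - 4 * (lil_norm (q ^ k) / m)"
          using cell(1)[OF i, of True] unfolding S_def prod.case cell(2)[OF i] cell(3)[OF i] by (auto simp: \<alpha>_def split: if_splits)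
      qed
    qed
  qed
qed

end

section \<open>Brownian paths have no common record time\<close>

text \<open>In the plane \<open>ln (x\<^sup>2 + y\<^sup>2)\<close> is harmonic, and adding \<open>c > 0\<close> makes it subharmonic and bounded below. The quadratic part makes \<open>psi\<close>
nonnegative. The linear part pays for the reflection at the axes: a reflection by \<open>m\<close> raises the coordinate by \<open>m\<close>
and changes the logarithm by at most \<open>m\<^sup>2 / c\<close>, which is no more than \<open>m\<close> for small \<open>m\<close>.\<close>

definition psi :: "real \<Rightarrow> real \<Rightarrow> real \<Rightarrow> real" where
  "psi c x y = 2 * (x\<^sup>2 + y\<^sup>2) + 2 - ln (x\<^sup>2 + y\<^sup>2 + c) - (x + y)"

lemma psi_measurable [measurable]:
  assumes [measurable]: "f \<in> borel_measurable M" "g \<in> borel_measurable M"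
  shows "(\<lambda>x. psi c (f x) (g x)) \<in> borel_measurable M"
  unfolding psi_def by measurable

lemma ln_ge_one_minus_inverse: "x > 0 \<Longrightarrow> 1 - 1 / x \<le> ln (x::real)"
  using ln_le_minus_one[of "1 / x"] by (simp add: ln_div)

lemma psi_nonneg: "0 < c \<Longrightarrow> c \<le> 1 \<Longrightarrow> 0 \<le> psi c x y"
proof -
  assume c: "0 < c" "c \<le> 1"
  have "x\<^sup>2 + y\<^sup>2 + c > 0" using c by (simp add: add_nonneg_pos)
  then have "ln (x\<^sup>2 + y\<^sup>2 + c) \<le> x\<^sup>2 + y\<^sup>2 + c - 1" by (rule ln_le_minus_one)
  moreover have "0 \<le> (x - 1/2)\<^sup>2 + (y - 1/2)\<^sup>2" by simp
  ultimately show ?thesis using c unfolding psi_def by (simp add: power2_eq_square algebra_simps)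
qed

text \<open>The argument of the logarithm on the right is \<open>s ^ 4\<close> up to terms that help as long as \<open>r \<le> 2 c\<close>. For larger \<open>r\<close> the
error term exceeds \<open>2 r / c \<ge> 4\<close>, and crude bounds suffice, by a constant if \<open>s \<ge> 2 r\<close> and by \<open>c / r\<close> otherwise.\<close>

lemma ln_mean_lower:
  fixes s r c :: real
  assumes c: "0 < c" "c \<le> s" and r: "0 \<le> r"
  shows "4 * ln s - r\<^sup>2 / c\<^sup>2 \<le> ln ((s + r)\<^sup>2 * ((s - r)\<^sup>2 + 4 * c * r))"
proof -
  define P where "P = (s + r)\<^sup>2 * ((s - r)\<^sup>2 + 4 * c * r)"
  have s: "s > 0" using c by simp
  have P1: "P = (s\<^sup>2 - r\<^sup>2)\<^sup>2 + 4 * c * r * (s + r)\<^sup>2"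
    by (simp add: P_def power2_eq_square algebra_simps)
  have ln4: "4 * ln s = ln (s ^ 4)" using s by (simp add: ln_realpow)
  have "4 * ln s - r\<^sup>2 / c\<^sup>2 \<le> ln P"
  proof (cases "r \<le> 2 * c")
    case True
    have "P = s ^ 4 + 2 * s\<^sup>2 * r * (2 * c - r) + r ^ 4 + 8 * c * s * r\<^sup>2 + 4 * c * r ^ 3"
      unfolding P1 by (simp add: power2_eq_square power3_eq_cube eval_nat_numeral algebra_simps)
    moreover have "0 \<le> 2 * s\<^sup>2 * r * (2 * c - r)" "0 \<le> 8 * c * s * r\<^sup>2" "0 \<le> 4 * c * r ^ 3" "0 \<le> r ^ 4"
      using True r c s by auto
    ultimately have "s ^ 4 \<le> P" by linarith
    then have "4 * ln s \<le> ln P" unfolding ln4 using s by (intro ln_mono) auto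
    moreover have "0 \<le> r\<^sup>2 / c\<^sup>2" by simp
    ultimately show ?thesis by linarith
  next
    case False
    then have rc: "r > 2 * c" "r > 0" using c by auto
    have rc1: "r / c \<ge> 2" using rc c by (simp add: field_simps)
    have rc2: "r\<^sup>2 / c\<^sup>2 \<ge> 2 * (r / c)"
      using mult_right_mono[OF rc1, of "r / c"] rc1 by (simp add: power2_eq_square)
    show ?thesis
    proof (cases "s \<ge> 2 * r")
      case True
      have "(2 * r)\<^sup>2 \<le> s\<^sup>2" using True r by (intro power_mono) auto
      then have "(3/4) * s\<^sup>2 \<le> s\<^sup>2 - r\<^sup>2" by (simp add: power_mult_distrib)
      then have "((3/4) * s\<^sup>2)\<^sup>2 \<le> (s\<^sup>2 - r\<^sup>2)\<^sup>2" by (intro power_mono) auto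
      moreover have "0 \<le> 4 * c * r * (s + r)\<^sup>2" using c r by simp
      ultimately have "((3/4) * s\<^sup>2)\<^sup>2 \<le> P" unfolding P1 by linarith
      then have "9/16 * s ^ 4 \<le> P" by (simp add: power_mult_distrib power2_eq_square eval_nat_numeral)
      then have "ln (9/16 * s ^ 4) \<le> ln P" using s by (intro ln_mono) auto
      moreover have "ln (9/16 * s ^ 4) = ln (9/16) + ln (s ^ 4)" using s by (intro ln_mult_pos) auto
      moreover have "ln (9/16::real) \<ge> 1 - 1 / (9/16)" by (rule ln_ge_one_minus_inverse) simp
      ultimately show ?thesis unfolding ln4 using rc1 rc2 by simp
    next
      case False
      have "s\<^sup>2 \<le> (2 * r)\<^sup>2" using False s by (intro power_mono) auto
      then have "s\<^sup>2 * s\<^sup>2 \<le> 4 * r\<^sup>2 * s\<^sup>2" by (intro mult_right_mono) (auto simp: power_mult_distrib)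
      then have "c / r * (s\<^sup>2 * s\<^sup>2) \<le> c / r * (4 * r\<^sup>2 * s\<^sup>2)" using c rc by (intro mult_left_mono) auto
      also have "\<dots> = 4 * c * r * s\<^sup>2" using rc by (simp add: power2_eq_square)
      also have "\<dots> \<le> 4 * c * r * (s + r)\<^sup>2" using c r s by (intro mult_left_mono power_mono) auto
      also have "\<dots> \<le> P" unfolding P1 by simp
      finally have "c / r * s ^ 4 \<le> P" by (simp add: power2_eq_square eval_nat_numeral)
      then have "ln (c / r * s ^ 4) \<le> ln P" using s c rc by (intro ln_mono) auto
      moreover have "ln (c / r * s ^ 4) = ln (c / r) + ln (s ^ 4)" using s c rc by (intro ln_mult_pos) auto
      moreover have "ln (c / r) \<ge> 1 - 1 / (c / r)" using c rc by (intro ln_ge_one_minus_inverse) auto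
      ultimately show ?thesis unfolding ln4 using rc1 rc2 by simp
    qed
  qed
  then show ?thesis by (simp add: P_def)
qed

text \<open>An approximate mean value inequality over the four rotations of \<open>(u, v)\<close> by right angles. The product of
the four arguments is \<open>(P\<^sup>2 - 4 \<alpha>\<^sup>2) (P\<^sup>2 - 4 \<beta>\<^sup>2)\<close> with \<open>P = s + r\<close>, where \<open>\<alpha>\<^sup>2 + \<beta>\<^sup>2 = (s - c) r\<close> does not depend on the direction.\<close>

lemma ln_four_rotations:
  fixes x y u v c :: real
  assumes c: "0 < c"
  shows "4 * ln (x\<^sup>2 + y\<^sup>2 + c) - (u\<^sup>2 + v\<^sup>2)\<^sup>2 / c\<^sup>2 \<le>
    ln ((x + u)\<^sup>2 + (y + v)\<^sup>2 + c) + ln ((x - v)\<^sup>2 + (y + u)\<^sup>2 + c)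
    + ln ((x - u)\<^sup>2 + (y - v)\<^sup>2 + c) + ln ((x + v)\<^sup>2 + (y - u)\<^sup>2 + c)"
proof -
  define s r where "s = x\<^sup>2 + y\<^sup>2 + c" and "r = u\<^sup>2 + v\<^sup>2"
  define \<alpha> \<beta> where "\<alpha> = x * u + y * v" and "\<beta> = y * u - x * v"
  have pos: "z\<^sup>2 + z'\<^sup>2 + c > 0" for z z' using c by (simp add: add_nonneg_pos)
  have f: "(x + u)\<^sup>2 + (y + v)\<^sup>2 + c = (s + r) + 2 * \<alpha>" "(x - v)\<^sup>2 + (y + u)\<^sup>2 + c = (s + r) + 2 * \<beta>"
    "(x - u)\<^sup>2 + (y - v)\<^sup>2 + c = (s + r) - 2 * \<alpha>" "(x + v)\<^sup>2 + (y - u)\<^sup>2 + c = (s + r) - 2 * \<beta>"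
    by (auto simp: s_def r_def \<alpha>_def \<beta>_def power2_eq_square algebra_simps)
  have p: "(s + r) + 2 * \<alpha> > 0" "(s + r) + 2 * \<beta> > 0" "(s + r) - 2 * \<alpha> > 0" "(s + r) - 2 * \<beta> > 0"
    unfolding f[symmetric] by (rule pos)+
  have ab: "\<alpha>\<^sup>2 + \<beta>\<^sup>2 = (s - c) * r"
    by (simp add: s_def r_def \<alpha>_def \<beta>_def power2_eq_square algebra_simps)
  have sc: "c \<le> s" "0 \<le> r" by (auto simp: s_def r_def)
  have lower_pos: "(s + r)\<^sup>2 * ((s - r)\<^sup>2 + 4 * c * r) > 0"
  proof -
    have "s + r > 0" using c sc by simp
    moreover have "(s - r)\<^sup>2 + 4 * c * r > 0"
    proof (cases "r = 0")
      case True then show ?thesis using c sc by simp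
    next
      case False then show ?thesis using c sc by (intro add_nonneg_pos) auto
    qed
    ultimately show ?thesis by simp
  qed
  have "(s + r)\<^sup>2 * ((s - r)\<^sup>2 + 4 * c * r) = (s + r)\<^sup>2 * ((s + r)\<^sup>2 - 4 * (\<alpha>\<^sup>2 + \<beta>\<^sup>2))"
    unfolding ab by (simp add: power2_eq_square algebra_simps)
  also have "\<dots> \<le> (s + r)\<^sup>2 * ((s + r)\<^sup>2 - 4 * (\<alpha>\<^sup>2 + \<beta>\<^sup>2)) + 16 * (\<alpha> * \<beta>)\<^sup>2" by simp
  also have "\<dots> = ((s + r) + 2 * \<alpha>) * ((s + r) + 2 * \<beta>) * ((s + r) - 2 * \<alpha>) * ((s + r) - 2 * \<beta>)"
    by (simp add: power2_eq_square algebra_simps)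
  finally have "ln ((s + r)\<^sup>2 * ((s - r)\<^sup>2 + 4 * c * r)) \<le>
      ln (((s + r) + 2 * \<alpha>) * ((s + r) + 2 * \<beta>) * ((s + r) - 2 * \<alpha>) * ((s + r) - 2 * \<beta>))"
    using lower_pos by (intro ln_mono) auto
  also have "\<dots> = ln ((s + r) + 2 * \<alpha>) + ln ((s + r) + 2 * \<beta>) + ln ((s + r) - 2 * \<alpha>) + ln ((s + r) - 2 * \<beta>)"
    using p by (simp add: ln_mult_pos)
  finally show ?thesis
    unfolding f using ln_mean_lower[OF c sc] by (simp add: s_def[symmetric] r_def[symmetric])
qed

text \<open>A reflection by \<open>m > c\<close> needs an increment larger than \<open>c\<close>, so its cost \<open>m\<^sup>2 / c\<close> is at most \<open>u ^ 4 / c ^ 3\<close>.\<close>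

lemma psi_reflect:
  assumes c: "0 < c" and ab: "0 \<le> a" "0 \<le> b"
  shows "psi c (max (a + u) 0) (max (b + v) 0) \<le> psi c (a + u) (b + v) + (u ^ 4 + v ^ 4) / c ^ 3"
proof -
  have excess: "m\<^sup>2 / c - m \<le> u ^ 4 / c ^ 3" if "m = max (a + u) 0 - (a + u)" "0 \<le> a" for m a u
  proof (cases "m \<le> c")
    case True
    have "0 \<le> m" using that by auto
    then have "m * m \<le> c * m" using True by (intro mult_right_mono) auto
    then have "m\<^sup>2 / c - m \<le> 0" using c by (simp add: field_simps power2_eq_square)
    moreover have "0 \<le> u ^ 4 / c ^ 3" using c by simp
    ultimately show ?thesis by linarith
  next
    case False
    then have m: "c < m" "m \<le> - u" using that c by (auto simp: max_def split: if_splits)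
    then have mu: "m\<^sup>2 \<le> u\<^sup>2" using c by (subst power2_minus[symmetric], intro power_mono) auto
    have "c\<^sup>2 \<le> m\<^sup>2" using m c by (intro power_mono) auto
    with mu have "c\<^sup>2 \<le> u\<^sup>2" by linarith
    then have "m\<^sup>2 * c\<^sup>2 \<le> u\<^sup>2 * u\<^sup>2" using mu by (intro mult_mono) auto
    then have "m\<^sup>2 / c \<le> u ^ 4 / c ^ 3" using c
      by (simp add: field_simps power2_eq_square power3_eq_cube eval_nat_numeral)
    then show ?thesis using m c by linarith
  qed
  define m where "m = max (a + u) 0 - (a + u)"
  define n where "n = max (b + v) 0 - (b + v)"
  have sq: "(max (a + u) 0)\<^sup>2 = (a + u)\<^sup>2 - m\<^sup>2" "(max (b + v) 0)\<^sup>2 = (b + v)\<^sup>2 - n\<^sup>2"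
    by (auto simp: m_def n_def max_def power2_eq_square algebra_simps)
  define z where "z = (max (a + u) 0)\<^sup>2 + (max (b + v) 0)\<^sup>2 + c"
  have z: "z \<ge> c" by (simp add: z_def)
  have z': "(a + u)\<^sup>2 + (b + v)\<^sup>2 + c = z + (m\<^sup>2 + n\<^sup>2)" by (simp add: z_def sq)
  have "ln (z + (m\<^sup>2 + n\<^sup>2)) \<le> ln z + (m\<^sup>2 + n\<^sup>2) / c"
  proof -
    have "z + (m\<^sup>2 + n\<^sup>2) = z * (1 + (m\<^sup>2 + n\<^sup>2) / z)" using z c by (simp add: field_simps)
    moreover have "1 + (m\<^sup>2 + n\<^sup>2) / z > 0" using z c by (intro add_pos_nonneg) auto
    ultimately have "ln (z + (m\<^sup>2 + n\<^sup>2)) = ln z + ln (1 + (m\<^sup>2 + n\<^sup>2) / z)"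
      using z c by (simp add: ln_mult_pos)
    also have "ln (1 + (m\<^sup>2 + n\<^sup>2) / z) \<le> (m\<^sup>2 + n\<^sup>2) / z"
      using z c by (intro ln_add_one_self_le_self) auto
    also have "\<dots> \<le> (m\<^sup>2 + n\<^sup>2) / c" using z c by (intro divide_left_mono) auto
    finally show ?thesis by simp
  qed
  moreover have "psi c (max (a + u) 0) (max (b + v) 0) = 2 * ((a + u)\<^sup>2 + (b + v)\<^sup>2) - 2 * (m\<^sup>2 + n\<^sup>2) + 2 - ln z - ((a + u) + (b + v)) - (m + n)"
    unfolding psi_def z_def[symmetric] unfolding sq by (simp add: m_def n_def)
  moreover have "psi c (a + u) (b + v) = 2 * ((a + u)\<^sup>2 + (b + v)\<^sup>2) + 2 - ln (z + (m\<^sup>2 + n\<^sup>2)) - ((a + u) + (b + v))"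
    unfolding psi_def z' ..
  moreover have "m\<^sup>2 / c - m \<le> u ^ 4 / c ^ 3" "n\<^sup>2 / c - n \<le> v ^ 4 / c ^ 3"
    by (rule excess[OF m_def ab(1)], rule excess[OF n_def ab(2)])
  moreover have "0 \<le> m\<^sup>2" "0 \<le> n\<^sup>2" by auto
  moreover have "(m\<^sup>2 + n\<^sup>2) / c = m\<^sup>2 / c + n\<^sup>2 / c" "(u ^ 4 + v ^ 4) / c ^ 3 = u ^ 4 / c ^ 3 + v ^ 4 / c ^ 3"
    by (rule add_divide_distrib)+
  ultimately show ?thesis by (smt (verit))
qed

text \<open>In the sum over the four rotations the linear terms cancel. This inequality involves no integrability
of the logarithm: after symmetrization only second and fourth moments remain.\<close>

lemma psi_four_rotations:
  assumes c: "0 < c" "c \<le> 1" and ab: "0 \<le> a" "0 \<le> b"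
  shows "psi c (max (a + u) 0) (max (b + v) 0) + psi c (max (a - v) 0) (max (b + u) 0)
       + psi c (max (a - u) 0) (max (b - v) 0) + psi c (max (a + v) 0) (max (b - u) 0)
       \<le> 4 * psi c a b + (8 * u\<^sup>2 + 6 * u ^ 4 / c ^ 3) + (8 * v\<^sup>2 + 6 * v ^ 4 / c ^ 3)"
proof -
  have 1: "psi c (max (a + u) 0) (max (b + v) 0) \<le> psi c (a + u) (b + v) + (u ^ 4 + v ^ 4) / c ^ 3"
    "psi c (max (a - v) 0) (max (b + u) 0) \<le> psi c (a - v) (b + u) + (u ^ 4 + v ^ 4) / c ^ 3"
    "psi c (max (a - u) 0) (max (b - v) 0) \<le> psi c (a - u) (b - v) + (u ^ 4 + v ^ 4) / c ^ 3"
    "psi c (max (a + v) 0) (max (b - u) 0) \<le> psi c (a + v) (b - u) + (u ^ 4 + v ^ 4) / c ^ 3"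
    using psi_reflect[OF c(1) ab, of u v] psi_reflect[OF c(1) ab, of "-v" u]
      psi_reflect[OF c(1) ab, of "-u" "-v"] psi_reflect[OF c(1) ab, of v "-u"] by (simp_all add: add.commute)
  have 2: "psi c (a + u) (b + v) + psi c (a - v) (b + u) + psi c (a - u) (b - v) + psi c (a + v) (b - u)
      \<le> 4 * psi c a b + 8 * (u\<^sup>2 + v\<^sup>2) + (u\<^sup>2 + v\<^sup>2)\<^sup>2 / c\<^sup>2"
  proof -
    have "2 * ((a + u)\<^sup>2 + (b + v)\<^sup>2) + 2 * ((a - v)\<^sup>2 + (b + u)\<^sup>2) + 2 * ((a - u)\<^sup>2 + (b - v)\<^sup>2) + 2 * ((a + v)\<^sup>2 + (b - u)\<^sup>2)
       = 8 * (a\<^sup>2 + b\<^sup>2) + 8 * (u\<^sup>2 + v\<^sup>2)"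
      by (simp add: power2_eq_square algebra_simps)
    moreover define l0 l1 l2 l3 l4 where "l0 = ln (a\<^sup>2 + b\<^sup>2 + c)" and "l1 = ln ((a + u)\<^sup>2 + (b + v)\<^sup>2 + c)"
      and "l2 = ln ((a - v)\<^sup>2 + (b + u)\<^sup>2 + c)" and "l3 = ln ((a - u)\<^sup>2 + (b - v)\<^sup>2 + c)"
      and "l4 = ln ((a + v)\<^sup>2 + (b - u)\<^sup>2 + c)"
    moreover have "4 * l0 - (u\<^sup>2 + v\<^sup>2)\<^sup>2 / c\<^sup>2 \<le> l1 + l2 + l3 + l4"
      unfolding l0_def l1_def l2_def l3_def l4_def by (rule ln_four_rotations[OF c(1)])
    ultimately show ?thesis unfolding psi_def l0_def[symmetric] l1_def[symmetric] l2_def[symmetric] l3_def[symmetric] l4_def[symmetric]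
      by (smt (verit))
  qed
  have 3: "(u\<^sup>2 + v\<^sup>2)\<^sup>2 / c\<^sup>2 \<le> 2 * (u ^ 4 + v ^ 4) / c ^ 3"
  proof -
    have "0 \<le> (u\<^sup>2 - v\<^sup>2)\<^sup>2" by simp
    then have "(u\<^sup>2 + v\<^sup>2)\<^sup>2 \<le> 2 * (u ^ 4 + v ^ 4)" by (simp add: power2_eq_square eval_nat_numeral algebra_simps)
    moreover have "c ^ 3 \<le> c\<^sup>2" using c by (intro power_decreasing) auto
    ultimately show ?thesis using c by (intro frac_le) auto
  qed
  have "(8 * u\<^sup>2 + 6 * u ^ 4 / c ^ 3) + (8 * v\<^sup>2 + 6 * v ^ 4 / c ^ 3) = 8 * (u\<^sup>2 + v\<^sup>2) + 2 * (u ^ 4 + v ^ 4) / c ^ 3 + 4 * ((u ^ 4 + v ^ 4) / c ^ 3)"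
    by (simp add: add_divide_distrib)
  then show ?thesis using 1 2 3 by linarith
qed

lemma nn_integral_normal_uminus:
  assumes [measurable]: "f \<in> borel_measurable borel"
  shows "(\<integral>\<^sup>+x. f (- x) \<partial>density lborel (normal_density 0 \<sigma>)) = (\<integral>\<^sup>+x. f x \<partial>density lborel (normal_density 0 \<sigma>))"
proof -
  have "(\<integral>\<^sup>+x. f x \<partial>density lborel (normal_density 0 \<sigma>)) = (\<integral>\<^sup>+x. ennreal (normal_density 0 \<sigma> x) * f x \<partial>lborel)"
    by (simp add: nn_integral_density)
  also have "\<dots> = (\<integral>\<^sup>+x. ennreal (normal_density 0 \<sigma> (- x)) * f (- x) \<partial>lborel)"
    using nn_integral_real_affine[of "\<lambda>x. ennreal (normal_density 0 \<sigma> x) * f x" "-1" 0] by simp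
  also have "\<dots> = (\<integral>\<^sup>+x. ennreal (normal_density 0 \<sigma> x) * f (- x) \<partial>lborel)"
    by (simp add: normal_density_def)
  also have "\<dots> = (\<integral>\<^sup>+x. f (- x) \<partial>density lborel (normal_density 0 \<sigma>))"
    by (simp add: nn_integral_density)
  finally show ?thesis by simp
qed

lemma nn_integral_normal_rotate:
  fixes F :: "real \<times> real \<Rightarrow> ennreal"
  assumes [measurable]: "F \<in> borel_measurable (borel \<Otimes>\<^sub>M borel)" and \<sigma>: "\<sigma> > 0"
  defines "\<nu> \<equiv> density lborel (normal_density 0 \<sigma>)"
  shows "(\<integral>\<^sup>+u. \<integral>\<^sup>+v. F (- v, u) \<partial>\<nu> \<partial>\<nu>) = (\<integral>\<^sup>+u. \<integral>\<^sup>+v. F (u, v) \<partial>\<nu> \<partial>\<nu>)"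
proof -
  interpret prob_space \<nu> unfolding \<nu>_def using \<sigma> by (rule prob_space_normal_density)
  interpret pair_sigma_finite \<nu> \<nu> ..
  have [measurable_cong]: "sets \<nu> = sets borel" by (simp add: \<nu>_def)
  have "(\<integral>\<^sup>+u. \<integral>\<^sup>+v. F (- v, u) \<partial>\<nu> \<partial>\<nu>) = (\<integral>\<^sup>+v. \<integral>\<^sup>+u. F (- v, u) \<partial>\<nu> \<partial>\<nu>)"
    by (rule Fubini'[symmetric]) measurable
  also have "\<dots> = (\<integral>\<^sup>+v. \<integral>\<^sup>+u. F (v, u) \<partial>\<nu> \<partial>\<nu>)"
    using nn_integral_normal_uminus[of "\<lambda>v. \<integral>\<^sup>+u. F (v, u) \<partial>\<nu>" \<sigma>] unfolding \<nu>_def[symmetric] by simp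
  finally show ?thesis .
qed

lemma nn_integral_normal_moments:
  assumes \<sigma>: "\<sigma> > 0" and k: "k \<ge> 0"
  shows "(\<integral>\<^sup>+x. ennreal (8 * x\<^sup>2 + k * x ^ 4) \<partial>density lborel (normal_density 0 \<sigma>)) = ennreal (8 * \<sigma>\<^sup>2 + 3 * k * \<sigma> ^ 4)"
proof -
  have 2: "has_bochner_integral lborel (\<lambda>x. normal_density 0 \<sigma> x * x\<^sup>2) (\<sigma>\<^sup>2)"
    using normal_moment_even[OF \<sigma>, of 0 1] \<sigma> by (simp add: fact_numeral power2_eq_square)
  have 4: "has_bochner_integral lborel (\<lambda>x. normal_density 0 \<sigma> x * x ^ 4) (3 * \<sigma> ^ 4)"
    using normal_moment_even[OF \<sigma>, of 0 2] \<sigma> by (simp add: fact_numeral field_simps power2_eq_square eval_nat_numeral)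
  have "has_bochner_integral lborel (\<lambda>x. 8 * (normal_density 0 \<sigma> x * x\<^sup>2) + k * (normal_density 0 \<sigma> x * x ^ 4)) (8 * \<sigma>\<^sup>2 + k * (3 * \<sigma> ^ 4))"
    by (intro has_bochner_integral_add has_bochner_integral_mult_right 2 4)
  then have h: "has_bochner_integral lborel (\<lambda>x. normal_density 0 \<sigma> x * (8 * x\<^sup>2 + k * x ^ 4)) (8 * \<sigma>\<^sup>2 + 3 * k * \<sigma> ^ 4)"
    by (simp add: algebra_simps)
  have "(\<integral>\<^sup>+x. ennreal (8 * x\<^sup>2 + k * x ^ 4) \<partial>density lborel (normal_density 0 \<sigma>)) =
      (\<integral>\<^sup>+x. ennreal (normal_density 0 \<sigma> x * (8 * x\<^sup>2 + k * x ^ 4)) \<partial>lborel)"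
    using k by (subst nn_integral_density) (auto simp: ennreal_mult'[symmetric] simp del: ennreal_plus)
  also have "\<dots> = ennreal (8 * \<sigma>\<^sup>2 + 3 * k * \<sigma> ^ 4)"
    using h k by (subst nn_integral_eq_integral) (auto simp: has_bochner_integral_iff)
  finally show ?thesis .
qed

text \<open>For a step of variance \<open>h\<close> the second moments contribute \<open>4 h\<close> and the fourth moments \<open>9 h\<^sup>2 / c ^ 3 \<le> h\<close>.\<close>

lemma psi_gaussian_step:
  assumes c: "0 < c" "c \<le> 1" and ab: "0 \<le> a" "0 \<le> b" and h: "0 < h" "9 * h \<le> c ^ 3"
  defines "\<nu> \<equiv> density lborel (normal_density 0 (sqrt h))"
  shows "(\<integral>\<^sup>+u. \<integral>\<^sup>+v. ennreal (psi c (max (a + u) 0) (max (b + v) 0)) \<partial>\<nu> \<partial>\<nu>) \<le> ennreal (psi c a b + 5 * h)"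
proof -
  have \<sigma>: "sqrt h > 0" using h by simp
  interpret prob_space \<nu> unfolding \<nu>_def using \<sigma> by (rule prob_space_normal_density)
  have [measurable_cong]: "sets \<nu> = sets borel" by (simp add: \<nu>_def)
  define F where "F p = ennreal (psi c (max (a + fst p) 0) (max (b + snd p) 0))" for p :: "real \<times> real"
  have F[measurable]: "F \<in> borel_measurable (borel \<Otimes>\<^sub>M borel)" unfolding F_def psi_def by measurable
  define I where "I G = (\<integral>\<^sup>+u. \<integral>\<^sup>+v. G (u, v) \<partial>\<nu> \<partial>\<nu>)" for G :: "real \<times> real \<Rightarrow> ennreal"
  define g where "g u = 8 * u\<^sup>2 + (6 / c ^ 3) * u ^ 4" for u :: real
  have g0: "g u \<ge> 0" for u using c by (simp add: g_def)
  have [measurable]: "g \<in> borel_measurable borel" unfolding g_def by measurable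
  have rot: "I (\<lambda>p. G (- snd p, fst p)) = I G" if [measurable]: "G \<in> borel_measurable (borel \<Otimes>\<^sub>M borel)" for G
    using nn_integral_normal_rotate[OF that \<sigma>] by (simp add: I_def \<nu>_def)
  define F1 F2 F3 where "F1 p = F (- snd p, fst p)" and "F2 p = F1 (- snd p, fst p)" and "F3 p = F2 (- snd p, fst p)" for p
  have [measurable]: "F1 \<in> borel_measurable (borel \<Otimes>\<^sub>M borel)" unfolding F1_def by measurable
  have [measurable]: "F2 \<in> borel_measurable (borel \<Otimes>\<^sub>M borel)" unfolding F2_def by measurable
  have [measurable]: "F3 \<in> borel_measurable (borel \<Otimes>\<^sub>M borel)" unfolding F3_def by measurable
  have IF: "I F1 = I F" "I F2 = I F" "I F3 = I F"
  proof -
    show 1: "I F1 = I F" using rot[of F] unfolding F1_def[abs_def] by simp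
    show 2: "I F2 = I F" using rot[of F1] 1 unfolding F2_def[abs_def] by simp
    show "I F3 = I F" using rot[of F2] 2 unfolding F3_def[abs_def] by simp
  qed
  have "4 * I F = I F + I F1 + I F2 + I F3"
  proof -
    have "4 * x = x + x + x + x" for x :: ennreal
    proof -
      have "(4::ennreal) = 1 + 1 + 1 + 1" by simp
      then show ?thesis by (simp only: distrib_right mult_1_left)
    qed
    then show ?thesis unfolding IF .
  qed
  also have "\<dots> = I (\<lambda>p. F p + F1 p + F2 p + F3 p)"
    unfolding I_def by (simp add: nn_integral_add)
  also have "\<dots> \<le> I (\<lambda>p. ennreal (4 * psi c a b) + ennreal (g (fst p)) + ennreal (g (snd p)))"
    unfolding I_def
  proof (intro nn_integral_mono)
    fix u v
    have "F (u, v) + F1 (u, v) + F2 (u, v) + F3 (u, v) =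
       ennreal (psi c (max (a + u) 0) (max (b + v) 0) + psi c (max (a - v) 0) (max (b + u) 0)
       + psi c (max (a - u) 0) (max (b - v) 0) + psi c (max (a + v) 0) (max (b - u) 0))"
      unfolding F3_def F2_def F1_def F_def fst_conv snd_conv using psi_nonneg[OF c] by simp
    also have "\<dots> \<le> ennreal (4 * psi c a b + g u + g v)"
      using psi_four_rotations[OF c ab, of u v] by (intro ennreal_leI) (simp add: g_def)
    also have "\<dots> = ennreal (4 * psi c a b) + ennreal (g u) + ennreal (g v)"
      using g0 psi_nonneg[OF c] by simp
    finally show "F (u, v) + F1 (u, v) + F2 (u, v) + F3 (u, v) \<le>
      ennreal (4 * psi c a b) + ennreal (g (fst (u, v))) + ennreal (g (snd (u, v)))" by simp
  qed
  also have "\<dots> = ennreal (4 * psi c a b) + (\<integral>\<^sup>+u. ennreal (g u) \<partial>\<nu>) + (\<integral>\<^sup>+u. ennreal (g u) \<partial>\<nu>)"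
    unfolding I_def fst_conv snd_conv by (simp add: nn_integral_add emeasure_space_1)
  also have "(\<integral>\<^sup>+u. ennreal (g u) \<partial>\<nu>) = ennreal (8 * h + 18 * (h * h / c ^ 3))"
  proof -
    have "sqrt h ^ 4 = (sqrt h)\<^sup>2 * (sqrt h)\<^sup>2" by (simp only: power_add[symmetric]) simp
    then have "sqrt h ^ 4 = h * h" "(sqrt h)\<^sup>2 = h" using h by simp_all
    then show ?thesis
      unfolding g_def \<nu>_def using c by (subst nn_integral_normal_moments[OF \<sigma>]) simp_all
  qed
  also have "ennreal (4 * psi c a b) + ennreal (8 * h + 18 * (h * h / c ^ 3)) + ennreal (8 * h + 18 * (h * h / c ^ 3))
     = ennreal (4 * psi c a b + (8 * h + 18 * (h * h / c ^ 3)) + (8 * h + 18 * (h * h / c ^ 3)))"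
  proof -
    have "ennreal x + ennreal y + ennreal z = ennreal (x + y + z)" if "0 \<le> x" "0 \<le> y" "0 \<le> z" for x y z
      using that by simp
    then show ?thesis by (rule) (use h c psi_nonneg[OF c, of a b] in auto)
  qed
  also have "\<dots> \<le> ennreal (4 * (psi c a b + 5 * h))"
  proof (rule ennreal_leI)
    have "9 * h * h \<le> c ^ 3 * h" using h by (intro mult_right_mono) auto
    then have "9 * (h * h / c ^ 3) \<le> h" using c by (simp add: field_simps)
    moreover define x where "x = h * h / c ^ 3"
    ultimately have "9 * x \<le> h" by simp
    then show "4 * psi c a b + (8 * h + 18 * (h * h / c ^ 3)) + (8 * h + 18 * (h * h / c ^ 3)) \<le> 4 * (psi c a b + 5 * h)"
      unfolding x_def[symmetric] by simp
  qed
  also have "\<dots> = 4 * ennreal (psi c a b + 5 * h)"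
    using psi_nonneg[OF c, of a b] h by (simp add: ennreal_mult)
  finally have "4 * I F \<le> 4 * ennreal (psi c a b + 5 * h)" .
  then have "I F \<le> ennreal (psi c a b + 5 * h)"
    by (subst (asm) ennreal_mult_le_mult_iff) auto
  then show ?thesis by (simp add: I_def F_def)
qed

text \<open>The walk with increments \<open>y\<close>, started at \<open>1\<close> and pushed up to \<open>0\<close> whenever it would become negative; it is the height of
the unreflected walk above the minimum of \<open>0\<close> and its running minimum.\<close>

primrec reflected :: "(nat \<Rightarrow> real) \<Rightarrow> nat \<Rightarrow> real" where
  "reflected y 0 = 1"
| "reflected y (Suc n) = max (reflected y n + y n) 0"

lemma reflected_nonneg: "0 \<le> reflected y n"
  by (induction n) auto

lemma reflected_cong: "(\<And>i. i < n \<Longrightarrow> y i = y' i) \<Longrightarrow> reflected y n = reflected y' n"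
  by (induction n) auto

lemma reflected_le:
  assumes "v \<le> 0" "\<And>l. l \<le> i \<Longrightarrow> v \<le> w j (real l * h)" "w j 0 = 1"
  shows "reflected (grid_inc w h j) i \<le> w j (real i * h) - v"
  using assms(2)
proof (induction i)
  case (Suc i)
  have "reflected (grid_inc w h j) i \<le> w j (real i * h) - v" by (rule Suc.IH) (simp add: Suc.prems)
  then show ?case using Suc.prems[of "Suc i"] grid_inc_def[of w h j i] by simp
qed (use assms in simp)

lemma reflected_measurable [measurable]:
  assumes "\<And>i. i < n \<Longrightarrow> (\<lambda>x. f x i) \<in> borel_measurable M"
  shows "(\<lambda>x. reflected (f x) n) \<in> borel_measurable M"
  using assms by (induction n) auto

definition near_origin :: "real \<Rightarrow> (bool \<times> nat \<Rightarrow> real) \<Rightarrow> nat \<Rightarrow> bool" where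
  "near_origin r y i \<longleftrightarrow> (\<forall>j. reflected (\<lambda>n. y (j, n)) i \<le> r)"

lemma psi_near_origin:
  assumes r: "0 < r" "r \<le> 1" and xy: "0 \<le> x" "x \<le> r" "0 \<le> y" "y \<le> r"
  shows "ln (1 / (3 * r\<^sup>2)) \<le> psi (r\<^sup>2) x y"
proof -
  have "x\<^sup>2 \<le> r\<^sup>2" "y\<^sup>2 \<le> r\<^sup>2" using xy by (auto intro: power_mono)
  moreover have r2: "r\<^sup>2 > 0" using r by simp
  ultimately have "ln (x\<^sup>2 + y\<^sup>2 + r\<^sup>2) \<le> ln (3 * r\<^sup>2)" by (intro ln_mono add_nonneg_pos) auto
  moreover have "ln (1 / (3 * r\<^sup>2)) = - ln (3 * r\<^sup>2)" using r by (simp add: ln_div)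
  moreover have "0 \<le> 2 * (x\<^sup>2 + y\<^sup>2)" "x + y \<le> 2" using xy r by auto
  ultimately show ?thesis unfolding psi_def by linarith
qed

context prob_space
begin

text \<open>Let \<open>P\<close> be \<open>psi\<close> of the reflected walk, frozen at the value \<open>K\<close> after a visit to the square \<open>[0, r]\<^sup>2\<close>. There \<open>psi \<ge> K\<close>, so
freezing does not increase the expectation, and the expectation of \<open>P\<close> grows by at most \<open>5 h\<close> per step. Markov's
inequality then bounds the probability of a visit by a constant divided by \<open>K = ln (1 / (3 r\<^sup>2))\<close>.\<close>

lemma near_origin_prob:
  fixes X :: "bool \<times> nat \<Rightarrow> 'a \<Rightarrow> real"
  assumes ind: "indep_vars (\<lambda>_. borel) X UNIV"
    and normal: "\<And>j. distributed M lborel (X j) (normal_density 0 (sqrt h))"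
    and r: "0 < r" "3 * r\<^sup>2 \<le> 1" and h: "0 < h" "9 * h \<le> (r\<^sup>2) ^ 3"
  shows "ln (1 / (3 * r\<^sup>2)) * prob {\<omega>\<in>space M. \<exists>i\<le>n. near_origin r (\<lambda>j. X j \<omega>) i} \<le> 4 + 5 * (real n + 1) * h"
proof -
  define c where "c = r\<^sup>2"
  have c: "0 < c" "c \<le> 1" "9 * h \<le> c ^ 3" using r h by (auto simp: c_def)
  have r1: "r \<le> 1"
  proof (rule ccontr)
    assume "\<not> r \<le> 1"
    then have "1\<^sup>2 \<le> r\<^sup>2" by (intro power_mono) auto
    with r(2) show False by simp
  qed
  define K where "K = ln (1 / (3 * r\<^sup>2))"
  have K: "K \<ge> 0" unfolding K_def using r by (intro ln_ge_zero) (simp add: field_simps)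
  have Xm[measurable]: "X j \<in> borel_measurable M" for j using distributed_measurable[OF normal] by simp
  define \<nu> where "\<nu> = density lborel (\<lambda>x. ennreal (normal_density 0 (sqrt h) x))"
  have X\<nu>: "distr M borel (X j) = \<nu>" for j
    using distributed_distr_eq_density[OF normal[of j]] unfolding \<nu>_def by (metis distr_cong sets_lborel)
  define P where "P y n = (if \<exists>i<n. near_origin r y i then ennreal K
      else ennreal (psi c (reflected (\<lambda>n. y (True, n)) n) (reflected (\<lambda>n. y (False, n)) n)))" for y n
  have step: "(\<integral>\<^sup>+\<omega>. P (\<lambda>j. X j \<omega>) (Suc n) \<partial>M) \<le> (\<integral>\<^sup>+\<omega>. P (\<lambda>j. X j \<omega>) n \<partial>M) + ennreal (5 * h)" for n
  proof -
    define I where "I = (UNIV :: bool set) \<times> {..<n}"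
    define V where "V \<omega> = (\<lambda>j\<in>I. X j \<omega>)" for \<omega>
    define J where "J = (UNIV :: bool set) \<times> {n}"
    define Z where "Z \<omega> = (\<lambda>j\<in>J. X j \<omega>)" for \<omega>
    define a where "a j y = reflected (\<lambda>n. y (j, n)) n" for j and y :: "bool \<times> nat \<Rightarrow> real"
    define hit where "hit y \<longleftrightarrow> (\<exists>i\<le>n. near_origin r y i)" for y
    define f where "f y z = (if hit y then ennreal K
        else ennreal (psi c (max (a True y + z (True, n)) 0) (max (a False y + z (False, n)) 0)))"
      for y and z :: "bool \<times> nat \<Rightarrow> real"
    have [measurable]: "(\<lambda>z. z (j, n)) \<in> borel_measurable (Pi\<^sub>M J (\<lambda>_. borel))" for j
      by (rule measurable_component_singleton) (simp add: J_def)
    have am: "(\<lambda>y. reflected (\<lambda>n. y (j, n)) i) \<in> borel_measurable (Pi\<^sub>M I (\<lambda>_. borel))" if "i \<le> n" for i j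
      using that by (intro reflected_measurable measurable_component_singleton) (auto simp: I_def)
    have near_m: "Measurable.pred (Pi\<^sub>M I (\<lambda>_. borel)) (\<lambda>y. near_origin r y i)" if "i \<le> n" for i
      unfolding near_origin_def all_bool_eq using am[OF that] by measurable
    have [measurable]: "a j \<in> borel_measurable (Pi\<^sub>M I (\<lambda>_. borel))" for j
      unfolding a_def by (rule am) simp
    have [measurable]: "Measurable.pred (Pi\<^sub>M I (\<lambda>_. borel)) hit"
    proof -
      have "Measurable.pred (Pi\<^sub>M I (\<lambda>_. borel)) (\<lambda>y. \<exists>i\<in>{..n}. near_origin r y i)"
        using near_m by (intro pred_intros_finite) auto
      then show ?thesis unfolding hit_def by (simp only: atMost_iff Bex_def)
    qed
    have fm[measurable]: "(\<lambda>(y, z). f y z) \<in> borel_measurable (Pi\<^sub>M I (\<lambda>_. borel) \<Otimes>\<^sub>M Pi\<^sub>M J (\<lambda>_. borel))"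
      unfolding f_def by measurable
    have VZ: "indep_var (Pi\<^sub>M I (\<lambda>_. borel)) V (Pi\<^sub>M J (\<lambda>_. borel)) Z"
      unfolding V_def Z_def by (rule indep_var_restrict[OF ind]) (auto simp: I_def J_def)
    have Vm[measurable]: "V \<in> measurable M (Pi\<^sub>M I (\<lambda>_. borel))" unfolding V_def by measurable
    have Zm[measurable]: "Z \<in> measurable M (Pi\<^sub>M J (\<lambda>_. borel))" unfolding Z_def by measurable
    interpret DV: prob_space "distr M (Pi\<^sub>M I (\<lambda>_. borel)) V" by (rule prob_space_distr) measurable
    interpret DZ: prob_space "distr M (Pi\<^sub>M J (\<lambda>_. borel)) Z" by (rule prob_space_distr) measurable
    interpret N: prob_space \<nu> unfolding \<nu>_def using h by (intro prob_space_normal_density) simp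
    have [measurable_cong]: "sets \<nu> = sets borel" by (simp add: \<nu>_def)
    have "indep_var borel (X (True, n)) borel (X (False, n))"
    proof -
      have "indep_var (Pi\<^sub>M {(True, n)} (\<lambda>_. borel)) (\<lambda>\<omega>. \<lambda>j\<in>{(True, n)}. X j \<omega>)
          (Pi\<^sub>M {(False, n)} (\<lambda>_. borel)) (\<lambda>\<omega>. \<lambda>j\<in>{(False, n)}. X j \<omega>)"
        by (rule indep_var_restrict[OF ind]) auto
      then have "indep_var borel ((\<lambda>y. y (True, n)) \<circ> (\<lambda>\<omega>. \<lambda>j\<in>{(True, n)}. X j \<omega>))
          borel ((\<lambda>y. y (False, n)) \<circ> (\<lambda>\<omega>. \<lambda>j\<in>{(False, n)}. X j \<omega>))"
        by (rule indep_var_compose) (auto intro: measurable_component_singleton)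
      then show ?thesis by (simp add: comp_def)
    qed
    then have D\<nu>: "distr M (borel \<Otimes>\<^sub>M borel) (\<lambda>\<omega>. (X (True, n) \<omega>, X (False, n) \<omega>)) = \<nu> \<Otimes>\<^sub>M \<nu>"
      unfolding indep_var_distribution_eq X\<nu> by simp
    have inner: "(\<integral>\<^sup>+z. f y z \<partial>distr M (Pi\<^sub>M J (\<lambda>_. borel)) Z) \<le> P y n + ennreal (5 * h)"
      if y: "y \<in> space (Pi\<^sub>M I (\<lambda>_. borel))" for y
    proof (cases "hit y")
      case True
      then have "(\<integral>\<^sup>+z. f y z \<partial>distr M (Pi\<^sub>M J (\<lambda>_. borel)) Z) = ennreal K"
        using DZ.emeasure_space_1 by (simp add: f_def)
      also have "\<dots> \<le> P y n"
      proof (cases "\<exists>i<n. near_origin r y i")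
        case False
        with True have "near_origin r y n" unfolding hit_def by (metis le_neq_implies_less)
        then show ?thesis
          using False psi_near_origin[OF r(1) r1] reflected_nonneg unfolding P_def K_def c_def near_origin_def
          by (auto intro!: ennreal_leI)
      qed (simp add: P_def)
      finally show ?thesis by (simp add: add_increasing2)
    next
      case False
      then have "(\<integral>\<^sup>+z. f y z \<partial>distr M (Pi\<^sub>M J (\<lambda>_. borel)) Z) =
        (\<integral>\<^sup>+z. ennreal (psi c (max (a True y + z (True, n)) 0) (max (a False y + z (False, n)) 0))
          \<partial>distr M (Pi\<^sub>M J (\<lambda>_. borel)) Z)"
        unfolding f_def by simp
      also have "\<dots> = (\<integral>\<^sup>+\<omega>. ennreal (psi c (max (a True y + Z \<omega> (True, n)) 0) (max (a False y + Z \<omega> (False, n)) 0)) \<partial>M)"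
        by (rule nn_integral_distr) measurable
      also have "\<dots> = (\<integral>\<^sup>+\<omega>. (\<lambda>z. ennreal (psi c (max (a True y + fst z) 0) (max (a False y + snd z) 0))) (X (True, n) \<omega>, X (False, n) \<omega>) \<partial>M)"
        by (simp add: Z_def J_def)
      also have "\<dots> = (\<integral>\<^sup>+z. ennreal (psi c (max (a True y + fst z) 0) (max (a False y + snd z) 0)) \<partial>(\<nu> \<Otimes>\<^sub>M \<nu>))"
        unfolding D\<nu>[symmetric] by (rule nn_integral_distr[symmetric]) measurable
      also have "\<dots> = (\<integral>\<^sup>+u. \<integral>\<^sup>+v. ennreal (psi c (max (a True y + u) 0) (max (a False y + v) 0)) \<partial>\<nu> \<partial>\<nu>)"
        by (subst N.nn_integral_fst[symmetric]) auto
      also have "\<dots> \<le> ennreal (psi c (a True y) (a False y) + 5 * h)"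
        unfolding \<nu>_def using c h reflected_nonneg by (intro psi_gaussian_step) (auto simp: a_def)
      also have "\<dots> = P y n + ennreal (5 * h)"
        using False psi_nonneg[OF c(1,2)] h unfolding P_def a_def hit_def by (subst ennreal_plus) auto
      finally show ?thesis .
    qed
    have near_V: "near_origin r (\<lambda>j. X j \<omega>) i = near_origin r (V \<omega>) i" if "i \<le> n" for i \<omega>
      unfolding near_origin_def V_def I_def using that
      by (intro arg_cong[of _ _ All] ext arg_cong2[of _ _ _ _ "(\<le>)"] reflected_cong refl) auto
    have a_V: "reflected (\<lambda>n. X (j, n) \<omega>) n = a j (V \<omega>)" for j \<omega>
      unfolding a_def V_def I_def by (intro reflected_cong) auto
    have "P (\<lambda>j. X j \<omega>) (Suc n) = f (V \<omega>) (Z \<omega>)" for \<omega>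
      unfolding P_def f_def hit_def using near_V by (auto simp: less_Suc_eq_le a_V Z_def J_def)
    then have "(\<integral>\<^sup>+\<omega>. P (\<lambda>j. X j \<omega>) (Suc n) \<partial>M) = (\<integral>\<^sup>+\<omega>. (\<lambda>(y, z). f y z) (V \<omega>, Z \<omega>) \<partial>M)" by simp
    also have "\<dots> = (\<integral>\<^sup>+p. (\<lambda>(y, z). f y z) p \<partial>distr M (Pi\<^sub>M I (\<lambda>_. borel) \<Otimes>\<^sub>M Pi\<^sub>M J (\<lambda>_. borel)) (\<lambda>\<omega>. (V \<omega>, Z \<omega>)))"
      by (rule nn_integral_distr[symmetric]) measurable
    also have "\<dots> = (\<integral>\<^sup>+p. (\<lambda>(y, z). f y z) p \<partial>(distr M (Pi\<^sub>M I (\<lambda>_. borel)) V \<Otimes>\<^sub>M distr M (Pi\<^sub>M J (\<lambda>_. borel)) Z))"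
      using VZ unfolding indep_var_distribution_eq by simp
    also have "\<dots> = (\<integral>\<^sup>+y. \<integral>\<^sup>+z. f y z \<partial>distr M (Pi\<^sub>M J (\<lambda>_. borel)) Z \<partial>distr M (Pi\<^sub>M I (\<lambda>_. borel)) V)"
      by (subst DZ.nn_integral_fst[symmetric]) auto
    also have "\<dots> = (\<integral>\<^sup>+\<omega>. \<integral>\<^sup>+z. f (V \<omega>) z \<partial>distr M (Pi\<^sub>M J (\<lambda>_. borel)) Z \<partial>M)"
      by (rule nn_integral_distr) measurable
    also have "\<dots> \<le> (\<integral>\<^sup>+\<omega>. P (V \<omega>) n + ennreal (5 * h) \<partial>M)"
      using measurable_space[OF Vm] by (intro nn_integral_mono inner) auto
    also have "\<dots> = (\<integral>\<^sup>+\<omega>. P (V \<omega>) n \<partial>M) + ennreal (5 * h)"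
    proof -
      have "(\<lambda>y. P y n) \<in> borel_measurable (Pi\<^sub>M I (\<lambda>_. borel))"
      proof -
        have "Measurable.pred (Pi\<^sub>M I (\<lambda>_. borel)) (\<lambda>y. \<exists>i\<in>{..<n}. near_origin r y i)"
          using near_m by (intro pred_intros_finite) auto
        moreover define hit' where "hit' y \<longleftrightarrow> (\<exists>i<n. near_origin r y i)" for y
        ultimately have [measurable]: "Measurable.pred (Pi\<^sub>M I (\<lambda>_. borel)) hit'"
          unfolding hit'_def by (simp only: lessThan_iff Bex_def)
        show ?thesis unfolding P_def a_def[symmetric] hit'_def[symmetric] by measurable
      qed
      then have "(\<lambda>\<omega>. P (V \<omega>) n) \<in> borel_measurable M" by (rule measurable_compose[OF Vm])
      then show ?thesis by (simp add: nn_integral_add emeasure_space_1)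
    qed
    finally have "(\<integral>\<^sup>+\<omega>. P (\<lambda>j. X j \<omega>) (Suc n) \<partial>M) \<le> (\<integral>\<^sup>+\<omega>. P (V \<omega>) n \<partial>M) + ennreal (5 * h)" .
    moreover have "P (V \<omega>) n = P (\<lambda>j. X j \<omega>) n" for \<omega>
      unfolding P_def a_def[symmetric] using near_V a_V by auto
    ultimately show ?thesis by simp
  qed
  have bound: "(\<integral>\<^sup>+\<omega>. P (\<lambda>j. X j \<omega>) n \<partial>M) \<le> ennreal (4 + 5 * real n * h)" for n
  proof (induction n)
    case 0
    have "psi c 1 1 \<le> 4" unfolding psi_def using c ln_ge_zero[of "2 + c"] by simp
    then have "(\<integral>\<^sup>+\<omega>. P (\<lambda>j. X j \<omega>) 0 \<partial>M) \<le> (\<integral>\<^sup>+\<omega>. ennreal 4 \<partial>M)"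
      unfolding P_def by (intro nn_integral_mono) (auto simp del: ennreal_numeral intro: ennreal_leI)
    then show ?case by (simp add: emeasure_space_1)
  next
    case (Suc n)
    have "(\<integral>\<^sup>+\<omega>. P (\<lambda>j. X j \<omega>) (Suc n) \<partial>M) \<le> ennreal (4 + 5 * real n * h) + ennreal (5 * h)"
      using order_trans[OF step add_right_mono[OF Suc.IH]] .
    also have "\<dots> = ennreal (4 + 5 * real (Suc n) * h)"
      using h by (subst ennreal_plus[symmetric]) (auto simp: algebra_simps)
    finally show ?case .
  qed
  define H where "H = {\<omega>\<in>space M. \<exists>i\<le>n. near_origin r (\<lambda>j. X j \<omega>) i}"
  have Hm[measurable]: "H \<in> events"
    unfolding H_def near_origin_def by measurable
  have "ennreal (K * prob H) = ennreal K * emeasure M H"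
    using K by (simp add: emeasure_eq_measure ennreal_mult)
  also have "\<dots> = (\<integral>\<^sup>+\<omega>. ennreal K * indicator H \<omega> \<partial>M)"
    by (rule nn_integral_cmult_indicator[symmetric]) measurable
  also have "\<dots> \<le> (\<integral>\<^sup>+\<omega>. P (\<lambda>j. X j \<omega>) (Suc n) \<partial>M)"
    by (intro nn_integral_mono) (auto simp: P_def H_def indicator_def less_Suc_eq_le)
  also have "\<dots> \<le> ennreal (4 + 5 * real (Suc n) * h)" by (rule bound)
  finally have "K * prob H \<le> 4 + 5 * real (Suc n) * h"
    using h by (subst (asm) ennreal_le_iff) auto
  then show ?thesis by (simp add: K_def H_def add.commute)
qed

end

context brownian_pair
begin

text \<open>At a common record \<open>t\<close> both reflected walks on a sufficiently fine grid visit the square \<open>[0, r]\<^sup>2\<close>, by uniform continuity and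
\<open>reflected_le\<close>. For paths up to a fixed time the probability of such visits on all fine grids is at most of order
\<open>1 / ln (1 / r)\<close>, for every \<open>r\<close>, hence zero.\<close>

lemma AE_no_common_record:
  "AE \<omega> in M. \<forall>t>0. \<exists>j. W j t \<omega> > 0 \<or> (\<exists>s\<in>{0..<t}. W j s \<omega> \<le> W j t \<omega>)"
proof -
  define H where "H b r n = {\<omega>\<in>space M. \<exists>i\<le>Suc n. near_origin r (\<lambda>j. grid_inc (path \<omega>) (real (Suc b) / Suc n) (fst j) (snd j)) i}" for b n :: nat and r
  define R where "R l = 1 / (real l + 2)" for l :: nat
  define L where "L b l = (\<Union>m. \<Inter>n\<in>{m..}. H b (R l) n)" for b l
  have hp: "real (Suc b) / Suc n > 0" for b n by simp
  have Hm: "H b r n \<in> events" for b r n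
    unfolding H_def near_origin_def using grid_inc_measurable[OF hp[of b n]] by measurable
  have Rp: "0 < R l" "3 * (R l)\<^sup>2 \<le> 1" "R l \<le> 1/2" for l
  proof -
    show "0 < R l" by (simp add: R_def)
    show le: "R l \<le> 1/2" by (simp add: R_def field_simps)
    show "3 * (R l)\<^sup>2 \<le> 1" using power_mono[OF le, of 2] \<open>0 < R l\<close> by (simp add: power2_eq_square)
  qed
  have H_prob: "\<forall>\<^sub>F n in sequentially. ln (1 / (3 * (R l)\<^sup>2)) * prob (H b (R l) n) \<le> 4 + 10 * real (Suc b)" for b l
  proof -
    have "(\<lambda>n. 9 * (real (Suc b) / real (Suc n))) \<longlonglongrightarrow> 0" by real_asymp
    moreover have "0 < ((R l)\<^sup>2) ^ 3" using Rp(1)[of l] by simp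
    ultimately have "\<forall>\<^sub>F n in sequentially. 9 * (real (Suc b) / real (Suc n)) < ((R l)\<^sup>2) ^ 3"
      by (rule order_tendstoD)
    then show ?thesis
    proof eventually_elim
      case (elim n)
      have "ln (1 / (3 * (R l)\<^sup>2)) * prob (H b (R l) n) \<le> 4 + 5 * (real (Suc n) + 1) * (real (Suc b) / real (Suc n))"
        unfolding H_def using elim Rp
        by (intro near_origin_prob grid_inc_indep grid_inc_normal) auto
      also have "5 * (real (Suc n) + 1) * (real (Suc b) / real (Suc n)) \<le> 5 * (2 * real (Suc n)) * (real (Suc b) / real (Suc n))"
        by (intro mult_right_mono mult_left_mono) auto
      also have "5 * (2 * real (Suc n)) * (real (Suc b) / real (Suc n)) = 10 * real (Suc b)"
        by (simp del: of_nat_Suc)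
      finally show ?case by simp
    qed
  qed
  have Lm: "L b l \<in> events" for b l
    unfolding L_def by (intro sets.countable_UN) (auto intro!: sets.countable_INT' Hm)
  have lnp: "ln (1 / (3 * (R l)\<^sup>2)) \<ge> 0" for l
    using Rp(1,2)[of l] by (intro ln_ge_zero) (simp add: pos_le_divide_eq)
  have L_prob: "ln (1 / (3 * (R l)\<^sup>2)) * prob (L b l) \<le> 4 + 10 * real (Suc b)" for b l
  proof -
    have "(\<lambda>m. prob (\<Inter>n\<in>{m..}. H b (R l) n)) \<longlonglongrightarrow> prob (L b l)"
      unfolding L_def
    proof (rule finite_Lim_measure_incseq)
      show "range (\<lambda>m. \<Inter>n\<in>{m..}. H b (R l) n) \<subseteq> events" by (auto intro!: sets.countable_INT' Hm)
      show "incseq (\<lambda>m. \<Inter>n\<in>{m..}. H b (R l) n)" by (auto simp: incseq_def)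
    qed
    then have lim: "(\<lambda>m. ln (1 / (3 * (R l)\<^sup>2)) * prob (\<Inter>n\<in>{m..}. H b (R l) n)) \<longlonglongrightarrow> ln (1 / (3 * (R l)\<^sup>2)) * prob (L b l)"
      by (intro tendsto_intros)
    show ?thesis
    proof (rule tendsto_upperbound[OF lim])
      show "\<forall>\<^sub>F m in sequentially. ln (1 / (3 * (R l)\<^sup>2)) * prob (\<Inter>n\<in>{m..}. H b (R l) n) \<le> 4 + 10 * real (Suc b)"
        using H_prob[of l b]
      proof eventually_elim
        case (elim m)
        have "prob (\<Inter>n\<in>{m..}. H b (R l) n) \<le> prob (H b (R l) m)"
          by (intro finite_measure_mono Hm) auto
        from mult_left_mono[OF this lnp[of l]] elim show ?case by linarith
      qed
    qed simp
  qed
  have null: "(\<Inter>l. L b l) \<in> null_sets M" for b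
  proof -
    have ev: "(\<Inter>l. L b l) \<in> events" by (intro sets.countable_INT') (auto intro: Lm)
    define e where "e = prob (\<Inter>l. L b l)"
    have "ln (1 / (3 * (R l)\<^sup>2)) * e \<le> 4 + 10 * real (Suc b)" for l
    proof -
      have "e \<le> prob (L b l)" unfolding e_def by (intro finite_measure_mono Lm) auto
      from mult_left_mono[OF this lnp[of l]] L_prob[of l b] show ?thesis by linarith
    qed
    moreover have "filterlim (\<lambda>l. ln (1 / (3 * (R l)\<^sup>2)) * e) at_top sequentially" if "e > 0"
    proof -
      have "filterlim (\<lambda>l. ln (1 / (3 * (R l)\<^sup>2))) at_top sequentially" unfolding R_def by real_asymp
      then show ?thesis using that by (subst mult.commute) (intro filterlim_tendsto_pos_mult_at_top[OF tendsto_const])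
    qed
    ultimately have "\<not> e > 0"
      by (metis (mono_tags, lifting) filterlim_at_top_dense eventually_happens not_less trivial_limit_sequentially)
    then have "e = 0" unfolding e_def by (simp add: zero_less_measure_iff)
    then show ?thesis using ev by (simp add: e_def null_sets_def emeasure_eq_measure)
  qed
  have "AE \<omega> in M. \<forall>b. \<omega> \<notin> (\<Inter>l. L b l)"
    unfolding AE_all_countable using AE_not_in[OF null] by blast
  with AE_start AE_continuous AE_space show ?thesis
  proof eventually_elim
    fix \<omega> assume start: "\<forall>j. W j 0 \<omega> = 1" and cont: "\<forall>j. continuous_on {0..} (path \<omega> j)"
      and sp: "\<omega> \<in> space M" and nL: "\<forall>b. \<omega> \<notin> (\<Inter>l. L b l)"
    show "\<forall>t>0. \<exists>j. W j t \<omega> > 0 \<or> (\<exists>s\<in>{0..<t}. W j s \<omega> \<le> W j t \<omega>)"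
    proof (rule ccontr)
      assume "\<not> ?thesis"
      then obtain t where t: "t > 0" and le0: "\<And>j. W j t \<omega> \<le> 0" and rec: "\<And>j s. 0 \<le> s \<Longrightarrow> s < t \<Longrightarrow> W j t \<omega> < W j s \<omega>"
        by (auto simp: not_less not_le)
      define b where "b = nat \<lceil>t\<rceil>"
      have b: "t \<le> real (Suc b)" by (simp add: b_def) linarith
      have "\<omega> \<in> L b l" for l
      proof -
        have "\<forall>j. \<exists>\<delta>>0. \<forall>s\<in>{0..real (Suc b)}. \<forall>s'\<in>{0..real (Suc b)}. dist s' s < \<delta> \<longrightarrow> dist (W j s' \<omega>) (W j s \<omega>) < R l"
        proof
          fix j
          have "uniformly_continuous_on {0..real (Suc b)} (path \<omega> j)"
            by (rule compact_uniformly_continuous[OF continuous_on_subset[OF cont[rule_format, of j]]]) auto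
          from this[unfolded uniformly_continuous_on_def, THEN spec, THEN mp, OF Rp(1)[of l]] show "\<exists>\<delta>>0. \<forall>s\<in>{0..real (Suc b)}. \<forall>s'\<in>{0..real (Suc b)}. dist s' s < \<delta> \<longrightarrow> dist (W j s' \<omega>) (W j s \<omega>) < R l"
            .
        qed
        then obtain D where D: "\<And>j. D j > 0" "\<And>j s s'. s \<in> {0..real (Suc b)} \<Longrightarrow> s' \<in> {0..real (Suc b)} \<Longrightarrow> dist s' s < D j \<Longrightarrow> dist (W j s' \<omega>) (W j s \<omega>) < R l"
          by metis
        define \<delta> where "\<delta> = min (D True) (D False)"
        have \<delta>: "\<delta> > 0" "\<And>j. \<delta> \<le> D j" using D(1) by (auto simp: \<delta>_def) (metis (full_types) min.cobounded1 min.cobounded2)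
        have "(\<lambda>n. real (Suc b) / real (Suc n)) \<longlonglongrightarrow> 0" by real_asymp
        then have "\<forall>\<^sub>F n in sequentially. real (Suc b) / real (Suc n) < \<delta>" using \<delta>(1) by (rule order_tendstoD)
        then have "\<forall>\<^sub>F n in sequentially. \<omega> \<in> H b (R l) n"
        proof eventually_elim
          case (elim n)
          define h where "h = real (Suc b) / real (Suc n)"
          have h: "h > 0" by (simp add: h_def)
          have hd: "h < \<delta>" using elim by (simp only: h_def)
          define i where "i = nat \<lfloor>t / h\<rfloor>"
          note fc = floor_cell[OF h less_imp_le[OF t], folded i_def]
          have nh: "real (Suc n) * h = real (Suc b)" by (simp add: h_def)
          have "t / h \<le> real (Suc n)" unfolding pos_divide_le_eq[OF h] nh by (rule b)
          then have i: "i \<le> Suc n" unfolding i_def by linarith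
          have "reflected (grid_inc (path \<omega>) h j) i \<le> R l" for j
          proof -
            have "reflected (grid_inc (path \<omega>) h j) i \<le> W j (real i * h) \<omega> - W j t \<omega>"
            proof (rule reflected_le)
              fix k assume "k \<le> i"
              then have "real k * h \<le> real i * h" using h by (intro mult_right_mono) auto
              then have "real k * h \<le> t" using fc(1) by linarith
              then show "W j t \<omega> \<le> W j (real k * h) \<omega>"
                using rec[of "real k * h" j] h by (cases "real k * h = t") auto
            qed (use le0 start in auto)
            also have "\<dots> \<le> dist (W j (real i * h) \<omega>) (W j t \<omega>)" by (simp add: dist_real_def)
            also have "\<dots> \<le> R l"
            proof (intro less_imp_le D(2))
              show "t \<in> {0..real (Suc b)}" using t b by simp
              show "real i * h \<in> {0..real (Suc b)}" using fc(1) b h by auto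
              show "dist (real i * h) t < D j" using fc hd \<delta>(2)[of j] by (simp add: dist_real_def)
            qed
            finally show ?thesis .
          qed
          then have "near_origin (R l) (\<lambda>j. grid_inc (path \<omega>) h (fst j) (snd j)) i"
            by (simp add: near_origin_def)
          then show ?case unfolding H_def h_def[symmetric] by (intro CollectI conjI sp exI[of _ i] i)
        qed
        then show "\<omega> \<in> L b l" unfolding L_def eventually_sequentially by auto
      qed
      with nL show False by blast
    qed
  qed
qed

end

section \<open>The law of the iterated logarithm for the embedded sequence\<close>

theorem theorem7p1:
  fixes M :: "'a measure" and W1 W2 :: "real \<Rightarrow> 'a \<Rightarrow> real"
  assumes "prob_space M"
    and "prob_space.brownian_motion M 1 W1"
    and "prob_space.brownian_motion M 1 W2"
    and "prob_space.indep_processes M W1 W2"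
  defines "T \<equiv> \<lambda>n \<omega>. branch_time (\<lambda>t. W1 t \<omega>) (\<lambda>t. W2 t \<omega>) n"
    and "Y \<equiv> \<lambda>n \<omega>. branch_pos (\<lambda>t. W1 t \<omega>) (\<lambda>t. W2 t \<omega>) n"
  shows "AE \<omega> in M.
    limsup (\<lambda>n. ereal (Y n \<omega> / sqrt (2 * T n \<omega> * ln (ln (T n \<omega>))))) = 1"
proof -
  define W where "W j = (if j then W1 else W2)" for j
  interpret prob_space M by fact
  interpret brownian_pair M W
    by standard (auto simp: W_def assms)
  have "AE \<omega> in M. \<forall>N d. N \<ge> 40 \<longrightarrow> d > 0 \<longrightarrow> (\<exists>\<^sub>F k in sequentially. drive_event (path \<omega>) N d k)"
    using AE_drive_event by (simp add: AE_all_countable)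
  with AE_start AE_continuous AE_no_common_record AE_modulus_ok AE_grid_ok show ?thesis
  proof eventually_elim
    case (elim \<omega>)
    have "\<exists>t\<ge>0. path \<omega> True t < K" for K
    proof (rule driven_path_unbounded_below[where N = 40 and d = 1])
      show "grid_ok (path \<omega>) (real 40^2)" using elim(5) by (auto intro!: Rats_power)
    qed (use elim in auto)
    then interpret B: branching_pair "path \<omega>"
      using elim by unfold_locales auto
    have "limsup (\<lambda>n. ereal (B.Y n / lil_norm (B.T n))) = 1"
      using elim by (intro B.limsup_branch_pos) auto
    then show ?case
      unfolding B.Y_def B.T_def lil_norm_def by (simp add: Y_def T_def W_def)
  qed
qed

end
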